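(* Let $\alpha>0$, $0<q\leq 2$, $x\in\mathbb{R}$, let $w_x$ be a function of modulus of continuity type, and let $f\in\Omega_{\alpha,1,2}(w_x)$. Let $A=(a_{n,k})_{n,k\geq 0}$ be an infinite matrix of nonnegative real numbers such that $\sum_{k=0}^{\infty}a_{n,k}=1$ for every $n=0,1,2,\dots$ and $\lim_{n\to\infty}a_{n,0}=0$. Suppose that $(a_{n,k})_{k=0}^{\infty}\in GM({}_2\beta)$ for all $n$, uniformly in $n$; that is, there are constants $c>1$ and $K_0>0$ such that for all $n\geq 0$ and all integers $m\geq 1$ $$\sum_{k=m}^{2m-1}|a_{n,k}-a_{n,k+1}|\leq K_0\sum_{k=\max(1,[m/c])}^{[cm]}\frac{a_{n,k}}{k}.$$ Then, with this $c$, there is a constant $K>0$ independent of $n$ such that for all $n=0,1,2,\dots$ $$\left\{\sum_{k=0}^{\infty}a_{n,k}\left|S_{\frac{\alpha k}{2}}f(x)-f(x)\right|^{q}\right\}^{1/q}\leq K\left\{\sum_{k=0}^{\infty}a_{n,k}\left[w_x\left(\frac{\pi}{k+1}\right)+E_{\frac{\alpha k}{2^{1+[c]}}}(f)_{S^1}\right]^{q}\right\}^{1/q}.$$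
   Context: Notation: $[y]$ is the integer part of $y$; $\mathbb{N}=\{1,2,3,\dots\}$. $S^1$ is the class of all (complex-valued) functions on $\mathbb{R}$ that are almost periodic in the sense of Stepanov, with norm $\|f\|_{S^1}=\sup_{u\in\mathbb{R}}\frac1\pi\int_u^{u+\pi}|f(t)|\,dt$. The Fourier series of $f\in S^1$ is assumed to have the form $\sum_{\nu=-\infty}^{\infty}A_\nu(f)e^{i\lambda_\nu x}$, where $A_\nu(f)=\lim_{L\to\infty}\frac1L\int_0^L f(t)e^{-i\lambda_\nu t}\,dt$, and where the Fourier exponents satisfy $0=\lambda_0<\lambda_\nu<\lambda_{\nu+1}$ for $\nu\in\mathbb{N}$, $\lim_{\nu\to\infty}\lambda_\nu=\infty$, $\lambda_{-\nu}=-\lambda_\nu$, and $|A_\nu(f)|+|A_{-\nu}(f)|>0$ for $\nu\in\mathbb{N}$. (All frequencies with nonzero Fourier coefficient are among the $\lambda_\nu$.) Partial sums: $S_{\gamma}f(x)=\sum_{|\lambda_\nu|\leq\gamma}A_\nu(f)e^{i\lambda_\nu x}$ for $\gamma\ge 0$. $\Omega_{\alpha,1}$ (with $\alpha>0$ fixed) is the set of functions $f\in S^1$ that are bounded on $\mathbb{R}$ and whose Fourier exponents satisfy $\lambda_{\nu+1}-\lambda_\nu\geq\alpha$ for all $\nu\in\mathbb{N}$. Best approximation: for $\sigma\geq0$, $E_\sigma(f)_{S^1}=\inf_{g}\|f-g\|_{S^1}$, the infimum taken over the class $B_\sigma$ of entire functions $g$ of exponential type (at most) $\sigma$ that are bounded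 on the real axis. For fixed $x$, $\varphi_x(t)=f(x+t)+f(x-t)-2f(x)$, and for $\delta>0$ $$G_xf(\delta)_{2,1}=\left\{\sum_{k=0}^{[\pi/(\alpha\delta)]}\left(\frac{1}{(k+1)\delta}\int_{k\delta}^{(k+1)\delta}|\varphi_x(t)|\,dt\right)^{2}\right\}^{1/2}.$$ A function $w_x:[0,\infty)\to[0,\infty)$ is of modulus of continuity type if it is nondecreasing, continuous, $w_x(0)=0$, and $w_x(\delta_1+\delta_2)\leq w_x(\delta_1)+w_x(\delta_2)$ for all $\delta_1,\delta_2\geq0$. $\Omega_{\alpha,1,2}(w_x)$ is the set of $f\in\Omega_{\alpha,1}$ for which there is a constant $C>0$ such that for all $\gamma,\delta>0$ (and both choices of sign) $$\frac1\delta\int_0^\delta|\varphi_x(t)-\varphi_x(t\pm\gamma)|\,dt\leq C\,w_x(\gamma)\quad\text{and}\quad G_xf(\delta)_{2,1}\leq C\,w_x(\delta).$$ *)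

theory Defs
  imports "HOL-Complex_Analysis.Complex_Analysis"
begin

definition stepanov_norm :: "(real \<Rightarrow> complex) \<Rightarrow> real" where
  "stepanov_norm f = (SUP u. (1 / pi) * integral {u..u + pi} (\<lambda>t. norm (f t)))"

(* The bound is required for every u instead of through stepanov_norm, because the real-valued
   supremum is meaningless when the window means are unbounded.  In particular, members of the
   class have finite Stepanov norm. *)
definition stepanov_translation_number :: "(real \<Rightarrow> complex) \<Rightarrow> real \<Rightarrow> real \<Rightarrow> bool" where
  "stepanov_translation_number f \<epsilon> \<tau> \<longleftrightarrow>
     (\<forall>u. (1 / pi) * integral {u..u + pi} (\<lambda>t. norm (f (t + \<tau>) - f t)) \<le> \<epsilon>)"

(* Stepanov almost periodicity: locally Lebesgue integrable, with relatively dense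
   epsilon-translation numbers for every epsilon. *)
definition stepanov_ap :: "(real \<Rightarrow> complex) set" where
  "stepanov_ap = {f. (\<forall>a b. f absolutely_integrable_on {a..b}) \<and>
     (\<forall>\<epsilon>>0. \<exists>l>0. \<forall>a. \<exists>\<tau>\<in>{a..a + l}. stepanov_translation_number f \<epsilon> \<tau>)}"

definition fourier_coeff :: "(real \<Rightarrow> complex) \<Rightarrow> real \<Rightarrow> complex" where
  "fourier_coeff f \<mu> =
     Lim at_top (\<lambda>L::real. of_real (1 / L) * integral {0..L} (\<lambda>t. f t * exp (- \<i> * of_real (\<mu> * t))))"

(* These conditions determine lam uniquely from f. *)
definition fourier_exponents :: "(real \<Rightarrow> complex) \<Rightarrow> (int \<Rightarrow> real) \<Rightarrow> bool" where
  "fourier_exponents f lam \<longleftrightarrow>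
     lam 0 = 0 \<and>
     (\<forall>\<nu>\<ge>1. 0 < lam \<nu> \<and> lam \<nu> < lam (\<nu> + 1)) \<and>
     filterlim lam at_top at_top \<and>
     (\<forall>\<nu>. lam (- \<nu>) = - lam \<nu>) \<and>
     (\<forall>\<nu>\<ge>1. norm (fourier_coeff f (lam \<nu>)) + norm (fourier_coeff f (lam (- \<nu>))) > 0) \<and>
     (\<forall>\<mu>. fourier_coeff f \<mu> \<noteq> 0 \<longrightarrow> \<mu> \<in> range lam)"

(* The index set is finite whenever fourier_exponents f lam holds. *)
definition partial_sum :: "(int \<Rightarrow> real) \<Rightarrow> real \<Rightarrow> (real \<Rightarrow> complex) \<Rightarrow> real \<Rightarrow> complex" where
  "partial_sum lam \<gamma> f x =
     (\<Sum>\<nu> | \<bar>lam \<nu>\<bar> \<le> \<gamma>. fourier_coeff f (lam \<nu>) * exp (\<i> * of_real (lam \<nu> * x)))"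

definition Omega1 :: "real \<Rightarrow> (real \<Rightarrow> complex) set" where
  "Omega1 \<alpha> = {f \<in> stepanov_ap. bounded (range f) \<and>
     (\<exists>lam. fourier_exponents f lam \<and> (\<forall>\<nu>\<ge>1. lam (\<nu> + 1) - lam \<nu> \<ge> \<alpha>))}"

definition exp_type_bounded :: "real \<Rightarrow> (complex \<Rightarrow> complex) set" where
  "exp_type_bounded \<sigma> = {g. g holomorphic_on UNIV \<and>
     (\<forall>\<epsilon>>0. \<exists>M. \<forall>z. norm (g z) \<le> M * exp ((\<sigma> + \<epsilon>) * norm z)) \<and>
     bounded (range (\<lambda>t::real. g (of_real t)))}"

definition best_approx :: "real \<Rightarrow> (real \<Rightarrow> complex) \<Rightarrow> real" where
  "best_approx \<sigma> f = (INF g\<in>exp_type_bounded \<sigma>. stepanov_norm (\<lambda>t. f t - g (of_real t)))"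

definition phi :: "(real \<Rightarrow> complex) \<Rightarrow> real \<Rightarrow> real \<Rightarrow> complex" where
  "phi f x t = f (x + t) + f (x - t) - 2 * f x"

definition G21 :: "real \<Rightarrow> (real \<Rightarrow> complex) \<Rightarrow> real \<Rightarrow> real \<Rightarrow> real" where
  "G21 \<alpha> f x \<delta> =
     sqrt (\<Sum>k = 0..nat \<lfloor>pi / (\<alpha> * \<delta>)\<rfloor>.
       ((1 / ((real k + 1) * \<delta>)) *
         integral {real k * \<delta>..(real k + 1) * \<delta>} (\<lambda>t. norm (phi f x t)))\<^sup>2)"

definition modulus_type :: "(real \<Rightarrow> real) \<Rightarrow> bool" where
  "modulus_type w \<longleftrightarrow>
     (\<forall>\<delta>\<ge>0. w \<delta> \<ge> 0) \<and> mono_on {0..} w \<and> continuous_on {0..} w \<and> w 0 = 0 \<and>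
     (\<forall>\<delta>1\<ge>0. \<forall>\<delta>2\<ge>0. w (\<delta>1 + \<delta>2) \<le> w \<delta>1 + w \<delta>2)"

definition Omega12 :: "real \<Rightarrow> real \<Rightarrow> (real \<Rightarrow> real) \<Rightarrow> (real \<Rightarrow> complex) set" where
  "Omega12 \<alpha> x w = {f \<in> Omega1 \<alpha>. \<exists>C>0. \<forall>\<gamma>>0. \<forall>\<delta>>0.
     (1 / \<delta>) * integral {0..\<delta>} (\<lambda>t. norm (phi f x t - phi f x (t + \<gamma>))) \<le> C * w \<gamma> \<and>
     (1 / \<delta>) * integral {0..\<delta>} (\<lambda>t. norm (phi f x t - phi f x (t - \<gamma>))) \<le> C * w \<gamma> \<and>
     G21 \<alpha> f x \<delta> \<le> C * w \<delta>}"

(* The class GM(2 beta) with its constants c and K0 exposed, so that uniformity in a family of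
   sequences can be expressed. *)
definition GM_2beta :: "real \<Rightarrow> real \<Rightarrow> (nat \<Rightarrow> real) set" where
  "GM_2beta c K0 = {a. \<forall>m\<ge>1.
     (\<Sum>k = m..2 * m - 1. \<bar>a k - a (k + 1)\<bar>)
       \<le> K0 * (\<Sum>k = max 1 (nat \<lfloor>real m / c\<rfloor>)..nat \<lfloor>c * real m\<rfloor>. a k / real k)}"

end

theory Submission
  imports Defs "HOL-Probability.Sinc_Integral"
begin

text \<open>
  For consecutive windows \<open>(\<alpha> * k / 2, \<alpha> * (k + 1) / 2)\<close> the gap condition leaves one of two neighbours free of
  exponents, and over a free window the partial sum is a convolution with a de la Vallee Poussin kernel.  This
  uses the uniqueness theorem for almost periodic functions, proved here by sampling \<open>h\<close> on a fine grid: if all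
  Fourier means of \<open>h\<close> vanish, Parseval's identity for the discrete transform makes the correlations of the samples
  small in quadratic mean, whereas near-periods of \<open>h\<close> keep a positive proportion of them large.

  The resulting integral of \<open>\<phi>\<^sub>x\<close> is cut at \<open>\<delta> = pi / (m * \<alpha>)\<close> and at about \<open>pi / \<alpha>\<close>.  For \<open>k\<close> in the dyadic block
  from \<open>m\<close> to \<open>2 * m\<close>, the middle part is bounded in quadratic mean by \<open>G21\<close> at \<open>\<delta>\<close> through Bessel's inequality,
  and the tail by shifting the variable through half a period of the oscillating factor.  The \<open>GM\<close> condition
  finally replaces the weights in a block by their average over a comparable range.
\<close>

subsection \<open>Discrete Fourier transforms and correlations\<close>

text \<open>The obstacle is that \<open>f\<close> is controlled only in Stepanov's mean, while its
  partial sums are needed at one point. A convolution of \<open>f\<close> with a kernel of decay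
  \<open>1 / (1 + t\<^sup>2)\<close> is uniformly continuous and almost periodic in the uniform
  norm, so Fourier means alone identify it with a partial sum at every point. For this the transform
  of the kernel must be 1 at the retained exponents and 0 at all others; a trapezoid whose slope
  lies over a free window has this property. All windows have the length
  \<open>\<alpha> / 2\<close>, so the kernels share one amplitude and only the frequency of one sine
  depends on \<open>k\<close>. Orthogonality in \<open>k\<close> is therefore available, and the
  middle part is estimated only in quadratic mean over a block, not for single \<open>k\<close>;
  exponents \<open>q \<le> 2\<close> are reached from there. The tail produces errors of order
  \<open>1 / m\<close>. As \<open>w pi \<le> m * w (pi / m)\<close>, they are absorbed unless
  \<open>w pi = 0\<close>; in that case \<open>w\<close> vanishes, the second difference of
  \<open>f\<close> at \<open>x\<close> is zero almost everywhere, and the deviations are 0.\<close>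

lemma sum_cis_orthogonal:
  fixes M j l :: nat
  assumes "j < M" "l < M"
  shows "(\<Sum>k<M. cis (2 * pi * (real j - real l) * real k / real M)) = (if j = l then of_nat M else 0)"
proof (cases "j = l")
  case False
  define z where "z = cis (2 * pi * (real j - real l) / real M)"
  have M: "M > 0" using assms by simp
  have zk: "z ^ k = cis (2 * pi * (real j - real l) * real k / real M)" for k
    by (simp add: z_def Complex.DeMoivre field_simps)
  have "z ^ M = cis (2 * pi * (real j - real l))" using M by (simp add: zk)
  also have "\<dots> = 1"
    using cis_multiple_2pi[of "real j - real l"] by (simp add: mult.commute)
  finally have zM: "z ^ M = 1" .
  have "z \<noteq> 1"
  proof
    assume "z = 1"
    then have "cos (2 * pi * (real j - real l) / real M) = 1"
      by (simp add: z_def complex_eq_iff)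
    then obtain i :: int where i: "2 * pi * (real j - real l) / real M = of_int i * 2 * pi"
      using cos_one_2pi_int by blast
    then have "2 * pi * (real j - real l) = 2 * pi * (of_int i * real M)"
      using M by (simp add: divide_eq_eq mult_ac)
    then have "real j - real l = of_int i * real M" by simp
    then have "int j - int l = i * int M" 
      by (metis (mono_tags, lifting) of_int_diff of_int_eq_iff of_int_mult of_int_of_nat_eq)
    then have "\<bar>i * int M\<bar> < int M" using assms by linarith
    then have "i = 0" using M by (auto simp: abs_mult)
    with \<open>int j - int l = i * int M\<close> False show False by simp
  qed
  then have "(\<Sum>k<M. z ^ k) = 0" using zM by (simp add: geometric_sum)
  then show ?thesis using False by (simp add: zk)
qed simp

lemma cis_mult_cnj_cis:
  "cis (2 * pi * a * k / M) * cnj (cis (2 * pi * b * k / M)) = cis (2 * pi * (a - b) * k / M)"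
  by (simp add: cis_cnj cis_mult algebra_simps diff_divide_distrib)

lemma dft_parseval:
  fixes g :: "nat \<Rightarrow> complex"
  shows "(\<Sum>k<M. (norm (\<Sum>j<M. g j * cis (2 * pi * real j * real k / real M)))\<^sup>2)
    = real M * (\<Sum>j<M. (norm (g j))\<^sup>2)"
proof -
  let ?e = "\<lambda>j k. cis (2 * pi * real j * real k / real M)"
  have "complex_of_real (\<Sum>k<M. (norm (\<Sum>j<M. g j * ?e j k))\<^sup>2)
      = (\<Sum>k<M. (\<Sum>j<M. g j * ?e j k) * cnj (\<Sum>l<M. g l * ?e l k))"
    unfolding of_real_sum complex_norm_square ..
  also have "\<dots> = (\<Sum>k<M. \<Sum>j<M. \<Sum>l<M. g j * cnj (g l) * cis (2 * pi * (real j - real l) * real k / real M))"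
    unfolding cnj_sum sum_product cis_mult_cnj_cis[symmetric] by (simp only: complex_cnj_mult mult_ac)
  also have "\<dots> = (\<Sum>j<M. \<Sum>l<M. \<Sum>k<M. g j * cnj (g l) * cis (2 * pi * (real j - real l) * real k / real M))"
    by (subst sum.swap, rule sum.cong[OF refl], subst sum.swap, rule refl)
  also have "\<dots> = (\<Sum>j<M. \<Sum>l<M. g j * cnj (g l) * (if j = l then of_nat M else 0))"
    by (intro sum.cong refl) (simp only: sum_distrib_left[symmetric] sum_cis_orthogonal lessThan_iff)
  also have "\<dots> = (\<Sum>j<M. of_nat M * (g j * cnj (g j)))"
    by (intro sum.cong refl) (simp add: if_distrib sum.delta cong: if_cong)
  also have "\<dots> = complex_of_real (real M * (\<Sum>j<M. (norm (g j))\<^sup>2))"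
    unfolding of_real_mult of_real_sum complex_norm_square by (simp add: sum_distrib_left)
  finally show ?thesis using of_real_eq_iff by blast
qed

text \<open>Padding to the period \<open>2 * N\<close> keeps \<open>j + u\<close> below the period,
  so the correlations are cyclic and their transform is the product of the transforms of
  \<open>a\<close> and of the conjugate of \<open>b\<close>. Parseval is applied to this product and
  then to \<open>a\<close>, with the factor belonging to \<open>b\<close> replaced by its uniform
  bound \<open>D\<close>.\<close>

lemma correlation_bound:
  fixes a b :: "nat \<Rightarrow> complex"
  assumes D: "\<And>k. k < 2 * N \<Longrightarrow> norm (\<Sum>j<N. b j * cis (- (2 * pi * real k / real (2 * N)) * real j)) \<le> D"
  shows "(\<Sum>u<N. (norm (\<Sum>j<N. a (j + u) * cnj (b j)))\<^sup>2) \<le> D\<^sup>2 * (\<Sum>j<2 * N. (norm (a j))\<^sup>2)"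
proof (cases "N = 0")
  case False
  define M where "M = 2 * N"
  have M: "M > 0" using False by (simp add: M_def)
  let ?e = "\<lambda>j k. cis (2 * pi * real j * real k / real M)"
  define A where "A k = (\<Sum>j<M. a j * cnj (?e j k))" for k
  define C where "C k = (\<Sum>j<N. cnj (b j) * ?e j k)" for k
  have inv: "of_nat M * a j = (\<Sum>k<M. A k * ?e j k)" if "j < M" for j
  proof -
    have "(\<Sum>k<M. A k * ?e j k) = (\<Sum>k<M. \<Sum>l<M. a l * cis (2 * pi * (real j - real l) * real k / real M))"
      unfolding A_def sum_distrib_right cis_mult_cnj_cis[symmetric] by (simp only: mult_ac)
    also have "\<dots> = (\<Sum>l<M. \<Sum>k<M. a l * cis (2 * pi * (real j - real l) * real k / real M))"
      by (rule sum.swap)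
    also have "\<dots> = (\<Sum>l<M. a l * (if j = l then of_nat M else 0))"
      using that
      by (intro sum.cong refl) (simp only: sum_distrib_left[symmetric] sum_cis_orthogonal lessThan_iff)
    also have "\<dots> = of_nat M * a j" using that by (simp add: if_distrib sum.delta cong: if_cong)
    finally show ?thesis by simp
  qed
  have r: "of_nat M * (\<Sum>j<N. a (j + u) * cnj (b j)) = (\<Sum>k<M. A k * C k * ?e k u)" if "u < N" for u
  proof -
    have "of_nat M * (\<Sum>j<N. a (j + u) * cnj (b j)) = (\<Sum>j<N. (of_nat M * a (j + u)) * cnj (b j))"
      by (simp add: sum_distrib_left mult.assoc)
    also have "\<dots> = (\<Sum>j<N. (\<Sum>k<M. A k * ?e (j + u) k) * cnj (b j))"
      using that by (intro sum.cong refl, subst inv) (auto simp: M_def)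
    also have "\<dots> = (\<Sum>j<N. \<Sum>k<M. A k * (cnj (b j) * ?e j k) * ?e k u)"
      by (simp add: sum_distrib_right cis_mult[symmetric] distrib_left distrib_right add_divide_distrib) (simp add: mult_ac)
    also have "\<dots> = (\<Sum>k<M. A k * C k * ?e k u)"
      by (subst sum.swap) (simp add: C_def sum_distrib_left sum_distrib_right)
    finally show ?thesis .
  qed
  have C: "norm (C k) \<le> D" if "k < M" for k
  proof -
    have "C k = cnj (\<Sum>j<N. b j * cis (- (2 * pi * real k / real (2 * N)) * real j))"
      by (simp add: C_def cis_cnj M_def mult_ac)
    then show ?thesis using D[of k] that by (simp add: M_def del: cnj_sum)
  qed
  have "(real M)\<^sup>2 * (\<Sum>u<N. (norm (\<Sum>j<N. a (j + u) * cnj (b j)))\<^sup>2)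
     = (\<Sum>u<N. (norm (of_nat M * (\<Sum>j<N. a (j + u) * cnj (b j))))\<^sup>2)"
    by (simp add: norm_mult power_mult_distrib flip: sum_distrib_left)
  also have "\<dots> = (\<Sum>u<N. (norm (\<Sum>k<M. A k * C k * ?e k u))\<^sup>2)"
    by (intro sum.cong refl) (simp only: r lessThan_iff)
  \<comment> \<open>Parseval needs the full period; the additional terms only enlarge the
    sum.\<close>
  also have "\<dots> \<le> (\<Sum>u<M. (norm (\<Sum>k<M. A k * C k * ?e k u))\<^sup>2)"
    by (intro sum_mono2) (auto simp: M_def)
  also have "\<dots> = real M * (\<Sum>k<M. (norm (A k * C k))\<^sup>2)" by (rule dft_parseval)
  also have "\<dots> \<le> real M * (\<Sum>k<M. D\<^sup>2 * (norm (A k))\<^sup>2)"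
    using C by (intro mult_left_mono sum_mono) (auto simp: norm_mult power_mult_distrib mult.commute[of "D\<^sup>2"] intro!: mult_left_mono power_mono)
  also have "(\<Sum>k<M. D\<^sup>2 * (norm (A k))\<^sup>2) = D\<^sup>2 * (\<Sum>k<M. (norm (\<Sum>j<M. cnj (a j) * ?e j k))\<^sup>2)"
  proof -
    have "norm (A k) = norm (\<Sum>j<M. cnj (a j) * ?e j k)" for k
    proof -
      have "A k = cnj (\<Sum>j<M. cnj (a j) * ?e j k)" by (simp add: A_def)
      then show ?thesis by (metis complex_mod_cnj)
    qed
    then show ?thesis by (simp add: sum_distrib_left)
  qed
  also have "\<dots> = D\<^sup>2 * (real M * (\<Sum>j<M. (norm (a j))\<^sup>2))" by (simp only: dft_parseval complex_mod_cnj)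
  finally have "(real M)\<^sup>2 * (\<Sum>u<N. (norm (\<Sum>j<N. a (j + u) * cnj (b j)))\<^sup>2)
    \<le> (real M)\<^sup>2 * (D\<^sup>2 * (\<Sum>j<M. (norm (a j))\<^sup>2))" by (simp add: power2_eq_square mult_ac)
  then show ?thesis using M by (simp add: M_def)
qed simp

section \<open>Elementary bounds for exponentials\<close>

text \<open>The derivative \<open>cos t - 1 / 2\<close> is nonnegative up to \<open>pi / 3\<close>.
  Beyond that point \<open>sin y\<close> is at least \<open>sqrt 3 / 2\<close>, which exceeds
  \<open>pi / 4\<close>.\<close>

lemma sin_ge_half:
  fixes y :: real assumes "0 \<le> y" "y \<le> pi / 2" shows "y / 2 \<le> sin y"
proof (cases "y \<le> pi / 3")
  case True
  have "(\<lambda>y. sin y - y / 2) 0 \<le> (\<lambda>y. sin y - y / 2) y"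
  proof (rule DERIV_nonneg_imp_nondecreasing[OF assms(1)])
    fix t assume t: "0 \<le> t" "t \<le> y"
    have "cos t \<ge> cos (pi / 3)" using t True by (intro cos_monotone_0_pi_le) auto
    then have "cos t - 1 / 2 \<ge> 0" by (simp add: cos_60)
    moreover have "((\<lambda>y. sin y - y / 2) has_real_derivative (cos t - 1 / 2)) (at t)"
      by (auto intro!: derivative_eq_intros)
    ultimately show "\<exists>y. ((\<lambda>y. sin y - y / 2) has_real_derivative y) (at t) \<and> 0 \<le> y" by blast
  qed
  then show ?thesis by simp
next
  case False
  have "sin (pi / 3) \<le> sin y" using False assms by (intro sin_monotone_2pi_le) auto
  moreover have "sqrt 3 \<ge> 1.7" by (rule real_le_rsqrt) (simp add: power2_eq_square)
  moreover have "pi < 3.2" using pi_approx by simp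
  ultimately show ?thesis using assms by (simp add: sin_60)
qed

lemma norm_cis_diff_1_ge:
  assumes "\<bar>\<theta>\<bar> \<le> pi" shows "norm (cis \<theta> - 1) \<ge> \<bar>\<theta>\<bar> / 2"
proof -
  have "norm (cis \<theta> - 1) = 2 * \<bar>sin (\<theta> / 2)\<bar>" using dist_exp_i_1[of \<theta>] by (simp add: cis_conv_exp)
  moreover have "\<bar>\<theta>\<bar> / 2 / 2 \<le> sin (\<bar>\<theta>\<bar> / 2)" using assms by (intro sin_ge_half) auto
  moreover have "sin (\<bar>\<theta>\<bar> / 2) \<le> \<bar>sin (\<theta> / 2)\<bar>" by (simp add: abs_if)
  ultimately show ?thesis by linarith
qed

lemma integral_cis:
  fixes \<delta> \<mu> :: real
  assumes "\<delta> \<ge> 0" "\<mu> \<noteq> 0"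
  shows "((\<lambda>t. cis (\<mu> * t)) has_integral (cis (\<mu> * \<delta>) - 1) / (\<i> * of_real \<mu>)) {0..\<delta>}"
proof -
  have "((\<lambda>t. cis (\<mu> * t)) has_integral ((\<lambda>t. cis (\<mu> * t) / (\<i> * of_real \<mu>)) \<delta> - (\<lambda>t. cis (\<mu> * t) / (\<i> * of_real \<mu>)) 0)) {0..\<delta>}"
  proof (rule fundamental_theorem_of_calculus[OF assms(1)])
    fix t
    have "((\<lambda>z. exp (\<i> * of_real \<mu> * z) / (\<i> * of_real \<mu>)) has_field_derivative exp (\<i> * of_real \<mu> * of_real t)) (at (of_real t))"
      using assms by (auto intro!: derivative_eq_intros)
    then have "((\<lambda>t. exp (\<i> * of_real \<mu> * of_real t) / (\<i> * of_real \<mu>)) has_vector_derivative exp (\<i> * of_real \<mu> * of_real t)) (at t)"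
      by (rule has_vector_derivative_real_field)
    then show "((\<lambda>t. cis (\<mu> * t) / (\<i> * of_real \<mu>)) has_vector_derivative cis (\<mu> * t)) (at t within {0..\<delta>})"
      by (auto simp: cis_conv_exp mult.assoc intro: has_vector_derivative_at_within)
  qed
  then show ?thesis by (simp add: diff_divide_distrib)
qed

text \<open>A window of length \<open>\<delta>\<close> does not destroy frequencies up to
  \<open>pi / \<delta>\<close>. This lower bound permits dividing by the transform of the window,
  both when integrals are replaced by samples and when a function is averaged before Bessel's
  inequality.\<close>

lemma norm_integral_cis_ge:
  fixes \<delta> \<mu> :: real
  assumes "\<delta> \<ge> 0" "\<bar>\<mu> * \<delta>\<bar> \<le> pi"
  shows "norm (integral {0..\<delta>} (\<lambda>t. cis (\<mu> * t))) \<ge> \<delta> / 2"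
proof (cases "\<mu> = 0")
  case True then show ?thesis using assms by simp
next
  case False
  have "\<bar>\<mu> * \<delta>\<bar> / 2 \<le> norm (cis (\<mu> * \<delta>) - 1)" using assms by (intro norm_cis_diff_1_ge) auto
  then show ?thesis using assms(1) False
    unfolding integral_unique[OF integral_cis[OF assms(1) False]]
    by (simp add: norm_divide norm_mult abs_mult pos_le_divide_eq mult_ac)
qed

subsection \<open>Almost periodic functions\<close>

text \<open>Total boundedness of the set of translates in the uniform norm. A finite net of
  translates passes to sums and products by combining nets, and it feeds the pigeonhole count in
  \<open>near_period_count\<close> directly.\<close>

definition bochner_ap :: "(real \<Rightarrow> complex) \<Rightarrow> bool" where
  "bochner_ap h \<longleftrightarrow> (\<forall>\<epsilon>>0. \<exists>F. finite F \<and> (\<forall>s. \<exists>r\<in>F. \<forall>t. norm (h (t + s) - h (t + r)) \<le> \<epsilon>))"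

lemma norm_diff_le_of_half:
  fixes a b c :: complex
  assumes "norm (a - b) \<le> e / 2" "norm (c - b) \<le> e / 2" shows "norm (a - c) \<le> e"
  using norm_triangle_ineq4[of "a - b" "c - b"] assms by simp

lemma norm_diff_mono:
  fixes a b :: complex
  assumes "norm a \<le> x" "norm b \<le> y" shows "norm (a - b) \<le> x + y"
  using norm_triangle_ineq4[of a b] assms by simp

lemma norm_add_mono:
  fixes a b :: complex
  assumes "norm a \<le> x" "norm b \<le> y" shows "norm (a + b) \<le> x + y"
  using norm_triangle_ineq[of a b] assms by simp

text \<open>Each shift falls into a cell given by a pair of net points. One shift chosen from every
  occupied cell serves both functions; two members of a cell are within twice the radius, hence nets
  of radius \<open>\<epsilon> / 2\<close>.\<close>

lemma bochner_ap_pair: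
  assumes "bochner_ap g" "bochner_ap h" "\<epsilon> > 0"
  shows "\<exists>F. finite F \<and> (\<forall>s. \<exists>r\<in>F. \<forall>t. norm (g (t + s) - g (t + r)) \<le> \<epsilon> \<and> norm (h (t + s) - h (t + r)) \<le> \<epsilon>)"
proof -
  obtain F1 where F1: "finite F1" "\<And>s. \<exists>r\<in>F1. \<forall>t. norm (g (t + s) - g (t + r)) \<le> \<epsilon> / 2"
    using assms unfolding bochner_ap_def by (meson half_gt_zero)
  obtain F2 where F2: "finite F2" "\<And>s. \<exists>r\<in>F2. \<forall>t. norm (h (t + s) - h (t + r)) \<le> \<epsilon> / 2"
    using assms unfolding bochner_ap_def by (meson half_gt_zero)
  define P where "P i j s \<longleftrightarrow> (\<forall>t. norm (g (t + s) - g (t + i)) \<le> \<epsilon> / 2) \<and> (\<forall>t. norm (h (t + s) - h (t + j)) \<le> \<epsilon> / 2)"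
    for i j s
  define F where "F = (\<lambda>(i, j). SOME s. P i j s) ` (F1 \<times> F2)"
  have "\<exists>r\<in>F. \<forall>t. norm (g (t + s) - g (t + r)) \<le> \<epsilon> \<and> norm (h (t + s) - h (t + r)) \<le> \<epsilon>" for s
  proof -
    obtain i j where ij: "i \<in> F1" "j \<in> F2" "P i j s" using F1(2)[of s] F2(2)[of s] unfolding P_def by blast
    define r where "r = (SOME s. P i j s)"
    have r: "P i j r" unfolding r_def by (rule someI, rule ij(3))
    have "r \<in> F" using ij unfolding F_def r_def by force
    moreover have "norm (g (t + s) - g (t + r)) \<le> \<epsilon>" for t
      using ij r by (rule_tac norm_diff_le_of_half[of _ "g (t + i)"]) (auto simp: P_def)
    moreover have "norm (h (t + s) - h (t + r)) \<le> \<epsilon>" for t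
      using ij r by (rule_tac norm_diff_le_of_half[of _ "h (t + j)"]) (auto simp: P_def)
    ultimately show ?thesis by (intro bexI[of _ r]) auto
  qed
  moreover have "finite F" using F1 F2 by (simp add: F_def)
  ultimately show ?thesis by blast
qed

lemma bochner_ap_diff:
  assumes "bochner_ap g" "bochner_ap h" shows "bochner_ap (\<lambda>t. g t - h t)"
  unfolding bochner_ap_def
proof (intro allI impI)
  fix \<epsilon> :: real assume "\<epsilon> > 0"
  then obtain F where F: "finite F" "\<And>s. \<exists>r\<in>F. \<forall>t. norm (g (t + s) - g (t + r)) \<le> \<epsilon> / 2 \<and> norm (h (t + s) - h (t + r)) \<le> \<epsilon> / 2"
    using bochner_ap_pair[OF assms, of "\<epsilon> / 2"] by auto
  have "\<exists>r\<in>F. \<forall>t. norm (g (t + s) - h (t + s) - (g (t + r) - h (t + r))) \<le> \<epsilon>" for s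
  proof -
    obtain r where r: "r \<in> F" "\<And>t. norm (g (t + s) - g (t + r)) \<le> \<epsilon> / 2 \<and> norm (h (t + s) - h (t + r)) \<le> \<epsilon> / 2"
      using F(2) by blast
    have "norm (g (t + s) - h (t + s) - (g (t + r) - h (t + r))) \<le> \<epsilon>" for t
    proof -
      have "norm ((g (t + s) - g (t + r)) - (h (t + s) - h (t + r))) \<le> \<epsilon> / 2 + \<epsilon> / 2"
        using r(2)[of t] by (intro norm_diff_mono) auto
      then show ?thesis by (simp add: algebra_simps)
    qed
    with r show ?thesis by blast
  qed
  with F show "\<exists>F. finite F \<and> (\<forall>s. \<exists>r\<in>F. \<forall>t. norm (g (t + s) - h (t + s) - (g (t + r) - h (t + r))) \<le> \<epsilon>)" by blast
qed

lemma bochner_ap_mult: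
  assumes "bochner_ap g" "bochner_ap h" and B: "\<And>t. norm (g t) \<le> B" "\<And>t. norm (h t) \<le> B"
  shows "bochner_ap (\<lambda>t. g t * h t)"
  unfolding bochner_ap_def
proof (intro allI impI)
  fix \<epsilon> :: real assume \<epsilon>: "\<epsilon> > 0"
  have B0: "B \<ge> 0" using B(1)[of 0] norm_ge_zero order_trans by blast
  \<comment> \<open>The summand 1 keeps the denominator positive when \<open>B = 0\<close>.\<close>
  define \<eta> where "\<eta> = \<epsilon> / (2 * (B + 1))"
  have \<eta>: "\<eta> > 0" using \<epsilon> B0 by (simp add: \<eta>_def)
  have "2 * (B + 1) * \<eta> = \<epsilon>" using B0 by (simp add: \<eta>_def)
  then have \<eta>2: "\<eta> * B + B * \<eta> \<le> \<epsilon>" using \<eta> by (simp add: algebra_simps)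
  obtain F where F: "finite F" "\<And>s. \<exists>r\<in>F. \<forall>t. norm (g (t + s) - g (t + r)) \<le> \<eta> \<and> norm (h (t + s) - h (t + r)) \<le> \<eta>"
    using bochner_ap_pair[OF assms(1,2) \<eta>] by auto
  have "\<exists>r\<in>F. \<forall>t. norm (g (t + s) * h (t + s) - g (t + r) * h (t + r)) \<le> \<epsilon>" for s
  proof -
    obtain r where r: "r \<in> F" "\<And>t. norm (g (t + s) - g (t + r)) \<le> \<eta> \<and> norm (h (t + s) - h (t + r)) \<le> \<eta>"
      using F(2) by blast
    have "norm (g (t + s) * h (t + s) - g (t + r) * h (t + r)) \<le> \<epsilon>" for t
    proof -
      have "norm ((g (t + s) - g (t + r)) * h (t + s) + g (t + r) * (h (t + s) - h (t + r))) \<le> \<eta> * B + B * \<eta>"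
        using r(2)[of t] B B0 \<eta> by (intro norm_add_mono) (auto simp: norm_mult intro!: mult_mono)
      with \<eta>2 show ?thesis by (simp add: algebra_simps)
    qed
    with r show ?thesis by blast
  qed
  with F show "\<exists>F. finite F \<and> (\<forall>s. \<exists>r\<in>F. \<forall>t. norm (g (t + s) * h (t + s) - g (t + r) * h (t + r)) \<le> \<epsilon>)" by blast
qed

lemma bochner_ap_const: "bochner_ap (\<lambda>t. c)"
  unfolding bochner_ap_def by (intro allI impI exI[of _ "{0}"]) auto

text \<open>A translation multiplies the function by a unit complex number, so a finite net of the
  unit circle gives a finite net of translates; \<open>Arg z / \<mu>\<close> is a shift that
  realises the phase \<open>z\<close>.\<close>

lemma bochner_ap_cis: "bochner_ap (\<lambda>t. cis (\<mu> * t))"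
proof (cases "\<mu> = 0")
  case True then show ?thesis using bochner_ap_const[of "cis 0"] by simp
next
  case False
  show ?thesis unfolding bochner_ap_def
  proof (intro allI impI)
    fix \<epsilon> :: real assume "\<epsilon> > 0"
    have "seq_compact (sphere (0::complex) 1)" by (simp add: compact_imp_seq_compact)
    from seq_compact_imp_totally_bounded[OF this, rule_format, OF \<open>\<epsilon> > 0\<close>]
    obtain k :: "complex set" where k: "finite k" "k \<subseteq> sphere 0 1" "sphere 0 1 \<subseteq> (\<Union>x\<in>k. ball x \<epsilon>)" by auto
    define F where "F = (\<lambda>z. Arg z / \<mu>) ` k"
    have "\<exists>r\<in>F. \<forall>t. norm (cis (\<mu> * (t + s)) - cis (\<mu> * (t + r))) \<le> \<epsilon>" for s
    proof -
      have "cis (\<mu> * s) \<in> (\<Union>x\<in>k. ball x \<epsilon>)" by (rule subsetD[OF k(3)]) simp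
      then obtain z where z: "z \<in> k" "dist z (cis (\<mu> * s)) < \<epsilon>" by auto
      have z1: "norm z = 1" using k(2) z(1) by auto
      then have "z \<noteq> 0" by auto
      then have "cis (Arg z) = z" using z1 by (simp add: cis_Arg sgn_eq)
      then have "norm (cis (\<mu> * s) - cis (\<mu> * (Arg z / \<mu>))) \<le> \<epsilon>" using z(2) False by (simp add: dist_norm norm_minus_commute)
      moreover have "norm (cis (\<mu> * (t + s)) - cis (\<mu> * (t + r))) = norm (cis (\<mu> * s) - cis (\<mu> * r))" for t r
      proof -
        have "cis (\<mu> * (t + s)) - cis (\<mu> * (t + r)) = cis (\<mu> * t) * (cis (\<mu> * s) - cis (\<mu> * r))"
          by (simp add: right_diff_distrib cis_mult distrib_left)
        then show ?thesis by (simp add: norm_mult)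
      qed
      ultimately show ?thesis using z(1) unfolding F_def by auto
    qed
    moreover have "finite F" using k by (simp add: F_def)
    ultimately show "\<exists>F. finite F \<and> (\<forall>s. \<exists>r\<in>F. \<forall>t. norm (cis (\<mu> * (t + s)) - cis (\<mu> * (t + r))) \<le> \<epsilon>)" by blast
  qed
qed

lemma bochner_ap_cmult: "bochner_ap h \<Longrightarrow> (\<And>t. norm (h t) \<le> B) \<Longrightarrow> bochner_ap (\<lambda>t. c * h t)"
  by (rule bochner_ap_mult[where B="max B (norm c)"]) (auto simp: bochner_ap_const le_max_iff_disj)

lemma bochner_ap_diff_sum:
  assumes "finite I" "bochner_ap g" "\<And>i. i \<in> I \<Longrightarrow> bochner_ap (h i)"
  shows "bochner_ap (\<lambda>t. g t - (\<Sum>i\<in>I. h i t))"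
  using assms(1,3)
proof (induction I rule: finite_induct)
  case empty then show ?case using assms by simp
next
  case (insert i I)
  then have "bochner_ap (\<lambda>t. g t - (\<Sum>i\<in>I. h i t))" "bochner_ap (h i)" by auto
  from bochner_ap_diff[OF this] show ?case using insert by (simp add: algebra_simps)
qed

text \<open>Bohr's condition implies Bochner's: a near-period moves any shift \<open>s\<close> into
  \<open>{0..l}\<close>, and there finitely many representatives suffice by uniform
  continuity.\<close>

lemma bochner_apI_relatively_dense:
  assumes uc: "uniformly_continuous_on UNIV h"
    and rd: "\<And>\<epsilon>. \<epsilon> > 0 \<Longrightarrow> \<exists>l>0. \<forall>a. \<exists>\<tau>\<in>{a..a + l}. \<forall>t. norm (h (t + \<tau>) - h t) \<le> \<epsilon>"
  shows "bochner_ap h"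
  unfolding bochner_ap_def
proof (intro allI impI)
  fix \<epsilon> :: real assume \<epsilon>: "\<epsilon> > 0"
  obtain \<delta> where \<delta>: "\<delta> > 0" "\<And>s t. dist s t < \<delta> \<Longrightarrow> dist (h s) (h t) < \<epsilon> / 2"
    using uniformly_continuous_onE[OF uc, of "\<epsilon> / 2"] \<epsilon> by (metis UNIV_I dist_commute half_gt_zero)
  obtain l where l: "l > 0" "\<And>a. \<exists>\<tau>\<in>{a..a + l}. \<forall>t. norm (h (t + \<tau>) - h t) \<le> \<epsilon> / 2" using rd[of "\<epsilon> / 2"] \<epsilon> by auto
  have "seq_compact {0..l}" by (simp add: compact_imp_seq_compact)
  then obtain F where F: "finite F" "F \<subseteq> {0..l}" "{0..l} \<subseteq> (\<Union>x\<in>F. ball x \<delta>)"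
    using seq_compact_imp_totally_bounded[of "{0..l}"] \<delta>(1) by blast
  have "\<exists>r\<in>F. \<forall>t. norm (h (t + s) - h (t + r)) \<le> \<epsilon>" for s
  proof -
    obtain \<tau> where \<tau>: "\<tau> \<in> {- s..- s + l}" "\<And>t. norm (h (t + \<tau>) - h t) \<le> \<epsilon> / 2" using l(2) by blast
    have "s + \<tau> \<in> (\<Union>x\<in>F. ball x \<delta>)" using \<tau>(1) by (intro subsetD[OF F(3)]) auto
    then obtain r where r: "r \<in> F" "dist r (s + \<tau>) < \<delta>" by auto
    have "norm (h (t + s) - h (t + r)) \<le> \<epsilon>" for t
    proof -
      have "dist (t + s + \<tau>) (t + r) < \<delta>" using r(2) by (auto simp: dist_real_def)
      from \<delta>(2)[OF this] have "norm (h (t + s + \<tau>) - h (t + r)) \<le> \<epsilon> / 2" by (simp add: dist_norm)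
      then have "norm ((h (t + s + \<tau>) - h (t + r)) - (h (t + s + \<tau>) - h (t + s))) \<le> \<epsilon> / 2 + \<epsilon> / 2"
        using \<tau>(2)[of "t + s"] by (intro norm_diff_mono)
      then show ?thesis by simp
    qed
    with r(1) show ?thesis by blast
  qed
  with F(1) show "\<exists>F. finite F \<and> (\<forall>s. \<exists>r\<in>F. \<forall>t. norm (h (t + s) - h (t + r)) \<le> \<epsilon>)" by blast
qed

section \<open>Means over long windows\<close>

lemma norm_integral_le:
  fixes g :: "real \<Rightarrow> complex"
  assumes "g integrable_on {a..b}" "a \<le> b" "\<And>t. t \<in> {a..b} \<Longrightarrow> norm (g t) \<le> B"
  shows "norm (integral {a..b} g) \<le> B * (b - a)"
proof -
  have "norm (integral {a..b} g) \<le> integral {a..b} (\<lambda>t. B)"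
    using assms by (intro Henstock_Kurzweil_Integration.integral_norm_bound_integral) auto
  then show ?thesis using assms(2) by (simp add: mult.commute)
qed

lemma diff_eq_diff_of_add_eq:
  fixes a w v u z :: complex
  assumes "a + w = z" "v + u = z" shows "w - v = u - a"
proof -
  have "w = z - a" "u = z - v" by (metis add_diff_cancel_left' assms)+
  then show ?thesis by simp
qed

text \<open>The two integrals differ by two end pieces of length \<open>\<bar>r\<bar>\<close>, so
  the bound does not grow with \<open>T\<close>. For negative \<open>r\<close> the windows exchange
  roles.\<close>

lemma integral_window_shift:
  fixes g :: "real \<Rightarrow> complex"
  assumes ig: "\<And>a b. g integrable_on {a..b}" and B: "\<And>t. norm (g t) \<le> B" and "T \<ge> 0"
  shows "norm (integral {r..r + T} g - integral {0..T} g) \<le> 2 * \<bar>r\<bar> * B"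
proof -
  have *: "norm (integral {u + r..u + r + T} g - integral {u..u + T} g) \<le> 2 * r * B" if "r \<ge> 0" for u r
  proof -
    have "integral {u..u + r} g + integral {u + r..u + r + T} g = integral {u..u + r + T} g"
      using that assms by (intro Henstock_Kurzweil_Integration.integral_combine) auto
    moreover have "integral {u..u + T} g + integral {u + T..u + r + T} g = integral {u..u + r + T} g"
      using that assms by (intro Henstock_Kurzweil_Integration.integral_combine) auto
    ultimately have "integral {u + r..u + r + T} g - integral {u..u + T} g = integral {u + T..u + r + T} g - integral {u..u + r} g"
      by (rule diff_eq_diff_of_add_eq)
    also have "norm \<dots> \<le> B * (u + r + T - (u + T)) + B * (u + r - u)"
      using that assms by (intro norm_diff_mono norm_integral_le) auto
    finally show ?thesis by (simp add: mult_ac)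
  qed
  show ?thesis
  proof (cases "r \<ge> 0")
    case True then show ?thesis using *[of r 0] by simp
  next
    case False
    then show ?thesis using *[of "- r" r] by (simp add: norm_minus_commute)
  qed
qed

text \<open>Up to \<open>\<epsilon> / 2\<close> at each point, every translate is one of finitely
  many, and for these the shift costs at most \<open>2 * R * B\<close>, independently of
  \<open>T\<close>. The threshold \<open>T0\<close> makes that at most
  \<open>\<epsilon> / 2 * T\<close>.\<close>

lemma bochner_ap_mean_uniform:
  assumes ap: "bochner_ap g" and ig: "\<And>a b. g integrable_on {a..b}" and B: "\<And>t. norm (g t) \<le> B" and \<epsilon>: "\<epsilon> > 0"
  shows "\<exists>T0>0. \<forall>T\<ge>T0. \<forall>a. norm (integral {a..a + T} g - integral {0..T} g) \<le> \<epsilon> * T"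
proof -
  have B0: "B \<ge> 0" using B[of 0] norm_ge_zero order_trans by blast
  obtain F where F: "finite F" "\<And>s. \<exists>r\<in>F. \<forall>t. norm (g (t + s) - g (t + r)) \<le> \<epsilon> / 2"
    using ap \<epsilon> unfolding bochner_ap_def by (meson half_gt_zero)
  define R where "R = (\<Sum>r\<in>F. \<bar>r\<bar>)"
  have R: "\<bar>r\<bar> \<le> R" if "r \<in> F" for r unfolding R_def using F(1) that by (intro member_le_sum) auto
  have R0: "R \<ge> 0" by (simp add: R_def sum_nonneg)
  define T0 where "T0 = 4 * R * B / \<epsilon> + 1"
  have "T0 > 0" using B0 R0 \<epsilon> by (simp add: T0_def add_nonneg_pos)
  moreover have "norm (integral {a..a + T} g - integral {0..T} g) \<le> \<epsilon> * T" if T: "T \<ge> T0" for T a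
  proof -
    have T0: "T \<ge> 0" using T \<open>T0 > 0\<close> by simp
    obtain r where r: "r \<in> F" "\<And>t. norm (g (t + a) - g (t + r)) \<le> \<epsilon> / 2" using F(2) by blast
    have sh: "(\<lambda>t. g (t + s)) integrable_on {0..T}" "integral {s..s + T} g = integral {0..T} (\<lambda>t. g (t + s))" for s
      using integral_shift_Icc_real[of 0 T g s] integrable_on_shift_Icc_real[of g s 0 T] ig
      by (simp_all add: o_def add.commute)
    have "norm (integral {a..a + T} g - integral {r..r + T} g) = norm (integral {0..T} (\<lambda>t. g (t + a) - g (t + r)))"
      by (simp add: sh Henstock_Kurzweil_Integration.integral_diff)
    also have "\<dots> \<le> \<epsilon> / 2 * (T - 0)" using sh r(2) T0 by (intro norm_integral_le integrable_diff) auto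
    finally have "norm (integral {a..a + T} g - integral {r..r + T} g) \<le> \<epsilon> / 2 * T" by simp
    moreover have "norm (integral {r..r + T} g - integral {0..T} g) \<le> \<epsilon> / 2 * T"
    proof -
      have "norm (integral {r..r + T} g - integral {0..T} g) \<le> 2 * \<bar>r\<bar> * B" using integral_window_shift[OF ig B T0] .
      also have "\<dots> \<le> 2 * R * B" using R[OF r(1)] B0 by (intro mult_mono) auto
      also have "\<dots> \<le> \<epsilon> / 2 * T" using T \<epsilon> by (simp add: T0_def field_simps)
      finally show ?thesis .
    qed
    ultimately show ?thesis using norm_add_mono[of "integral {a..a + T} g - integral {r..r + T} g" "\<epsilon> / 2 * T" "integral {r..r + T} g - integral {0..T} g" "\<epsilon> / 2 * T"]
      by (simp add: mult.commute)
  qed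
  ultimately show ?thesis by blast
qed

text \<open>A window of length \<open>S\<close> consists of about \<open>S / T\<close> windows of
  length \<open>T\<close> and a remainder. Means over windows of equal length hardly depend on the
  position, so the mean over \<open>S\<close> is close to that over \<open>T\<close>, and the means
  satisfy a Cauchy condition.\<close>

lemma bochner_ap_mean_exists:
  assumes ap: "bochner_ap g" and ig: "\<And>a b. g integrable_on {a..b}" and B: "\<And>t. norm (g t) \<le> B"
  shows "\<exists>l. ((\<lambda>T. integral {0..T} g / of_real T) \<longlongrightarrow> l) at_top"
proof -
  define m where "m T = integral {0..T} g / of_real T" for T
  have near: "\<exists>T0>0. \<forall>T\<ge>T0. eventually (\<lambda>S. norm (m S - m T) \<le> \<epsilon>) at_top" if \<epsilon>: "\<epsilon> > 0" for \<epsilon>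
  proof -
    have B0: "B \<ge> 0" using B[of 0] norm_ge_zero order_trans by blast
    obtain T0 where T0: "T0 > 0" "\<And>T a. T \<ge> T0 \<Longrightarrow> norm (integral {a..a + T} g - integral {0..T} g) \<le> \<epsilon> / 2 * T"
      using bochner_ap_mean_uniform[OF ap ig B, of "\<epsilon> / 2"] \<epsilon> by auto
    have "eventually (\<lambda>S. norm (m S - m T) \<le> \<epsilon>) at_top" if T: "T \<ge> T0" for T
    proof -
      have Tp: "T > 0" using T T0 by simp
      have blk: "norm (integral {0..real n * T} g - of_nat n * integral {0..T} g) \<le> real n * (\<epsilon> / 2 * T)" for n
      proof (induction n)
        case (Suc n)
        have "integral {0..real n * T} g + integral {real n * T..real (Suc n) * T} g = integral {0..real (Suc n) * T} g"
          using Tp ig by (intro Henstock_Kurzweil_Integration.integral_combine) (auto simp: field_simps)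
        then have "integral {0..real (Suc n) * T} g - of_nat (Suc n) * integral {0..T} g
          = (integral {0..real n * T} g - of_nat n * integral {0..T} g) + (integral {real n * T..real n * T + T} g - integral {0..T} g)"
          by (simp add: algebra_simps)
        also have "norm \<dots> \<le> real n * (\<epsilon> / 2 * T) + \<epsilon> / 2 * T" using T0(2)[OF T] Suc by (intro norm_add_mono)
        finally show ?case by (simp add: algebra_simps)
      qed simp
      \<comment> \<open>The threshold makes the two boundary errors, together
        \<open>2 * B * T\<close>, at most half of \<open>\<epsilon> * S\<close>.\<close>
      have "norm (m S - m T) \<le> \<epsilon>" if S: "S \<ge> 4 * B * T / \<epsilon> + T" for S
      proof -
        have Sp: "S > 0" "S \<ge> T" 
        proof -
          have "4 * B * T / \<epsilon> \<ge> 0" using Tp B0 \<epsilon> by simp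
          then show "S > 0" "S \<ge> T" using S Tp by linarith+
        qed
        define n where "n = nat \<lfloor>S / T\<rfloor>"
        have n: "real n \<le> S / T" "S / T < real n + 1" unfolding n_def using Sp Tp by (auto intro: of_nat_floor)
        then have n': "real n * T \<le> S" "S < real n * T + T" using Tp by (auto simp: field_simps)
        have "integral {0..real n * T} g + integral {real n * T..S} g = integral {0..S} g"
          using n' Tp ig by (intro Henstock_Kurzweil_Integration.integral_combine) auto
        then have "integral {0..S} g - of_real (S / T) * integral {0..T} g
          = (integral {0..real n * T} g - of_nat n * integral {0..T} g) + integral {real n * T..S} g 
            - of_real (S / T - real n) * integral {0..T} g" by (simp add: algebra_simps)
        also have "norm \<dots> \<le> (real n * (\<epsilon> / 2 * T) + B * T) + 1 * (B * T)"
        proof (intro norm_diff_mono norm_add_mono blk)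
          have "norm (integral {real n * T..S} g) \<le> B * (S - real n * T)" using n' ig B by (intro norm_integral_le) auto
          also have "\<dots> \<le> B * T" using n' B0 by (intro mult_left_mono) auto
          finally show "norm (integral {real n * T..S} g) \<le> B * T" .
          have "norm (integral {0..T} g) \<le> B * (T - 0)" using Tp ig B by (intro norm_integral_le) auto
          then show "norm (of_real (S / T - real n) * integral {0..T} g) \<le> 1 * (B * T)"
            using n unfolding norm_mult norm_of_real by (intro mult_mono) auto
        qed
        also have "\<dots> \<le> S * (\<epsilon> / 2) + 2 * B * T" 
          using mult_right_mono[OF n'(1), of "\<epsilon> / 2"] \<epsilon> by (simp add: mult_ac)
        also have "2 * B * T \<le> S * (\<epsilon> / 2)" 
        proof -
          have "4 * B * T / \<epsilon> \<le> S" using S Tp by simp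
          then show ?thesis using \<epsilon> by (simp add: pos_divide_le_eq)
        qed
        finally have "norm (integral {0..S} g - of_real (S / T) * integral {0..T} g) \<le> S * \<epsilon>" by simp
        moreover have "m S - m T = (integral {0..S} g - of_real (S / T) * integral {0..T} g) / of_real S"
          using Sp Tp by (simp add: m_def diff_divide_distrib)
        ultimately show ?thesis using Sp by (simp add: norm_divide pos_divide_le_eq mult.commute)
      qed
      then show ?thesis unfolding eventually_at_top_linorder by blast
    qed
    then show ?thesis using T0(1) by blast
  qed
  have "Cauchy (\<lambda>n. m (real n))"
  proof (rule CauchyI)
    fix e :: real assume e: "e > 0"
    obtain T0 where T0: "T0 > 0" "\<And>T. T \<ge> T0 \<Longrightarrow> eventually (\<lambda>S. norm (m S - m T) \<le> e / 3) at_top"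
      using near[of "e / 3"] e by auto
    have "norm (m (real i) - m (real j)) < e" if "i \<ge> nat \<lceil>T0\<rceil>" "j \<ge> nat \<lceil>T0\<rceil>" for i j
    proof -
      have ij: "real i \<ge> T0" "real j \<ge> T0" using that by linarith+
      obtain S where "norm (m S - m (real i)) \<le> e / 3" "norm (m S - m (real j)) \<le> e / 3"
        using eventually_happens'[OF _ eventually_conj[OF T0(2)[OF ij(1)] T0(2)[OF ij(2)]]] by auto
      then have "norm ((m S - m (real j)) - (m S - m (real i))) \<le> e / 3 + e / 3" by (intro norm_diff_mono)
      then show ?thesis using e by simp
    qed
    then show "\<exists>M. \<forall>i\<ge>M. \<forall>j\<ge>M. norm (m (real i) - m (real j)) < e" by blast
  qed
  then obtain l where l: "(\<lambda>n. m (real n)) \<longlonglongrightarrow> l" using Cauchy_convergent_iff convergent_def by blast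
  have "(m \<longlongrightarrow> l) at_top"
  proof (rule tendstoI)
    fix e :: real assume e: "e > 0"
    obtain T0 where T0: "T0 > 0" "\<And>T. T \<ge> T0 \<Longrightarrow> eventually (\<lambda>S. norm (m S - m T) \<le> e / 3) at_top"
      using near[of "e / 3"] e by auto
    have "eventually (\<lambda>n. real n \<ge> T0) sequentially" using filterlim_real_sequentially by (simp add: filterlim_at_top)
    moreover have "eventually (\<lambda>n. dist (m (real n)) l < e / 3) sequentially" using tendstoD[OF l, of "e / 3"] e by simp
    ultimately obtain n where n: "real n \<ge> T0" "dist (m (real n)) l < e / 3"
      using eventually_happens'[OF _ eventually_conj] sequentially_bot by blast
    show "eventually (\<lambda>S. dist (m S) l < e) at_top"
      using T0(2)[OF n(1)]
    proof eventually_elim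
      case (elim S)
      have "dist (m S) l \<le> dist (m S) (m (real n)) + dist (m (real n)) l" by (rule dist_triangle)
      then show ?case using elim n(2) e by (simp add: dist_norm)
    qed
  qed
  then show ?thesis unfolding m_def by blast
qed

subsection \<open>The uniqueness theorem\<close>

lemma norm_cis_minus_one_le: "norm (cis x - 1) \<le> \<bar>x\<bar>"
proof -
  have "norm (cis x - 1) = 2 * \<bar>sin (x / 2)\<bar>" using dist_exp_i_1[of x] by (simp add: cis_conv_exp)
  also have "\<dots> \<le> 2 * \<bar>x / 2\<bar>" using abs_sin_le_one abs_sin_x_le_abs_x[of "x / 2"] by simp
  finally show ?thesis by simp
qed

text \<open>\<open>zero\<close> is a limit for each frequency separately. Smallness on windows of
  length \<open>T1 \<mu>\<close> persists for frequencies within \<open>r \<mu>\<close>, because the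
  phases hardly drift over that length; tiling extends it to all long windows, and compactness of
  the frequency range makes the threshold common.\<close>

lemma uniform_small_means:
  assumes ap: "bochner_ap h" and cont: "continuous_on UNIV h" and B: "\<And>t. norm (h t) \<le> B"
    and zero: "\<And>\<mu>. ((\<lambda>T. integral {0..T} (\<lambda>t. h t * cis (- (\<mu> * t))) / of_real T) \<longlongrightarrow> 0) at_top"
    and \<epsilon>: "\<epsilon> > 0"
  shows "\<exists>T0>0. \<forall>T\<ge>T0. \<forall>a. \<forall>\<mu>. \<bar>\<mu>\<bar> \<le> \<Lambda> \<longrightarrow> norm (integral {a..a + T} (\<lambda>t. h t * cis (- (\<mu> * t)))) \<le> \<epsilon> * T"
proof -
  have B0: "B \<ge> 0" using B[of 0] norm_ge_zero order_trans by blast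
  define g where "g \<mu> t = h t * cis (- (\<mu> * t))" for \<mu> t
  have cont': "continuous_on S h" for S using cont continuous_on_subset by blast
  have ig: "g \<mu> integrable_on {a..b}" for \<mu> a b unfolding g_def
    by (intro integrable_continuous_interval continuous_intros cont')
  have gB: "norm (g \<mu> t) \<le> B" for \<mu> t using B by (simp add: g_def norm_mult)
  have "\<exists>T1>0. \<forall>a. norm (integral {a..a + T1} (g \<mu>)) \<le> \<epsilon> / 4 * T1" for \<mu>
  proof -
    have "bochner_ap (\<lambda>t. h t * cis ((- \<mu>) * t))"
      using ap B by (intro bochner_ap_mult[where B="max B 1"] bochner_ap_cis) (auto simp: le_max_iff_disj)
    then have "bochner_ap (g \<mu>)" by (simp add: g_def[abs_def])
    from bochner_ap_mean_uniform[OF this ig gB, of "\<epsilon> / 8"] \<epsilon>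
    obtain T0 where T0: "T0 > 0" "\<And>T a. T \<ge> T0 \<Longrightarrow> norm (integral {a..a + T} (g \<mu>) - integral {0..T} (g \<mu>)) \<le> \<epsilon> / 8 * T" by auto
    have "eventually (\<lambda>T. dist (integral {0..T} (g \<mu>) / of_real T) 0 < \<epsilon> / 8) at_top"
      using tendstoD[OF zero[of \<mu>], of "\<epsilon> / 8"] \<epsilon> by (simp add: g_def[abs_def])
    then obtain T where T: "T \<ge> T0" "dist (integral {0..T} (g \<mu>) / of_real T) 0 < \<epsilon> / 8"
      using eventually_happens'[OF _ eventually_conj[OF _ eventually_ge_at_top[of T0]]] by (auto simp: )
    have Tp: "T > 0" using T T0 by simp
    have "norm (integral {0..T} (g \<mu>)) \<le> \<epsilon> / 8 * T" using T(2) Tp by (simp add: norm_divide divide_less_eq)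
    then have "norm (integral {a..a + T} (g \<mu>)) \<le> \<epsilon> / 4 * T" for a
      using norm_add_mono[OF T0(2)[OF T(1), of a], of "integral {0..T} (g \<mu>)" "\<epsilon> / 8 * T"] by (simp add: mult.commute)
    with Tp show ?thesis by blast
  qed
  then obtain T1 where T1: "\<And>\<mu>. T1 \<mu> > 0" "\<And>\<mu> a. norm (integral {a..a + T1 \<mu>} (g \<mu>)) \<le> \<epsilon> / 4 * T1 \<mu>" by metis
  \<comment> \<open>Chosen so that \<open>B\<close> times the phase drift over a window of length
    \<open>T1 \<mu>\<close> is at most \<open>\<epsilon> / 4\<close>.\<close>
  define r where "r \<mu> = \<epsilon> / (4 * (B + 1) * T1 \<mu>)" for \<mu>
  have r: "r \<mu> > 0" for \<mu> using \<epsilon> B0 T1(1)[of \<mu>] by (simp add: r_def)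
  have loc: "norm (integral {a..a + T} (g \<nu>)) \<le> \<epsilon> * T"
    if \<nu>: "\<bar>\<nu> - \<mu>\<bar> < r \<mu>" and T: "T \<ge> 2 * B * T1 \<mu> / \<epsilon>" "T > 0" for \<mu> \<nu> a T
  proof -
    let ?S = "T1 \<mu>"
    have S: "?S > 0" by (rule T1)
    have "\<bar>\<nu> - \<mu>\<bar> * (4 * (B + 1) * ?S) \<le> \<epsilon>" using \<nu> S B0 by (simp add: r_def pos_less_divide_eq)
    moreover have "\<bar>\<nu> - \<mu>\<bar> * (4 * B * ?S) \<le> \<bar>\<nu> - \<mu>\<bar> * (4 * (B + 1) * ?S)" using S by (intro mult_left_mono mult_right_mono) auto
    ultimately have small: "B * (\<bar>\<nu> - \<mu>\<bar> * ?S) \<le> \<epsilon> / 4" by (simp add: mult_ac)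
    have blk: "norm (integral {a..a + ?S} (g \<nu>)) \<le> \<epsilon> / 2 * ?S" for a
    proof -
      \<comment> \<open>The factor \<open>cis ((\<nu> - \<mu>) * a)\<close> aligns the two
        exponentials at the left end \<open>a\<close>, so the drift depends on the length of the
        window and not on its position.\<close>
      have "norm (integral {a..a + ?S} (\<lambda>t. cis ((\<nu> - \<mu>) * a) * g \<nu> t - g \<mu> t)) \<le> \<epsilon> / 4 * (a + ?S - a)"
      proof (intro norm_integral_le integrable_diff ig)
        show "(\<lambda>t. cis ((\<nu> - \<mu>) * a) * g \<nu> t) integrable_on {a..a + ?S}"
          using ig by (intro integrable_on_mult_right)
        fix t assume t: "t \<in> {a..a + ?S}"
        have "cis ((\<nu> - \<mu>) * a) * g \<nu> t = g \<mu> t * cis (- ((\<nu> - \<mu>) * (t - a)))"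
          by (simp add: g_def mult.assoc mult.left_commute[of _ "h t"] cis_mult algebra_simps)
        then have "cis ((\<nu> - \<mu>) * a) * g \<nu> t - g \<mu> t = g \<mu> t * (cis (- ((\<nu> - \<mu>) * (t - a))) - 1)"
          by (simp add: algebra_simps)
        also have "norm \<dots> \<le> B * \<bar>- ((\<nu> - \<mu>) * (t - a))\<bar>"
          unfolding norm_mult by (intro mult_mono gB norm_cis_minus_one_le) (use B0 in auto)
        also have "\<dots> \<le> B * (\<bar>\<nu> - \<mu>\<bar> * ?S)"
          using t B0 by (intro mult_left_mono) (auto simp: abs_mult intro!: mult_left_mono)
        finally show "norm (cis ((\<nu> - \<mu>) * a) * g \<nu> t - g \<mu> t) \<le> \<epsilon> / 4" using small by simp
      qed (use S in auto)
      also have "integral {a..a + ?S} (\<lambda>t. cis ((\<nu> - \<mu>) * a) * g \<nu> t - g \<mu> t)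
        = cis ((\<nu> - \<mu>) * a) * integral {a..a + ?S} (g \<nu>) - integral {a..a + ?S} (g \<mu>)"
        by (subst Henstock_Kurzweil_Integration.integral_diff) (auto intro: ig integrable_on_mult_right)
      finally have *: "norm (cis ((\<nu> - \<mu>) * a) * integral {a..a + ?S} (g \<nu>) - integral {a..a + ?S} (g \<mu>)) \<le> \<epsilon> / 4 * (a + ?S - a)" .
      have "norm (cis ((\<nu> - \<mu>) * a) * integral {a..a + ?S} (g \<nu>)) \<le> \<epsilon> / 4 * (a + ?S - a) + \<epsilon> / 4 * ?S"
        using norm_add_mono[OF * T1(2)[where \<mu>=\<mu> and a=a]] by simp
      then show ?thesis by (simp add: norm_mult)
    qed
    have blks: "norm (integral {a..a + real n * ?S} (g \<nu>)) \<le> real n * (\<epsilon> / 2 * ?S)" for n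
    proof (induction n)
      case (Suc n)
      have "integral {a..a + real n * ?S} (g \<nu>) + integral {a + real n * ?S..a + real (Suc n) * ?S} (g \<nu>) = integral {a..a + real (Suc n) * ?S} (g \<nu>)"
        using S ig by (intro Henstock_Kurzweil_Integration.integral_combine) (auto simp: field_simps)
      then have "integral {a..a + real (Suc n) * ?S} (g \<nu>) = integral {a..a + real n * ?S} (g \<nu>) + integral {a + real n * ?S..a + real n * ?S + ?S} (g \<nu>)"
        by (simp add: algebra_simps)
      also have "norm \<dots> \<le> real n * (\<epsilon> / 2 * ?S) + \<epsilon> / 2 * ?S" using blk Suc by (intro norm_add_mono)
      finally show ?case by (simp add: algebra_simps)
    qed simp
    define n where "n = nat \<lfloor>T / ?S\<rfloor>"
    have n: "real n \<le> T / ?S" "T / ?S < real n + 1" unfolding n_def using S T by (auto intro: of_nat_floor)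
    then have n': "real n * ?S \<le> T" "T < real n * ?S + ?S" using S by (auto simp: field_simps)
    have "integral {a..a + real n * ?S} (g \<nu>) + integral {a + real n * ?S..a + T} (g \<nu>) = integral {a..a + T} (g \<nu>)"
      using n' S ig by (intro Henstock_Kurzweil_Integration.integral_combine) auto
    then have "integral {a..a + T} (g \<nu>) = integral {a..a + real n * ?S} (g \<nu>) + integral {a + real n * ?S..a + T} (g \<nu>)" by simp
    also have "norm \<dots> \<le> real n * (\<epsilon> / 2 * ?S) + B * ?S"
    proof (rule norm_add_mono[OF blks])
      have "norm (integral {a + real n * ?S..a + T} (g \<nu>)) \<le> B * (a + T - (a + real n * ?S))"
        using n' ig gB by (intro norm_integral_le) auto
      also have "\<dots> \<le> B * ?S" using n' B0 by (intro mult_left_mono) auto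
      finally show "norm (integral {a + real n * ?S..a + T} (g \<nu>)) \<le> B * ?S" .
    qed
    also have "real n * (\<epsilon> / 2 * ?S) \<le> T * (\<epsilon> / 2)" using mult_right_mono[OF n'(1), of "\<epsilon> / 2"] \<epsilon> by (simp add: mult_ac)
    also have "B * ?S \<le> T * (\<epsilon> / 2)" using T(1) \<epsilon> by (simp add: pos_divide_le_eq)
    finally show ?thesis by (simp add: mult.commute)
  qed
  obtain D where D: "D \<subseteq> {- \<Lambda>..\<Lambda>}" "finite D" "{- \<Lambda>..\<Lambda>} \<subseteq> (\<Union>\<mu>\<in>D. ball \<mu> (r \<mu>))"
  proof (rule compactE_image[of "{- \<Lambda>..\<Lambda>}" "{- \<Lambda>..\<Lambda>}" "\<lambda>\<mu>. ball \<mu> (r \<mu>)"])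
    show "{- \<Lambda>..\<Lambda>} \<subseteq> (\<Union>\<mu>\<in>{- \<Lambda>..\<Lambda>}. ball \<mu> (r \<mu>))" using r by auto
  qed auto
  define T0 where "T0 = 1 + (\<Sum>\<mu>\<in>D. 2 * B * T1 \<mu> / \<epsilon>)"
  have nn: "2 * B * T1 \<mu> / \<epsilon> \<ge> 0" for \<mu> using B0 T1(1)[of \<mu>] \<epsilon> by simp
  have T0: "T0 > 0" unfolding T0_def by (intro add_pos_nonneg sum_nonneg nn) auto
  have "norm (integral {a..a + T} (\<lambda>t. h t * cis (- (\<nu> * t)))) \<le> \<epsilon> * T" if "T \<ge> T0" "\<bar>\<nu>\<bar> \<le> \<Lambda>" for T a \<nu>
  proof -
    have "\<nu> \<in> (\<Union>\<mu>\<in>D. ball \<mu> (r \<mu>))" using that(2) by (intro subsetD[OF D(3)]) auto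
    then obtain \<mu> where \<mu>: "\<mu> \<in> D" "\<bar>\<nu> - \<mu>\<bar> < r \<mu>" by (auto simp: dist_real_def abs_minus_commute)
    have "2 * B * T1 \<mu> / \<epsilon> \<le> (\<Sum>\<mu>\<in>D. 2 * B * T1 \<mu> / \<epsilon>)" using \<mu>(1) D(2) nn by (intro member_le_sum) auto
    then have "2 * B * T1 \<mu> / \<epsilon> \<le> T" using that(1) by (simp add: T0_def)
    from loc[OF \<mu>(2) this, of a] show ?thesis using T0 that(1) by (simp add: g_def[abs_def])
  qed
  with T0 show ?thesis by blast
qed

text \<open>On each cell of length \<open>\<delta>\<close> the function is frozen at the left end.
  The exponential of frequency \<open>\<theta> / \<delta>\<close> then integrates over the cell with
  index \<open>j\<close> to \<open>cis (- (\<theta> * real j))\<close> times a factor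
  \<open>I\<close> common to all cells, and \<open>I\<close> has norm at least
  \<open>\<delta> / 2\<close>.\<close>

lemma sample_sum_bound:
  assumes cont: "continuous_on UNIV h" and \<delta>: "\<delta> > 0"
    and osc: "\<And>s t. \<bar>s - t\<bar> \<le> \<delta> \<Longrightarrow> norm (h s - h t) \<le> \<epsilon>" and \<theta>: "\<bar>\<theta>\<bar> \<le> pi"
  shows "\<delta> / 2 * norm (\<Sum>j<N. h (x + real j * \<delta>) * cis (- (\<theta> * real j)))
    \<le> norm (integral {x..x + real N * \<delta>} (\<lambda>t. h t * cis (- (\<theta> / \<delta> * t)))) + \<epsilon> * (real N * \<delta>)"
proof -
  define g where "g t = h t * cis (- (\<theta> / \<delta> * t))" for t
  have cont': "continuous_on S h" for S using cont continuous_on_subset by blast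
  have ig: "g integrable_on {a..b}" for a b unfolding g_def
    by (intro integrable_continuous_interval continuous_intros cont')
  define c where "c t = cis (- (\<theta> / \<delta>) * t)" for t
  have ic: "c integrable_on {a..b}" for a b unfolding c_def
    by (intro integrable_continuous_interval continuous_intros)
  define I where "I = c x * integral {0..\<delta>} c"
  have blk: "norm (integral {x + real j * \<delta>..x + real j * \<delta> + \<delta>} g - h (x + real j * \<delta>) * cis (- (\<theta> * real j)) * I) \<le> \<epsilon> * \<delta>" for j
  proof -
    let ?y = "x + real j * \<delta>"
    have "c (t + ?y) = cis (- (\<theta> * real j)) * c x * c t" for t
      using \<delta> by (simp add: c_def cis_mult algebra_simps)
    then have "h ?y * cis (- (\<theta> * real j)) * I = integral {0..\<delta>} (\<lambda>t. h ?y * c (t + ?y))"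
      by (simp add: I_def mult_ac)
    also have "\<dots> = integral {?y..?y + \<delta>} (\<lambda>t. h ?y * c t)"
      using integral_shift_Icc_real[of 0 \<delta> "\<lambda>t. h ?y * c t" ?y] by (simp add: o_def add_ac)
    finally have "integral {?y..?y + \<delta>} g - h ?y * cis (- (\<theta> * real j)) * I
      = integral {?y..?y + \<delta>} (\<lambda>t. g t - h ?y * c t)"
      using ig ic by (simp add: Henstock_Kurzweil_Integration.integral_diff integrable_on_mult_right)
    also have "norm \<dots> \<le> \<epsilon> * (?y + \<delta> - ?y)"
    proof (intro norm_integral_le integrable_diff ig integrable_on_mult_right ic)
      fix t assume t: "t \<in> {?y..?y + \<delta>}"
      have "g t - h ?y * c t = (h t - h ?y) * c t" by (simp add: g_def c_def algebra_simps)
      then show "norm (g t - h ?y * c t) \<le> \<epsilon>" using osc[of t ?y] t by (simp add: norm_mult c_def)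
    qed (use \<delta> in auto)
    finally show ?thesis by simp
  qed
  have tot: "norm (integral {x..x + real N * \<delta>} g - (\<Sum>j<N. h (x + real j * \<delta>) * cis (- (\<theta> * real j))) * I) \<le> real N * (\<epsilon> * \<delta>)"
  proof (induction N)
    case (Suc N)
    have "integral {x..x + real N * \<delta>} g + integral {x + real N * \<delta>..x + real (Suc N) * \<delta>} g = integral {x..x + real (Suc N) * \<delta>} g"
      using \<delta> ig by (intro Henstock_Kurzweil_Integration.integral_combine) (auto simp: field_simps)
    then have "integral {x..x + real (Suc N) * \<delta>} g - (\<Sum>j<Suc N. h (x + real j * \<delta>) * cis (- (\<theta> * real j))) * I
      = (integral {x..x + real N * \<delta>} g - (\<Sum>j<N. h (x + real j * \<delta>) * cis (- (\<theta> * real j))) * I)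
       + (integral {x + real N * \<delta>..x + real N * \<delta> + \<delta>} g - h (x + real N * \<delta>) * cis (- (\<theta> * real N)) * I)"
      by (simp add: algebra_simps)
    also have "norm \<dots> \<le> real N * (\<epsilon> * \<delta>) + \<epsilon> * \<delta>" by (rule norm_add_mono[OF Suc blk])
    finally show ?case by (simp add: algebra_simps)
  qed simp
  have "norm (integral {0..\<delta>} c) \<ge> \<delta> / 2" using \<theta> \<delta> unfolding c_def by (intro norm_integral_cis_ge) auto
  then have "norm I \<ge> \<delta> / 2" by (simp add: I_def norm_mult c_def)
  then have "\<delta> / 2 * norm (\<Sum>j<N. h (x + real j * \<delta>) * cis (- (\<theta> * real j)))
    \<le> norm ((\<Sum>j<N. h (x + real j * \<delta>) * cis (- (\<theta> * real j))) * I)"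
    unfolding norm_mult by (subst mult.commute) (intro mult_left_mono, auto)
  also have "\<dots> \<le> norm (integral {x..x + real N * \<delta>} g) + real N * (\<epsilon> * \<delta>)"
    using norm_diff_mono[OF order_refl tot, of "integral {x..x + real N * \<delta>} g"] by simp
  finally show ?thesis by (simp add: g_def[abs_def] mult_ac)
qed

text \<open>Pigeonhole principle: differences of indices whose translates are close to the same \<open>r\<close> are near-periods.\<close>

lemma near_period_count:
  fixes h :: "real \<Rightarrow> complex" and \<delta> :: real
  assumes F: "finite F" "\<And>s. \<exists>r\<in>F. \<forall>t. norm (h (t + s) - h (t + r)) \<le> \<eta> / 2"
  shows "real N \<le> real (card F) * real (card {u. u < N \<and> (\<forall>t. norm (h (t + real u * \<delta>) - h t) \<le> \<eta>)})"
    (is "_ \<le> _ * real (card ?U)")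
proof -
  define A where "A r = {u. u < N \<and> (\<forall>t. norm (h (t + real u * \<delta>) - h (t + r)) \<le> \<eta> / 2)}" for r
  have fin: "finite (A r)" for r by (simp add: A_def)
  have cU: "card (A r) \<le> card ?U" for r
  proof (cases "A r = {}")
    case False
    \<comment> \<open>Subtracting the least element is injective and keeps the differences natural
      numbers below \<open>N\<close>.\<close>
    define v where "v = Min (A r)"
    have v: "v \<in> A r" "\<And>u. u \<in> A r \<Longrightarrow> v \<le> u" using False fin by (auto simp: v_def)
    have "inj_on (\<lambda>u. u - v) (A r)" using v(2) by (auto simp: inj_on_def) (metis le_add_diff_inverse)
    moreover have "(\<lambda>u. u - v) ` A r \<subseteq> ?U"
    proof clarsimp
      fix u assume u: "u \<in> A r"
      have vu: "v \<le> u" using v(2) u by simp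
      have "norm (h (t + real (u - v) * \<delta>) - h t) \<le> \<eta>" for t
      proof (rule norm_diff_le_of_half)
        let ?t = "t - real v * \<delta>"
        have e: "t + real (u - v) * \<delta> = ?t + real u * \<delta>" using vu by (simp add: of_nat_diff algebra_simps)
        show "norm (h (t + real (u - v) * \<delta>) - h (?t + r)) \<le> \<eta> / 2" using u unfolding e by (auto simp: A_def)
        have "norm (h (?t + real v * \<delta>) - h (?t + r)) \<le> \<eta> / 2" using v(1) unfolding A_def by blast
        then show "norm (h t - h (?t + r)) \<le> \<eta> / 2" by simp
      qed
      then show "u - v < N \<and> (\<forall>t. norm (h (t + real (u - v) * \<delta>) - h t) \<le> \<eta>)" using u by (auto simp: A_def)
    qed
    ultimately show ?thesis by (intro card_inj_on_le[of "\<lambda>u. u - v"]) auto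
  qed simp
  have "{..<N} \<subseteq> (\<Union>r\<in>F. A r)" using F(2) by (auto simp: A_def)
  then have "card {..<N} \<le> card (\<Union>r\<in>F. A r)" using F(1) fin by (intro card_mono) auto
  then have "N \<le> (\<Sum>r\<in>F. card (A r))" using card_UN_le[OF F(1), of A] by simp
  also have "\<dots> \<le> (\<Sum>r\<in>F. card ?U)" by (intro sum_mono cU)
  finally have "N \<le> (\<Sum>r\<in>F. card ?U)" .
  then show ?thesis by (simp flip: of_nat_mult)
qed

theorem bochner_ap_eq_0:
  assumes ap: "bochner_ap h" and uc: "uniformly_continuous_on UNIV h" and B: "\<And>t. norm (h t) \<le> B"
    and zero: "\<And>\<mu>. ((\<lambda>T. integral {0..T} (\<lambda>t. h t * cis (- (\<mu> * t))) / of_real T) \<longlongrightarrow> 0) at_top"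
  shows "h x = 0"
proof (rule ccontr)
  assume "h x \<noteq> 0"
  define d where "d = norm (h x) / 2"
  have d: "d > 0" using \<open>h x \<noteq> 0\<close> by (simp add: d_def)
  have Bp: "B > 0" using B[of x] \<open>h x \<noteq> 0\<close> by (meson less_le_trans zero_less_norm_iff)
  have cont: "continuous_on UNIV h" using uc by (rule uniformly_continuous_imp_continuous)
  obtain F1 where F1: "finite F1" "\<And>s. \<exists>r\<in>F1. \<forall>t. norm (h (t + s) - h (t + r)) \<le> d / 2"
    using ap d unfolding bochner_ap_def by (meson half_gt_zero)
  define n1 where "n1 = real (card F1)"
  have n1: "n1 \<ge> 1" using F1(1) F1(2)[of 0] by (auto simp: n1_def Suc_le_eq card_gt_0_iff)
  \<comment> \<open>A near-period to within \<open>\<eta>\<close> changes the correlation by at most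
    \<open>real N * \<eta> * B\<close>, which is half of the lower bound for
    \<open>norm (r 0)\<close>.\<close>
  define \<eta> where "\<eta> = d\<^sup>2 / (2 * n1 * B)"
  have \<eta>: "\<eta> > 0" using d n1 Bp by (simp add: \<eta>_def)
  obtain F2 where F2: "finite F2" "\<And>s. \<exists>r\<in>F2. \<forall>t. norm (h (t + s) - h (t + r)) \<le> \<eta> / 2"
    using ap \<eta> unfolding bochner_ap_def by (meson half_gt_zero)
  define n2 where "n2 = real (card F2)"
  have n2: "n2 \<ge> 1" using F2(1) F2(2)[of 0] by (auto simp: n2_def Suc_le_eq card_gt_0_iff)
  \<comment> \<open>With this value the comparison of the two bounds for the sum of squared
    correlations ends in \<open>1 / 4 \<le> 2 / (9 * n2)\<close>, which is false for
    \<open>n2 \<ge> 1\<close>.\<close>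
  define \<epsilon> where "\<epsilon> = d\<^sup>2 / (12 * n1 * n2 * B)"
  have \<epsilon>: "\<epsilon> > 0" using d n1 n2 Bp by (simp add: \<epsilon>_def)
  obtain \<delta>' where \<delta>': "\<delta>' > 0" "\<And>s t. dist t s < \<delta>' \<Longrightarrow> dist (h t) (h s) < \<epsilon>"
    using uniformly_continuous_onE[OF uc \<epsilon>] by (metis UNIV_I)
  define \<delta> where "\<delta> = \<delta>' / 2"
  have \<delta>: "\<delta> > 0" using \<delta>' by (simp add: \<delta>_def)
  have osc: "norm (h s - h t) \<le> \<epsilon>" if "\<bar>s - t\<bar> \<le> \<delta>" for s t
    using \<delta>'(2)[of s t] that \<delta>'(1) by (simp add: \<delta>_def dist_norm)
  \<comment> \<open>Samples with step \<open>\<delta>\<close> see only frequencies up to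
    \<open>pi / \<delta>\<close>, so uniformity over a compact range is enough.\<close>
  obtain T0 where T0: "T0 > 0" "\<And>T a \<mu>. T \<ge> T0 \<Longrightarrow> \<bar>\<mu>\<bar> \<le> pi / \<delta> \<Longrightarrow> norm (integral {a..a + T} (\<lambda>t. h t * cis (- (\<mu> * t)))) \<le> \<epsilon> * T"
    using uniform_small_means[OF ap cont B zero \<epsilon>, of "pi / \<delta>"] by auto
  define N where "N = nat \<lceil>T0 / \<delta>\<rceil>"
  have "T0 / \<delta> \<le> real N" unfolding N_def by (rule real_nat_ceiling_ge)
  then have N: "real N * \<delta> \<ge> T0" using \<delta> by (simp add: pos_divide_le_eq)
  then have Np: "real N > 0" using T0(1) \<delta> by (cases "N = 0") auto
  define a where "a j = h (x + real j * \<delta>)" for j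
  have samp: "norm (\<Sum>j<N. a j * cis (- (\<theta> * real j))) \<le> 4 * \<epsilon> * real N" if "\<bar>\<theta>\<bar> \<le> pi" for \<theta>
  proof -
    have "\<delta> / 2 * norm (\<Sum>j<N. a j * cis (- (\<theta> * real j)))
      \<le> norm (integral {x..x + real N * \<delta>} (\<lambda>t. h t * cis (- (\<theta> / \<delta> * t)))) + \<epsilon> * (real N * \<delta>)"
      unfolding a_def by (rule sample_sum_bound[OF cont \<delta> osc that])
    also have "norm (integral {x..x + real N * \<delta>} (\<lambda>t. h t * cis (- (\<theta> / \<delta> * t)))) \<le> \<epsilon> * (real N * \<delta>)"
      using that \<delta> by (intro T0(2) N) (simp add: divide_right_mono)
    finally show ?thesis using \<delta> by (simp add: mult_ac)
  qed
  have dft: "norm (\<Sum>j<N. a j * cis (- (2 * pi * real k / real (2 * N)) * real j)) \<le> 4 * \<epsilon> * real N" if "k < 2 * N" for k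
  proof -
    define \<theta> where "\<theta> = 2 * pi * real k / real (2 * N)"
    have "real k < real (2 * N)" using that by simp
    then have \<theta>: "0 \<le> \<theta>" "\<theta> < 2 * pi" using Np by (auto simp: \<theta>_def pos_divide_less_eq)
    show ?thesis
    proof (cases "\<theta> \<le> pi")
      case True then show ?thesis using samp[of \<theta>] \<theta> by (simp add: \<theta>_def)
    next
      case False
      \<comment> \<open>Frequencies in the upper half of the period stand for negative ones: samples
        at integers do not distinguish \<open>\<theta>\<close> from
        \<open>\<theta> - 2 * pi\<close>.\<close>
      have "cis (- ((\<theta> - 2 * pi) * real j)) = cis (- (\<theta> * real j))" for j
      proof -
        have "cis (- ((\<theta> - 2 * pi) * real j)) = cis (- (\<theta> * real j)) * cis (2 * pi * real j)"
          unfolding cis_mult by (simp add: algebra_simps)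
        then show ?thesis using cis_multiple_2pi[of "real j"] by simp
      qed
      then show ?thesis using samp[of "\<theta> - 2 * pi"] \<theta> False by (simp add: \<theta>_def)
    qed
  qed
  define r where "r u = (\<Sum>j<N. a (j + u) * cnj (a j))" for u
  have "(\<Sum>u<N. (norm (r u))\<^sup>2) \<le> (4 * \<epsilon> * real N)\<^sup>2 * (\<Sum>j<2 * N. (norm (a j))\<^sup>2)"
    unfolding r_def by (rule correlation_bound[OF dft])
  also have "\<dots> \<le> (4 * \<epsilon> * real N)\<^sup>2 * (\<Sum>j<2 * N. B\<^sup>2)"
    using B by (intro mult_left_mono sum_mono power_mono) (auto simp: a_def)
  finally have upper: "(\<Sum>u<N. (norm (r u))\<^sup>2) \<le> 32 * \<epsilon>\<^sup>2 * B\<^sup>2 * real N ^ 3"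
    by (simp add: power_mult_distrib power2_eq_square power3_eq_cube mult_ac)
  \<comment> \<open>Since \<open>norm (h x) = 2 * d\<close>, samples at near-periods to within
    \<open>d\<close> have norm at least \<open>d\<close>, and the pigeonhole count supplies at least
    \<open>real N / n1\<close> of them.\<close>
  have r0: "real N * d\<^sup>2 / n1 \<le> norm (r 0)"
  proof -
    define U where "U = {u. u < N \<and> (\<forall>t. norm (h (t + real u * \<delta>) - h t) \<le> d)}"
    have "real N \<le> n1 * real (card U)" unfolding n1_def U_def by (rule near_period_count[OF F1])
    then have "real N * d\<^sup>2 / n1 \<le> real (card U) * d\<^sup>2"
      using n1 mult_right_mono[of "real N" "n1 * real (card U)" "d\<^sup>2"] by (simp add: pos_divide_le_eq mult_ac)
    also have "\<dots> = (\<Sum>u\<in>U. d\<^sup>2)" by simp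
    also have "\<dots> \<le> (\<Sum>u\<in>U. (norm (a u))\<^sup>2)"
    proof (intro sum_mono power_mono)
      fix u assume "u \<in> U"
      then have "norm (a u - h x) \<le> d" by (auto simp: U_def a_def)
      then have "norm (h x) - norm (a u) \<le> d" using norm_triangle_ineq2[of "h x" "a u"] by (simp add: norm_minus_commute)
      then show "d \<le> norm (a u)" by (simp add: d_def)
    qed (use d in auto)
    also have "\<dots> \<le> (\<Sum>u<N. (norm (a u))\<^sup>2)" by (intro sum_mono2) (auto simp: U_def)
    also have "r 0 = of_real (\<Sum>u<N. (norm (a u))\<^sup>2)"
      unfolding r_def of_real_sum complex_norm_square by simp
    then have "(\<Sum>u<N. (norm (a u))\<^sup>2) = norm (r 0)" by (simp add: sum_nonneg del: of_real_sum)
    finally show ?thesis .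
  qed
  define U where "U = {u. u < N \<and> (\<forall>t. norm (h (t + real u * \<delta>) - h t) \<le> \<eta>)}"
  have NU: "real N \<le> n2 * real (card U)" unfolding n2_def U_def by (rule near_period_count[OF F2])
  have "real N * d\<^sup>2 / (2 * n1) \<le> norm (r u)" if u: "u \<in> U" for u
  proof -
    have "norm (r u - r 0) = norm (\<Sum>j<N. (a (j + u) - a j) * cnj (a j))"
      by (simp add: r_def algebra_simps sum_subtractf)
    also have "\<dots> \<le> (\<Sum>j<N. \<eta> * B)"
    proof (intro sum_norm_le)
      fix j
      have "norm (h ((x + real j * \<delta>) + real u * \<delta>) - h (x + real j * \<delta>)) \<le> \<eta>" using u unfolding U_def by blast
      moreover have "x + real (j + u) * \<delta> = (x + real j * \<delta>) + real u * \<delta>" by (simp add: algebra_simps)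
      ultimately have "norm (a (j + u) - a j) \<le> \<eta>" unfolding a_def by metis
      then show "norm ((a (j + u) - a j) * cnj (a j)) \<le> \<eta> * B"
        unfolding norm_mult using B \<eta> by (intro mult_mono) (auto simp: a_def)
    qed
    also have "\<dots> = real N * d\<^sup>2 / (2 * n1)" using Bp n1 by (simp add: \<eta>_def)
    finally have "norm (r 0) - norm (r u) \<le> real N * d\<^sup>2 / (2 * n1)"
      using norm_triangle_ineq2[of "r 0" "r u"] by (simp add: norm_minus_commute)
    moreover define Q where "Q = real N * d\<^sup>2 / (2 * n1)"
    moreover have "2 * Q \<le> norm (r 0)" using r0 by (simp add: Q_def)
    ultimately show ?thesis by linarith
  qed
  then have "(\<Sum>u\<in>U. (real N * d\<^sup>2 / (2 * n1))\<^sup>2) \<le> (\<Sum>u\<in>U. (norm (r u))\<^sup>2)"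
    using n1 by (intro sum_mono power_mono) auto
  also have "\<dots> \<le> (\<Sum>u<N. (norm (r u))\<^sup>2)" by (intro sum_mono2) (auto simp: U_def)
  finally have "real (card U) * (real N * d\<^sup>2 / (2 * n1))\<^sup>2 \<le> 32 * \<epsilon>\<^sup>2 * B\<^sup>2 * real N ^ 3" using upper by simp
  then have "n2 * (real (card U) * (real N * d\<^sup>2 / (2 * n1))\<^sup>2) \<le> n2 * (32 * \<epsilon>\<^sup>2 * B\<^sup>2 * real N ^ 3)"
    using n2 by (intro mult_left_mono) auto
  moreover have "real N * (real N * d\<^sup>2 / (2 * n1))\<^sup>2 \<le> (n2 * real (card U)) * (real N * d\<^sup>2 / (2 * n1))\<^sup>2"
    using NU by (intro mult_right_mono) auto
  ultimately have "real N * (real N * d\<^sup>2 / (2 * n1))\<^sup>2 \<le> n2 * (32 * \<epsilon>\<^sup>2 * B\<^sup>2 * real N ^ 3)" by (simp add: mult_ac)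
  moreover have "real N * (real N * d\<^sup>2 / (2 * n1))\<^sup>2 = real N ^ 3 * (d ^ 4 / n1\<^sup>2) * (1 / 4)"
    by (simp add: power_divide power_mult_distrib power2_eq_square power3_eq_cube power4_eq_xxxx mult_ac)
  moreover have "n2 * (32 * \<epsilon>\<^sup>2 * B\<^sup>2 * real N ^ 3) = real N ^ 3 * (d ^ 4 / n1\<^sup>2) * (2 / (9 * n2))"
    using Bp n1 n2 by (simp add: \<epsilon>_def power_divide power_mult_distrib field_simps power2_eq_square power4_eq_xxxx)
  moreover have "real N ^ 3 * (d ^ 4 / n1\<^sup>2) > 0" using Np d n1 by simp
  ultimately have "1 / 4 \<le> 2 / (9 * n2)" by (metis mult_le_cancel_left_pos)
  moreover have "2 / (9 * n2) \<le> 2 / 9" using n2 by (simp add: field_simps)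
  ultimately show False by simp
qed

subsection \<open>Convolutions and the Fejer kernel\<close>

lemma integrable_kernel_mult:
  fixes k g :: "real \<Rightarrow> 'a::{real_normed_field, banach, second_countable_topology}"
  assumes k: "integrable lborel k" and g[measurable]: "g \<in> borel_measurable borel" and B: "\<And>t. norm (g t) \<le> B"
  shows "integrable lborel (\<lambda>t. k t * g (y + t))"
proof (rule Bochner_Integration.integrable_bound)
  show "integrable lborel (\<lambda>t. B * norm (k t))" using k by auto
  have [measurable]: "k \<in> borel_measurable borel" using borel_measurable_integrable[OF k] by simp
  show "(\<lambda>t. k t * g (y + t)) \<in> borel_measurable lborel" by measurable
  have "norm (k t * g (y + t)) \<le> norm (B * norm (k t))" for t
  proof -
    have "norm (k t * g (y + t)) \<le> norm (k t) * B" unfolding norm_mult by (intro mult_left_mono B) auto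
    also have "\<dots> \<le> norm (B * norm (k t))" using abs_ge_self[of "norm (k t) * B"] by (simp add: mult.commute)
    finally show ?thesis .
  qed
  then show "AE t in lborel. norm (k t * g (y + t)) \<le> norm (B * norm (k t))" by simp
qed

lemma integrable_window:
  fixes g :: "real \<Rightarrow> 'a::{banach, second_countable_topology}"
  assumes g[measurable]: "g \<in> borel_measurable borel" and B: "\<And>t. norm (g t) \<le> B"
  shows "integrable lborel (\<lambda>t. indicator {a..b} t *\<^sub>R g t)"
proof (rule Bochner_Integration.integrable_bound)
  have "integrable lborel (indicator {a..b} :: real \<Rightarrow> real)" by (rule integrable_real_indicator) (auto simp: emeasure_lborel_Icc_eq)
  then show "integrable lborel (\<lambda>t. B * indicator {a..b} t :: real)" by simp
  show "AE t in lborel. norm (indicator {a..b} t *\<^sub>R g t) \<le> norm (B * indicator {a..b} t :: real)"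
    by (intro AE_I2) (auto simp: indicator_def intro: order_trans[OF B abs_ge_self])
qed measurable

text \<open>Bridge from the gauge integrals of the definitions to the Lebesgue integral, to which
  Fubini's theorem and dominated convergence are applied.\<close>

lemma
  fixes g :: "real \<Rightarrow> 'a::euclidean_space"
  assumes g: "g \<in> borel_measurable borel" "\<And>t. norm (g t) \<le> B"
  shows bounded_borel_integrable_on: "g integrable_on {a..b}"
    and integral_eq_lborel: "integral {a..b} g = (LINT t|lborel. indicator {a..b} t *\<^sub>R g t)"
  using set_borel_integral_eq_integral[of "{a..b}" g] integrable_window[OF g, of a b]
  by (auto simp: set_integrable_def set_lebesgue_integral_def)

text \<open>\<open>g\<close> is merely bounded, so it is the bounded window for \<open>y\<close>
  that makes the double integral absolutely convergent.\<close>

lemma fubini_window: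
  fixes k g :: "real \<Rightarrow> 'a::{real_normed_field, banach, second_countable_topology}"
  assumes k: "integrable lborel k" and g[measurable]: "g \<in> borel_measurable borel" and B: "\<And>t. norm (g t) \<le> B"
  shows "(LINT y|lborel. indicator {a..b} y *\<^sub>R (LINT t|lborel. k t * g (y + t)))
    = (LINT t|lborel. k t * (LINT y|lborel. indicator {a..b} y *\<^sub>R g (y + t)))"
proof -
  have [measurable]: "k \<in> borel_measurable borel" using borel_measurable_integrable[OF k] by simp
  have B0: "B \<ge> 0" using B[of 0] norm_ge_zero order_trans by blast
  let ?f = "\<lambda>y t. indicator {a..b} y *\<^sub>R (k t * g (y + t))"
  have "integrable (lborel \<Otimes>\<^sub>M lborel) (case_prod ?f)"
  proof (rule lborel_pair.Fubini_integrable)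
    have "(\<lambda>p. indicator {a..b} (fst p) *\<^sub>R (k (snd p) * g (fst p + snd p))) \<in> borel_measurable (lborel \<Otimes>\<^sub>M lborel)"
      by measurable
    then show "case_prod ?f \<in> borel_measurable (lborel \<Otimes>\<^sub>M lborel)" by (simp add: case_prod_beta')
    show "AE y in lborel. integrable lborel (\<lambda>t. case (y, t) of (y, t) \<Rightarrow> ?f y t)"
      using integrable_kernel_mult[OF k g B] by auto
    show "integrable lborel (\<lambda>y. LINT t|lborel. norm (case (y, t) of (y, t) \<Rightarrow> ?f y t))"
    proof (rule Bochner_Integration.integrable_bound)
      have "integrable lborel (indicator {a..b} :: real \<Rightarrow> real)" by (rule integrable_real_indicator) (auto simp: emeasure_lborel_Icc_eq)
      then show "integrable lborel (\<lambda>y. (B * (LINT t|lborel. norm (k t))) * indicator {a..b} y :: real)" by simp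
      have "(\<lambda>y. LINT t|lborel. norm (indicator {a..b} (fst (y, t)) *\<^sub>R (k t * g (y + t)))) \<in> borel_measurable lborel"
        by measurable
      then show "(\<lambda>y. LINT t|lborel. norm (case (y, t) of (y, t) \<Rightarrow> ?f y t)) \<in> borel_measurable lborel" by simp
      have "(LINT t|lborel. norm (?f y t)) \<le> B * (LINT t|lborel. norm (k t)) * indicator {a..b} y" for y
      proof -
        have "(LINT t|lborel. norm (?f y t)) \<le> (LINT t|lborel. (B * indicator {a..b} y) * norm (k t))"
        proof (rule integral_mono)
          show "integrable lborel (\<lambda>t. norm (?f y t))" using integrable_kernel_mult[OF k g B] by auto
          show "integrable lborel (\<lambda>t. (B * indicator {a..b} y) * norm (k t))" using k by auto
          show "norm (?f y t) \<le> (B * indicator {a..b} y) * norm (k t)" for t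
            using B[of "y + t"] by (auto simp: indicator_def norm_mult mult.commute[of _ "norm (g _)"] intro!: mult_right_mono)
        qed
        then show ?thesis by (simp add: mult_ac)
      qed
      then show "AE y in lborel. norm (LINT t|lborel. norm (case (y, t) of (y, t) \<Rightarrow> ?f y t)) \<le> norm ((B * (LINT t|lborel. norm (k t))) * indicator {a..b} y :: real)"
        by (intro AE_I2) (simp add: B0)
    qed
  qed
  from lborel_pair.Fubini_integral[OF this]
  have "(LINT y|lborel. LINT t|lborel. ?f y t) = (LINT t|lborel. LINT y|lborel. ?f y t)" by simp
  moreover have "(LINT y|lborel. ?f y t) = k t * (LINT y|lborel. indicator {a..b} y *\<^sub>R g (y + t))" for t
    by (simp add: scaleR_conv_of_real mult.left_commute)
  ultimately show ?thesis by (simp add: mult_ac)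
qed

lemma integral_window_translate:
  fixes g :: "real \<Rightarrow> complex"
  assumes g[measurable]: "g \<in> borel_measurable borel" and B: "\<And>t. norm (g t) \<le> B"
  shows "(LINT y|lborel. indicator {a..b} y *\<^sub>R g (y + t)) = integral {a + t..b + t} g"
proof -
  have "(LINT y|lborel. indicator {a..b} y *\<^sub>R g (y + t)) = integral {a..b} (\<lambda>y. g (y + t))"
    by (rule integral_eq_lborel[symmetric, where B=B]) (use B in auto)
  also have "\<dots> = integral {a + t..b + t} g"
    using integral_shift_Icc_real[of a b g t] by (simp add: o_def add.commute)
  finally show ?thesis .
qed

lemma integrable_inverse_square: "integrable lborel (\<lambda>t::real. C / (1 + t\<^sup>2))"
proof -
  have "integrable lborel (\<lambda>t::real. inverse (1 + t\<^sup>2))"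
    using integrable_inverse_1_plus_square by (simp add: set_integrable_def)
  from integrable_mult_right[OF this, of C] show ?thesis by (simp add: divide_inverse)
qed

text \<open>Division by zero gives \<open>fejer a 0 = 0\<close> instead of the limit \<open>a\<^sup>2 / (2 * pi)\<close>, so the kernels below are
  continuous only away from 0.\<close>

definition fejer :: "real \<Rightarrow> real \<Rightarrow> real" where
  "fejer a t = (1 - cos (a * t)) / (pi * t\<^sup>2)"

lemma fejer_measurable[measurable]: "fejer a \<in> borel_measurable borel"
  unfolding fejer_def[abs_def] by measurable

lemma fejer_nonneg: "fejer a t \<ge> 0"
  by (simp add: fejer_def)

lemma fejer_minus: "fejer a (- t) = fejer a t"
  by (simp add: fejer_def)

lemma one_minus_cos_le: "1 - cos (x::real) \<le> x\<^sup>2 / 2"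
proof -
  have "1 - cos x = 2 * (sin (x / 2))\<^sup>2" using cos_double_sin[of "x / 2"] by simp
  also have "(sin (x / 2))\<^sup>2 \<le> (x / 2)\<^sup>2"
    using abs_sin_x_le_abs_x[of "x / 2"] by (simp only: abs_le_square_iff)
  finally show ?thesis by (simp add: power2_eq_square)
qed

text \<open>The quadratic bound for \<open>1 - cos\<close> controls small \<open>t\<close>, the
  bound 2 controls large \<open>t\<close>; adding both gives a single majorant of the form demanded
  in \<open>conv_kernel\<close>.\<close>

lemma fejer_le: "fejer a t \<le> (a\<^sup>2 + 2) / (1 + t\<^sup>2)"
proof (cases "t = 0")
  case False
  have t: "t\<^sup>2 > 0" "1 + t\<^sup>2 > 0" using False by (auto simp: add_pos_nonneg)
  have "(1 - cos (a * t)) * (1 + t\<^sup>2) = (1 - cos (a * t)) + (1 - cos (a * t)) * t\<^sup>2" by (simp add: algebra_simps)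
  also have "\<dots> \<le> (a * t)\<^sup>2 / 2 + 2 * t\<^sup>2"
    using cos_ge_minus_one[of "a * t"] by (intro add_mono one_minus_cos_le mult_right_mono) auto
  also have "\<dots> \<le> (a\<^sup>2 + 2) * (1 * t\<^sup>2)" by (simp add: algebra_simps power_mult_distrib)
  also have "\<dots> \<le> (a\<^sup>2 + 2) * (pi * t\<^sup>2)" using pi_ge_two by (intro mult_left_mono mult_right_mono) auto
  finally show ?thesis using t unfolding fejer_def
    by (simp add: divide_le_eq le_divide_eq mult_ac)
qed (simp add: fejer_def)

lemma fejer_integrable: "integrable lborel (fejer a)"
  by (rule Bochner_Integration.integrable_bound[OF integrable_inverse_square[of "a\<^sup>2 + 2"]])
     (use fejer_le fejer_nonneg in \<open>auto intro!: AE_I2 simp: abs_of_nonneg\<close>)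

lemma fejer_integral: "(LINT t|lborel. fejer a t) = \<bar>a\<bar>"
proof -
  have pos: "(LINT t|lborel. fejer a t) = a" if a: "a > 0" for a
  proof -
    define F where "F t = (a * Si (a * t) - (1 - cos (a * t)) / t) / pi" for t
    have der: "(F has_real_derivative fejer a t) (at t)" if "t > 0" for t
    proof -
      have "(F has_real_derivative ((a * (sinc (a * t) * a) - ((sin (a * t) * a) * t - (1 - cos (a * t)) * 1) / (t * t)) / pi)) (at t)"
        unfolding F_def using that a
        by (auto intro!: derivative_eq_intros DERIV_chain2[OF DERIV_Si] simp: power2_eq_square)
      also have "(a * (sinc (a * t) * a) - ((sin (a * t) * a) * t - (1 - cos (a * t)) * 1) / (t * t)) / pi = fejer a t"
        using that a by (simp add: fejer_def field_simps power2_eq_square)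
      finally show ?thesis .
    qed
    have c: "isCont (fejer a) t" if "t > 0" for t unfolding fejer_def using that by (intro continuous_intros) auto
    have "((\<lambda>t. (1 - cos (a * t)) / t) \<longlongrightarrow> 0) (at_right 0)"
    proof (rule tendsto_sandwich[of "\<lambda>_. 0" _ _ "\<lambda>t. a\<^sup>2 / 2 * t"])
      show "eventually (\<lambda>t. (1 - cos (a * t)) / t \<le> a\<^sup>2 / 2 * t) (at_right 0)"
        unfolding eventually_at_right_field
      proof (intro exI[of _ 1] conjI allI impI)
        fix t :: real assume "0 < t" "t < 1"
        then show "(1 - cos (a * t)) / t \<le> a\<^sup>2 / 2 * t"
          using one_minus_cos_le[of "a * t"] by (simp add: divide_le_eq power2_eq_square mult_ac)
      qed simp
      show "eventually (\<lambda>t. 0 \<le> (1 - cos (a * t)) / t) (at_right 0)"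
        unfolding eventually_at_right_field by (intro exI[of _ 1]) auto
      have "((\<lambda>t. a\<^sup>2 / 2 * t) \<longlongrightarrow> a\<^sup>2 / 2 * 0) (at_right 0)" by (intro tendsto_intros)
      then show "((\<lambda>t. a\<^sup>2 / 2 * t) \<longlongrightarrow> 0) (at_right 0)" by simp
    qed auto
    moreover have "((\<lambda>t. Si (a * t)) \<longlongrightarrow> Si 0) (at_right 0)"
    proof (rule isCont_tendsto_compose[OF isCont_Si])
      have "((\<lambda>t. a * t) \<longlongrightarrow> a * 0) (at_right 0)" by (intro tendsto_intros)
      then show "((\<lambda>t. a * t) \<longlongrightarrow> 0) (at_right 0)" by simp
    qed
    ultimately have "(F \<longlongrightarrow> (a * Si 0 - 0) / pi) (at_right 0)" unfolding F_def by (intro tendsto_intros) auto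
    moreover have "Si 0 = 0" unfolding Si_def zero_ereal_def by (rule interval_integral_endpoints_same)
    ultimately have l0: "(F \<longlongrightarrow> 0) (at_right 0)" by simp
    have "((\<lambda>t. Si (a * t)) \<longlongrightarrow> pi / 2) at_top"
      by (rule filterlim_compose[OF Si_at_top]) (use a in \<open>auto intro!: filterlim_tendsto_pos_mult_at_top filterlim_ident\<close>)
    moreover have "((\<lambda>t. (1 - cos (a * t)) / t) \<longlongrightarrow> 0) at_top"
    proof (rule tendsto_sandwich[of "\<lambda>_. 0" _ _ "\<lambda>t. 2 / t"])
      show "eventually (\<lambda>t. (1 - cos (a * t)) / t \<le> 2 / t) at_top"
        using eventually_gt_at_top[of 0]
      proof eventually_elim
        case (elim t) then show ?case using cos_ge_minus_one[of "a * t"] by (intro divide_right_mono) auto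
      qed
      show "eventually (\<lambda>t. 0 \<le> (1 - cos (a * t)) / t) at_top"
        using eventually_gt_at_top[of 0] by eventually_elim auto
      show "((\<lambda>t. 2 / t) \<longlongrightarrow> (0::real)) at_top" by (rule tendsto_divide_0[OF tendsto_const filterlim_at_top_imp_at_infinity[OF filterlim_ident]])
    qed auto
    ultimately have "(F \<longlongrightarrow> (a * (pi / 2) - 0) / pi) at_top" unfolding F_def by (intro tendsto_intros) auto
    then have l1: "(F \<longlongrightarrow> a / 2) at_top" by simp
    have "(LBINT t=0..\<infinity>. fejer a t) = a / 2 - 0" "set_integrable lborel (einterval 0 \<infinity>) (fejer a)"
      using der c fejer_nonneg l0 l1
      by (intro interval_integral_FTC_nonneg[where F=F]; force simp: zero_ereal_def ereal_tendsto_simps)+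
    then have "has_bochner_integral lborel (\<lambda>t. indicator {0<..} t *\<^sub>R fejer a t) (a / 2)"
      by (auto simp: has_bochner_integral_iff interval_lebesgue_integral_def set_integrable_def set_lebesgue_integral_def zero_ereal_def einterval_eq_Ici)
    \<comment> \<open>At 0 the kernel has the value 0, so the end point may be included even without
      an argument about null sets.\<close>
    moreover have "(\<lambda>t. indicator {0<..} t *\<^sub>R fejer a t) = (\<lambda>t. indicator {0..} t *\<^sub>R fejer a t)"
      by (auto simp: fun_eq_iff indicator_def fejer_def)
    ultimately have "has_bochner_integral lborel (\<lambda>t. indicator {0..} t *\<^sub>R fejer a t) (a / 2)" by simp
    from has_bochner_integral_even_function[OF this fejer_minus]
    show ?thesis by (simp add: has_bochner_integral_iff)
  qed
  consider "a > 0" | "a = 0" | "a < 0" by linarith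
  then show ?thesis
  proof cases
    case 3
    have "fejer a = fejer (- a)" by (simp add: fejer_def fun_eq_iff)
    then show ?thesis using pos[of "- a"] 3 by simp
  qed (simp_all add: pos, simp add: fejer_def[abs_def])
qed

subsection \<open>De la Vallee Poussin kernels\<close>

lemma integrable_mult_cis:
  fixes k :: "real \<Rightarrow> real"
  assumes "integrable lborel k"
  shows "integrable lborel (\<lambda>t. of_real (k t) * cis (\<mu> * t))"
proof (rule Bochner_Integration.integrable_bound[OF assms])
  have [measurable]: "k \<in> borel_measurable borel" using borel_measurable_integrable[OF assms] by simp
  have [measurable]: "(\<lambda>t. cis (\<mu> * t)) \<in> borel_measurable borel"
    by (intro borel_measurable_continuous_onI continuous_intros)
  show "(\<lambda>t. complex_of_real (k t) * cis (\<mu> * t)) \<in> borel_measurable lborel" by measurable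
qed (simp add: norm_mult)

lemma integral_even_mult_cis:
  fixes k :: "real \<Rightarrow> real"
  assumes k: "integrable lborel k" and even: "\<And>t. k (- t) = k t"
  shows "(LINT t|lborel. of_real (k t) * cis (\<mu> * t)) = of_real (LINT t|lborel. k t * cos (\<mu> * t))"
proof -
  let ?I = "LINT t|lborel. of_real (k t) * cis (\<mu> * t)"
  have "?I = (LINT t|lborel. of_real (k (- t)) * cis (\<mu> * - t))"
    using lborel_integral_real_affine[of "-1" "\<lambda>t. of_real (k t) * cis (\<mu> * t)" 0] by simp
  then have "2 * ?I = ?I + (LINT t|lborel. of_real (k t) * cis ((- \<mu>) * t))" by (simp add: even)
  also have "\<dots> = (LINT t|lborel. of_real (k t) * cis (\<mu> * t) + of_real (k t) * cis ((- \<mu>) * t))"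
    by (rule Bochner_Integration.integral_add[symmetric]) (intro integrable_mult_cis k)+
  also have "\<dots> = (LINT t|lborel. complex_of_real (2 * (k t * cos (\<mu> * t))))"
    by (intro Bochner_Integration.integral_cong refl) (simp add: complex_eq_iff)
  also have "\<dots> = 2 * of_real (LINT t|lborel. k t * cos (\<mu> * t))" unfolding integral_complex_of_real by simp
  finally show ?thesis by simp
qed

text \<open>Writing the product of cosines as a sum reduces the transform to three values of
  \<open>fejer_integral\<close>. For nonnegative \<open>a\<close> the result is the tent
  \<open>max 0 (a - \<bar>\<mu>\<bar>)\<close>.\<close>

lemma fejer_transform: "(LINT t|lborel. fejer a t * cos (\<mu> * t)) = (\<bar>a + \<mu>\<bar> + \<bar>a - \<mu>\<bar>) / 2 - \<bar>\<mu>\<bar>"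
proof -
  have "fejer a t * cos (\<mu> * t) = (fejer (a + \<mu>) t + fejer (a - \<mu>) t) / 2 - fejer \<mu> t" for t
  proof -
    define d where "d = inverse (pi * t\<^sup>2)"
    show ?thesis unfolding fejer_def divide_inverse[of _ "pi * t\<^sup>2"] d_def[symmetric]
      by (simp add: distrib_right left_diff_distrib cos_add cos_diff) (simp add: algebra_simps)
  qed
  then show ?thesis by (simp add: fejer_integral fejer_integrable)
qed

text \<open>A difference of two tents: for \<open>0 \<le> \<kappa> < \<eta>\<close> the transform is
  the trapezoid that equals 1 up to \<open>\<kappa>\<close> and falls linearly to 0 at
  \<open>\<eta>\<close>.\<close>

definition vp_kernel :: "real \<Rightarrow> real \<Rightarrow> real \<Rightarrow> real" where
  "vp_kernel \<kappa> \<eta> t = (fejer \<eta> t - fejer \<kappa> t) / (\<eta> - \<kappa>)"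

lemma vp_kernel_integrable: "integrable lborel (vp_kernel \<kappa> \<eta>)"
  unfolding vp_kernel_def[abs_def] by (intro integrable_divide Bochner_Integration.integrable_diff fejer_integrable)

lemma vp_kernel_measurable[measurable]: "vp_kernel \<kappa> \<eta> \<in> borel_measurable borel"
  unfolding vp_kernel_def[abs_def] by measurable

lemma vp_kernel_minus: "vp_kernel \<kappa> \<eta> (- t) = vp_kernel \<kappa> \<eta> t"
  by (simp add: vp_kernel_def fejer_minus)

lemma vp_kernel_le:
  assumes "\<kappa> < \<eta>"
  shows "\<bar>vp_kernel \<kappa> \<eta> t\<bar> \<le> ((\<eta>\<^sup>2 + \<kappa>\<^sup>2 + 4) / (\<eta> - \<kappa>)) / (1 + t\<^sup>2)"
proof -
  have "\<bar>fejer \<eta> t - fejer \<kappa> t\<bar> \<le> (\<eta>\<^sup>2 + 2) / (1 + t\<^sup>2) + (\<kappa>\<^sup>2 + 2) / (1 + t\<^sup>2)"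
    using fejer_le[of \<eta> t] fejer_le[of \<kappa> t] fejer_nonneg[of \<eta> t] fejer_nonneg[of \<kappa> t] by linarith
  also have "\<dots> = (\<eta>\<^sup>2 + \<kappa>\<^sup>2 + 4) / (1 + t\<^sup>2)" by (simp add: add_divide_distrib[symmetric])
  finally have "\<bar>fejer \<eta> t - fejer \<kappa> t\<bar> / (\<eta> - \<kappa>) \<le> ((\<eta>\<^sup>2 + \<kappa>\<^sup>2 + 4) / (1 + t\<^sup>2)) / (\<eta> - \<kappa>)"
    using assms by (intro divide_right_mono) auto
  moreover have "\<bar>vp_kernel \<kappa> \<eta> t\<bar> = \<bar>fejer \<eta> t - fejer \<kappa> t\<bar> / (\<eta> - \<kappa>)"
    using assms by (simp add: vp_kernel_def abs_divide)
  ultimately have "\<bar>vp_kernel \<kappa> \<eta> t\<bar> \<le> ((\<eta>\<^sup>2 + \<kappa>\<^sup>2 + 4) / (1 + t\<^sup>2)) / (\<eta> - \<kappa>)" by simp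
  then show ?thesis by (simp add: mult.commute)
qed

lemma vp_kernel_isCont: "t \<noteq> 0 \<Longrightarrow> isCont (vp_kernel \<kappa> \<eta>) t"
  unfolding vp_kernel_def[abs_def] fejer_def divide_inverse[of _ "\<eta> - \<kappa>"] by (intro continuous_intros) auto

lemma vp_kernel_transform:
  assumes "0 \<le> \<kappa>" "\<kappa> < \<eta>" "\<bar>\<mu>\<bar> \<le> \<kappa> \<or> \<eta> \<le> \<bar>\<mu>\<bar>"
  shows "(LINT t|lborel. of_real (vp_kernel \<kappa> \<eta> t) * cis (\<mu> * t)) = (if \<bar>\<mu>\<bar> \<le> \<kappa> then 1 else 0)"
proof -
  have i: "integrable lborel (\<lambda>t. fejer a t * cos (\<mu> * t))" for a
    by (rule Bochner_Integration.integrable_bound[OF fejer_integrable[of a]])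
       (auto simp: abs_mult mult_left_le)
  have "(LINT t|lborel. vp_kernel \<kappa> \<eta> t * cos (\<mu> * t))
     = (LINT t|lborel. (fejer \<eta> t * cos (\<mu> * t) - fejer \<kappa> t * cos (\<mu> * t)) / (\<eta> - \<kappa>))"
    by (simp add: vp_kernel_def left_diff_distrib)
  also have "\<dots> = (((\<bar>\<eta> + \<mu>\<bar> + \<bar>\<eta> - \<mu>\<bar>) / 2 - \<bar>\<mu>\<bar>) - ((\<bar>\<kappa> + \<mu>\<bar> + \<bar>\<kappa> - \<mu>\<bar>) / 2 - \<bar>\<mu>\<bar>)) / (\<eta> - \<kappa>)"
    by (simp add: i fejer_transform)
  also have "((\<bar>\<eta> + \<mu>\<bar> + \<bar>\<eta> - \<mu>\<bar>) / 2 - \<bar>\<mu>\<bar>) - ((\<bar>\<kappa> + \<mu>\<bar> + \<bar>\<kappa> - \<mu>\<bar>) / 2 - \<bar>\<mu>\<bar>) = (if \<bar>\<mu>\<bar> \<le> \<kappa> then \<eta> - \<kappa> else 0)"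
    using assms by (auto simp: abs_if)
  finally show ?thesis using assms by (simp add: integral_even_mult_cis vp_kernel_integrable vp_kernel_minus)
qed

text \<open>Beyond integrability, the majorant \<open>C / (1 + t\<^sup>2)\<close> dominates all
  small translates of the kernel at once, and as a weight it is compatible with the window means of
  the Stepanov norm. Continuity away from 0 gives the convergence almost everywhere used in
  \<open>k_shift_tendsto\<close>.\<close>

locale conv_kernel =
  fixes k :: "real \<Rightarrow> real" and C :: real and g :: "real \<Rightarrow> complex" and B :: real
  assumes k_int: "integrable lborel k" and k_le: "\<And>t. \<bar>k t\<bar> \<le> C / (1 + t\<^sup>2)"
    and k_cont: "\<And>t. t \<noteq> 0 \<Longrightarrow> isCont k t"
    and g_meas[measurable]: "g \<in> borel_measurable borel" and g_le: "\<And>t. norm (g t) \<le> B"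
begin

definition "conv y = (LINT t|lborel. of_real (k t) * g (y + t))"

lemma k_meas[measurable]: "k \<in> borel_measurable borel" using borel_measurable_integrable[OF k_int] by simp

lemma B_nonneg: "B \<ge> 0" using g_le[of 0] norm_ge_zero order_trans by blast

lemma C_nonneg: "C \<ge> 0" using k_le[of 0] by simp

lemma k_int': "integrable lborel (\<lambda>t. complex_of_real (k t))" using k_int by simp

lemma conv_le: "norm (conv y) \<le> B * (LINT t|lborel. \<bar>k t\<bar>)"
proof -
  have "norm (conv y) \<le> (LINT t|lborel. B * \<bar>k t\<bar>)"
    unfolding conv_def
  proof (rule Bochner_Integration.integral_norm_bound_integral)
    show "integrable lborel (\<lambda>t. of_real (k t) * g (y + t))" by (rule integrable_kernel_mult[OF k_int' g_meas g_le])
    show "integrable lborel (\<lambda>t. B * \<bar>k t\<bar>)" using k_int by auto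
    show "norm (of_real (k t) * g (y + t)) \<le> B * \<bar>k t\<bar>" for t
      unfolding norm_mult using mult_right_mono[OF g_le[of "y + t"], of "\<bar>k t\<bar>"] by (simp add: mult.commute)
  qed
  then show ?thesis by simp
qed

lemma conv_diff_le: "norm (conv (y + s) - conv y) \<le> B * (LINT t|lborel. \<bar>k (t - s) - k t\<bar>)"
proof -
  have ks: "integrable lborel (\<lambda>t. k (t - s))" using lborel_integrable_real_affine[OF k_int, of 1 "- s"] by simp
  have "conv (y + s) = (LINT t|lborel. of_real (k (t - s)) * g (y + t))"
    unfolding conv_def using lborel_integral_real_affine[of 1 "\<lambda>t. of_real (k t) * g (y + s + t)" "- s"] by (simp add: add_ac)
  then have "conv (y + s) - conv y = (LINT t|lborel. of_real (k (t - s)) * g (y + t)) - (LINT t|lborel. of_real (k t) * g (y + t))"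
    by (simp only: conv_def[of y])
  also have "\<dots> = (LINT t|lborel. of_real (k (t - s)) * g (y + t) - of_real (k t) * g (y + t))"
    using ks k_int by (intro Bochner_Integration.integral_diff[symmetric] integrable_kernel_mult[OF _ g_meas g_le]) auto
  also have "\<dots> = (LINT t|lborel. of_real (k (t - s) - k t) * g (y + t))" by (simp add: left_diff_distrib)
  also have "norm \<dots> \<le> (LINT t|lborel. B * \<bar>k (t - s) - k t\<bar>)"
  proof (rule Bochner_Integration.integral_norm_bound_integral)
    show "integrable lborel (\<lambda>t. of_real (k (t - s) - k t) * g (y + t))"
      by (rule integrable_kernel_mult[OF _ g_meas g_le]) (use ks k_int in auto)
    show "integrable lborel (\<lambda>t. B * \<bar>k (t - s) - k t\<bar>)" using ks k_int by auto
    show "norm (of_real (k (t - s) - k t) * g (y + t)) \<le> B * \<bar>k (t - s) - k t\<bar>" for t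
      unfolding norm_mult norm_of_real using mult_right_mono[OF g_le[of "y + t"], of "\<bar>k (t - s) - k t\<bar>"] by (simp add: mult.commute)
  qed
  finally show ?thesis by simp
qed

text \<open>Continuity of translation in the mean, by dominated convergence.\<close>

lemma k_shift_tendsto:
  assumes "s \<longlonglongrightarrow> 0"
  shows "(\<lambda>n. LINT t|lborel. \<bar>k (t - s n) - k t\<bar>) \<longlonglongrightarrow> 0"
proof -
  \<comment> \<open>Clipping to \<open>{- 1..1}\<close> provides one majorant for all
    \<open>n\<close>; from some index on the sequence is unchanged.\<close>
  define s' where "s' n = max (- 1) (min 1 (s n))" for n
  have s': "\<bar>s' n\<bar> \<le> 1" for n by (auto simp: s'_def)
  have ev: "eventually (\<lambda>n. s' n = s n) sequentially"
    using tendstoD[OF assms, of 1] by (auto elim!: eventually_mono simp: s'_def)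
  then have s'0: "s' \<longlonglongrightarrow> 0" using assms by (simp add: tendsto_cong[OF ev])
  have "(\<lambda>n. LINT t|lborel. \<bar>k (t - s' n) - k t\<bar>) \<longlonglongrightarrow> (LINT t|(lborel::real measure). 0)"
  proof (rule integral_dominated_convergence[where w="\<lambda>t. 4 * C / (1 + t\<^sup>2)"])
    show "AE t in lborel. (\<lambda>n. \<bar>k (t - s' n) - k t\<bar>) \<longlonglongrightarrow> 0"
      using AE_lborel_singleton[of 0]
    proof eventually_elim
      case (elim t)
      have "(\<lambda>n. t - s' n) \<longlonglongrightarrow> t - 0" by (intro tendsto_intros s'0)
      then have "(\<lambda>n. k (t - s' n)) \<longlonglongrightarrow> k t" by (intro isCont_tendsto_compose[OF k_cont[OF elim]]) simp
      then have "(\<lambda>n. \<bar>k (t - s' n) - k t\<bar>) \<longlonglongrightarrow> \<bar>k t - k t\<bar>" by (intro tendsto_intros)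
      then show ?case by simp
    qed
    show "AE t in lborel. norm \<bar>k (t - s' n) - k t\<bar> \<le> 4 * C / (1 + t\<^sup>2)" for n
    proof (intro AE_I2)
      fix t
      have sq: "(s' n)\<^sup>2 \<le> 1" using s'[of n] by (simp add: abs_square_le_1)
      \<comment> \<open>Completing the square: this is what compares the weight with its translates
        by at most 1, at the price of the factor 3.\<close>
      have "(2 * t - 3 * s' n)\<^sup>2 \<ge> 0" by simp
      then have "1 + t\<^sup>2 \<le> 3 * (1 + (t - s' n)\<^sup>2)" using sq by (simp add: power2_eq_square algebra_simps)
      then have "C * (1 + t\<^sup>2) \<le> C * (3 * (1 + (t - s' n)\<^sup>2))" using C_nonneg by (intro mult_left_mono)
      then have "C / (1 + (t - s' n)\<^sup>2) \<le> 3 * C / (1 + t\<^sup>2)"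
        by (simp add: divide_le_eq le_divide_eq add_pos_nonneg mult_ac)
      then show "norm \<bar>k (t - s' n) - k t\<bar> \<le> 4 * C / (1 + t\<^sup>2)"
        using k_le[of t] k_le[of "t - s' n"] by (simp add: abs_le_iff)
    qed
    show "integrable lborel (\<lambda>t::real. 4 * C / (1 + t\<^sup>2))" by (rule integrable_inverse_square)
  qed measurable
  then have "(\<lambda>n. LINT t|lborel. \<bar>k (t - s' n) - k t\<bar>) \<longlonglongrightarrow> 0" by simp
  moreover have "eventually (\<lambda>n. (LINT t|lborel. \<bar>k (t - s' n) - k t\<bar>) = (LINT t|lborel. \<bar>k (t - s n) - k t\<bar>)) sequentially"
    using ev by eventually_elim simp
  ultimately show ?thesis using tendsto_cong by fast
qed

lemma conv_uniformly_continuous: "uniformly_continuous_on UNIV conv"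
  unfolding uniformly_continuous_on_sequentially
proof (intro allI impI, elim conjE)
  fix x y :: "nat \<Rightarrow> real" assume "(\<lambda>n. dist (x n) (y n)) \<longlonglongrightarrow> 0"
  then have "(\<lambda>n. x n - y n) \<longlonglongrightarrow> 0" by (simp add: dist_real_def tendsto_rabs_zero_iff)
  from tendsto_mult_right_zero[OF k_shift_tendsto[OF this], of B]
  have lim: "(\<lambda>n. B * (LINT t|lborel. \<bar>k (t - (x n - y n)) - k t\<bar>)) \<longlonglongrightarrow> 0" .
  show "(\<lambda>n. dist (conv (x n)) (conv (y n))) \<longlonglongrightarrow> 0"
  proof (rule tendsto_sandwich[OF _ _ tendsto_const lim])
    show "eventually (\<lambda>n. dist (conv (x n)) (conv (y n)) \<le> B * (LINT t|lborel. \<bar>k (t - (x n - y n)) - k t\<bar>)) sequentially"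
      using conv_diff_le[of "y n" "x n - y n" for n] by (intro always_eventually allI) (simp add: dist_norm)
  qed auto
qed

text \<open>Stated as a vanishing difference because the mean for \<open>g\<close> is not yet known
  to converge; \<open>fourier_coeff_tendsto\<close> deduces that from the convergence for
  \<open>conv\<close>. By Fubini the error is the kernel integrated against the change of the mean
  under translation by \<open>t\<close>, which tends to 0 for each \<open>t\<close> and is bounded
  by \<open>2 * B\<close>.\<close>

lemma conv_fourier:
  "((\<lambda>T. integral {0..T} (\<lambda>y. conv y * cis (- (\<mu> * y))) / of_real T
     - (LINT t|lborel. of_real (k t) * cis (\<mu> * t)) * (integral {0..T} (\<lambda>y. g y * cis (- (\<mu> * y))) / of_real T)) \<longlongrightarrow> 0) at_top"
proof -
  define K where "K t = of_real (k t) * cis (\<mu> * t)" for t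
  define G where "G t = g t * cis (- (\<mu> * t))" for t
  have [measurable]: "(\<lambda>t. cis (c * t)) \<in> borel_measurable borel" for c :: real
    by (intro borel_measurable_continuous_onI continuous_intros)
  have [measurable]: "(\<lambda>t. cis (- (c * t))) \<in> borel_measurable borel" for c :: real
    by (intro borel_measurable_continuous_onI continuous_intros)
  have Gm[measurable]: "G \<in> borel_measurable borel" unfolding G_def by measurable
  have G_le: "norm (G t) \<le> B" for t using g_le by (simp add: G_def norm_mult)
  have Ki: "integrable lborel K" unfolding K_def by (rule integrable_mult_cis[OF k_int])
  have conv_G: "conv y * cis (- (\<mu> * y)) = (LINT t|lborel. K t * G (y + t))" for y
  proof -
    have "conv y * cis (- (\<mu> * y)) = (LINT t|lborel. of_real (k t) * g (y + t) * cis (- (\<mu> * y)))"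
      unfolding conv_def by simp
    also have "\<dots> = (LINT t|lborel. K t * G (y + t))"
    proof (intro Bochner_Integration.integral_cong refl)
      fix t
      have "cis (- (\<mu> * y)) = cis (\<mu> * t) * cis (- (\<mu> * (y + t)))" by (simp add: cis_mult algebra_simps)
      then show "of_real (k t) * g (y + t) * cis (- (\<mu> * y)) = K t * G (y + t)" by (simp add: K_def G_def)
    qed
    finally show ?thesis .
  qed
  define R where "R T t = (integral {t..t + T} G - integral {0..T} G) / of_real T" for T t
  have R_le: "norm (R T t) \<le> 2 * B" "norm (R T t) \<le> 2 * \<bar>t\<bar> * B / T" if "T > 0" for T t
  proof -
    have "norm (integral {t..t + T} G - integral {0..T} G) \<le> B * (t + T - t) + B * (T - 0)"
      using that G_le by (intro norm_diff_mono norm_integral_le bounded_borel_integrable_on[OF Gm G_le]) auto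
    then show "norm (R T t) \<le> 2 * B" using that by (simp add: R_def norm_divide divide_le_eq mult_ac)
    have "norm (integral {t..t + T} G - integral {0..T} G) \<le> 2 * \<bar>t\<bar> * B"
      using that by (intro integral_window_shift bounded_borel_integrable_on[OF Gm G_le] G_le) auto
    then show "norm (R T t) \<le> 2 * \<bar>t\<bar> * B / T" using that by (simp add: R_def norm_divide divide_right_mono)
  qed
  have R_eq: "(LINT y|lborel. indicator {0..T} y *\<^sub>R G (y + t)) = integral {t..t + T} G" for T t
    using integral_window_translate[OF Gm G_le, of 0 T t] by (simp add: add.commute)
  have Rm[measurable]: "(\<lambda>t. R T t) \<in> borel_measurable borel" for T
  proof -
    have "(\<lambda>t. LINT y|lborel. indicator {0..T} y *\<^sub>R G (y + t)) \<in> borel_measurable borel" by measurable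
    then show ?thesis unfolding R_def R_eq by measurable
  qed
  have main: "integral {0..T} (\<lambda>y. conv y * cis (- (\<mu> * y))) / of_real T - (LINT t|lborel. K t) * (integral {0..T} G / of_real T)
     = (LINT t|lborel. K t * R T t)" if T: "T > 0" for T
  proof -
    have KI: "integrable lborel (\<lambda>t. K t * integral {t..t + T} G)"
    proof (rule Bochner_Integration.integrable_bound)
      show "integrable lborel (\<lambda>t. (B * T) * norm (K t))" using Ki by auto
      have "(\<lambda>t. LINT y|lborel. indicator {0..T} y *\<^sub>R G (y + t)) \<in> borel_measurable borel" by measurable
      then have [measurable]: "(\<lambda>t. integral {t..t + T} G) \<in> borel_measurable borel" unfolding R_eq .
      have [measurable]: "K \<in> borel_measurable borel" using borel_measurable_integrable[OF Ki] by simp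
      show "(\<lambda>t. K t * integral {t..t + T} G) \<in> borel_measurable lborel" by measurable
      show "AE t in lborel. norm (K t * integral {t..t + T} G) \<le> norm ((B * T) * norm (K t))"
      proof (intro AE_I2)
        fix t
        have "norm (integral {t..t + T} G) \<le> B * (t + T - t)"
          using T G_le by (intro norm_integral_le bounded_borel_integrable_on[OF Gm G_le]) auto
        then show "norm (K t * integral {t..t + T} G) \<le> norm ((B * T) * norm (K t))"
          using T B_nonneg by (simp add: norm_mult abs_mult mult.commute[of "norm (K t)"] mult_right_mono)
      qed
    qed
    have "integral {0..T} (\<lambda>y. conv y * cis (- (\<mu> * y))) = (LINT y|lborel. indicator {0..T} y *\<^sub>R (conv y * cis (- (\<mu> * y))))"
    proof (rule integral_eq_lborel)
      show "(\<lambda>y. conv y * cis (- (\<mu> * y))) \<in> borel_measurable borel"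
        by (intro borel_measurable_continuous_onI continuous_intros uniformly_continuous_imp_continuous conv_uniformly_continuous)
      show "norm (conv y * cis (- (\<mu> * y))) \<le> B * (LINT t|lborel. \<bar>k t\<bar>)" for y
        using conv_le by (simp add: norm_mult)
    qed
    also have "\<dots> = (LINT t|lborel. K t * integral {t..t + T} G)"
      unfolding conv_G fubini_window[OF Ki Gm G_le] R_eq ..
    finally have "integral {0..T} (\<lambda>y. conv y * cis (- (\<mu> * y))) - (LINT t|lborel. K t) * integral {0..T} G
      = (LINT t|lborel. K t * integral {t..t + T} G - K t * integral {0..T} G)"
      using KI Ki by simp
    also have "\<dots> = (LINT t|lborel. of_real T * (K t * R T t))"
      using T by (intro Bochner_Integration.integral_cong refl) (simp add: R_def, simp add: right_diff_distrib)
    also have "\<dots> = of_real T * (LINT t|lborel. K t * R T t)" by simp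
    finally show ?thesis using T by (simp add: field_simps)
  qed
  have "((\<lambda>T. LINT t|lborel. K t * R T t) \<longlongrightarrow> (LINT t|(lborel::real measure). 0)) at_top"
  proof (rule integral_dominated_convergence_at_top[where w="\<lambda>t. (2 * B) * norm (K t)"])
    have [measurable]: "K \<in> borel_measurable borel" using borel_measurable_integrable[OF Ki] by simp
    show "(\<lambda>t. K t * R T t) \<in> borel_measurable lborel" for T by measurable
    show "integrable lborel (\<lambda>t. (2 * B) * norm (K t))" using Ki by auto
    show "eventually (\<lambda>T. AE t in lborel. norm (K t * R T t) \<le> (2 * B) * norm (K t)) at_top"
      using eventually_gt_at_top[of 0]
    proof eventually_elim
      case (elim T)
      then show ?case using R_le(1)[OF elim] by (intro AE_I2) (simp add: norm_mult mult.commute mult_left_mono)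
    qed
    show "AE t in lborel. ((\<lambda>T. K t * R T t) \<longlongrightarrow> 0) at_top"
    proof (intro AE_I2)
      fix t
      have "((\<lambda>T. 2 * \<bar>t\<bar> * B / T) \<longlongrightarrow> 0) at_top"
        by (rule tendsto_divide_0[OF tendsto_const filterlim_at_top_imp_at_infinity[OF filterlim_ident]])
      then have "((\<lambda>T. R T t) \<longlongrightarrow> 0) at_top"
      proof (rule Lim_null_comparison[rotated])
        show "eventually (\<lambda>T. norm (R T t) \<le> 2 * \<bar>t\<bar> * B / T) at_top"
          using eventually_gt_at_top[of 0] by eventually_elim (rule R_le(2))
      qed
      then show "((\<lambda>T. K t * R T t) \<longlongrightarrow> 0) at_top" by (rule tendsto_mult_right_zero)
    qed
  qed measurable
  moreover have "eventually (\<lambda>T. (LINT t|lborel. K t * R T t) = integral {0..T} (\<lambda>y. conv y * cis (- (\<mu> * y))) / of_real T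
     - (LINT t|lborel. K t) * (integral {0..T} G / of_real T)) at_top"
    using eventually_gt_at_top[of 0] by eventually_elim (rule main[symmetric])
  ultimately show ?thesis unfolding K_def[symmetric] G_def[symmetric] by (simp add: tendsto_cong)
qed

text \<open>Shifting \<open>1 / (1 + t\<^sup>2)\<close> by some \<open>v \<in> {0..pi}\<close> changes it by at most a constant factor; averaging over
  \<open>v\<close> makes the window means of the Stepanov norm appear.\<close>

lemma conv_translate_le:
  assumes \<tau>: "\<And>u. integral {u..u + pi} (\<lambda>t. norm (g (t + \<tau>) - g t)) \<le> pi * \<epsilon>"
  shows "norm (conv (y + \<tau>) - conv y) \<le> C * (2 + 2 * pi\<^sup>2) * (LINT t|lborel. 1 / (1 + t\<^sup>2)) * \<epsilon>"
proof -
  define p where "p t = 1 / (1 + t\<^sup>2)" for t :: real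
  define D where "D s = norm (g (y + s + \<tau>) - g (y + s))" for s
  \<comment> \<open>This value gives \<open>1 + t\<^sup>2 \<le> M * (1 + (v + t)\<^sup>2)\<close>
    whenever \<open>v\<close> lies in \<open>{0..pi}\<close>.\<close>
  define M :: real where "M = 2 + 2 * pi\<^sup>2"
  have M: "M > 0" unfolding M_def by (intro add_pos_nonneg) auto
  have p_int: "integrable lborel p" unfolding p_def by (rule integrable_inverse_square)
  have p_pos: "p t > 0" for t by (simp add: p_def add_pos_nonneg)
  have [measurable]: "p \<in> borel_measurable borel" using borel_measurable_integrable[OF p_int] by simp
  have Dm[measurable]: "D \<in> borel_measurable borel" unfolding D_def by measurable
  have D_le: "norm (D s) \<le> 2 * B" for s
    using norm_diff_mono[OF g_le g_le, of "y + s + \<tau>" "y + s"] by (simp add: D_def)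
  have D_nonneg: "D s \<ge> 0" for s by (simp add: D_def)
  have pD: "integrable lborel (\<lambda>t. p t * D (v + t))" for v by (rule integrable_kernel_mult[OF p_int Dm D_le])
  define q where "q v = (LINT t|lborel. p t * D (v + t))" for v
  have q_le: "norm (q v) \<le> 2 * B * (LINT t|lborel. p t)" for v
  proof -
    have "norm (q v) \<le> (LINT t|lborel. 2 * B * p t)"
      unfolding q_def
    proof (rule Bochner_Integration.integral_norm_bound_integral)
      show "norm (p t * D (v + t)) \<le> 2 * B * p t" for t
        using mult_right_mono[OF D_le[of "v + t"], of "p t"] p_pos[of t] by (simp add: abs_mult mult.commute)
    qed (use pD p_int in auto)
    then show ?thesis by simp
  qed
  have qm[measurable]: "q \<in> borel_measurable borel" unfolding q_def by measurable
  have q_ge: "q 0 / M \<le> q v" if v: "v \<in> {0..pi}" for v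
  proof -
    have "q 0 = (LINT t|lborel. p (v + t) * D (v + t))"
      unfolding q_def using lborel_integral_real_affine[of 1 "\<lambda>t. p t * D t" v] by simp
    also have "\<dots> \<le> (LINT t|lborel. M * (p t * D (v + t)))"
    proof (rule integral_mono)
      show "integrable lborel (\<lambda>t. p (v + t) * D (v + t))"
        using lborel_integrable_real_affine[OF pD[of 0], of 1 v] by simp
      show "integrable lborel (\<lambda>t. M * (p t * D (v + t)))" using pD by auto
      fix t
      have "v\<^sup>2 \<le> pi\<^sup>2" using v by (intro power_mono) auto
      moreover have "(2 * v + t)\<^sup>2 \<ge> 0" "(v + t)\<^sup>2 * pi\<^sup>2 \<ge> 0" by auto
      moreover have "t\<^sup>2 \<le> 2 * (v + t)\<^sup>2 + 2 * v\<^sup>2"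
        using zero_le_power2[of "2 * v + t"] by (simp add: power2_eq_square algebra_simps)
      moreover have "M * (1 + (v + t)\<^sup>2) = 2 + 2 * pi\<^sup>2 + 2 * (v + t)\<^sup>2 + 2 * ((v + t)\<^sup>2 * pi\<^sup>2)"
        by (simp add: M_def distrib_left distrib_right)
      ultimately have "1 + t\<^sup>2 \<le> M * (1 + (v + t)\<^sup>2)" by linarith
      then have "p (v + t) \<le> M * p t" by (simp add: p_def divide_le_eq le_divide_eq add_pos_nonneg mult_ac)
      from mult_right_mono[OF this D_nonneg[of "v + t"]] show "p (v + t) * D (v + t) \<le> M * (p t * D (v + t))" by (simp add: mult_ac)
    qed
    also have "\<dots> = M * q v" by (simp add: q_def)
    finally show ?thesis using M by (simp add: divide_le_eq mult.commute)
  qed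
  have ind: "integrable lborel (\<lambda>v. indicator {0..pi} v *\<^sub>R (q 0 / M))" 
    by (rule integrable_window[of _ "norm (q 0 / M)"]) auto
  have "pi * (q 0 / M) = (LINT v|lborel. indicator {0..pi} v *\<^sub>R (q 0 / M))" by simp
  also have "\<dots> \<le> (LINT v|lborel. indicator {0..pi} v *\<^sub>R q v)"
    by (rule integral_mono[OF ind integrable_window[OF qm q_le]]) (auto simp: indicator_def q_ge)
  also have "\<dots> = (LINT t|lborel. p t * (LINT v|lborel. indicator {0..pi} v *\<^sub>R D (v + t)))"
    unfolding q_def by (rule fubini_window[OF p_int Dm D_le])
  also have "\<dots> \<le> (LINT t|lborel. p t * (pi * \<epsilon>))"
  proof (rule integral_mono_AE')
    show "integrable lborel (\<lambda>t. p t * (pi * \<epsilon>))" using p_int by auto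
    have w: "(LINT v|lborel. indicator {0..pi} v *\<^sub>R D (v + t)) = integral {0..pi} (\<lambda>v. D (v + t))" for t
      by (rule integral_eq_lborel[symmetric, where B="2 * B"]) (use D_le in auto)
    have w': "integral {0..pi} (\<lambda>v. D (v + t)) = integral {y + t..y + t + pi} (\<lambda>t. norm (g (t + \<tau>) - g t))" for t
      using integral_shift_Icc_real[of 0 pi "\<lambda>t. norm (g (t + \<tau>) - g t)" "y + t"] by (simp add: o_def D_def add_ac)
    show "AE t in lborel. p t * (LINT v|lborel. indicator {0..pi} v *\<^sub>R D (v + t)) \<le> p t * (pi * \<epsilon>)"
      unfolding w w' using \<tau> p_pos by (intro AE_I2 mult_left_mono) (auto simp: less_imp_le)
    show "AE t in lborel. 0 \<le> p t * (pi * \<epsilon>)"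
    proof (intro AE_I2 mult_nonneg_nonneg)
      fix t
      show "p t \<ge> 0" using p_pos[of t] by simp
      have "0 \<le> integral {0..pi} (\<lambda>v. D (v + t))"
        by (intro Henstock_Kurzweil_Integration.integral_nonneg bounded_borel_integrable_on[where B="2 * B"]) (use D_le D_nonneg in auto)
      then show "0 \<le> \<epsilon>" unfolding w' using \<tau>[of "y + t"] by (metis order_trans pi_gt_zero zero_le_mult_iff not_less order_less_imp_le)
    qed simp
  qed
  also have "\<dots> = pi * \<epsilon> * (LINT t|lborel. p t)" by simp
  finally have Q: "q 0 \<le> M * \<epsilon> * (LINT t|lborel. p t)" using M by (simp add: divide_le_eq mult_ac)
  have "conv (y + \<tau>) - conv y = (LINT t|lborel. of_real (k t) * g (y + \<tau> + t) - of_real (k t) * g (y + t))"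
    unfolding conv_def by (intro Bochner_Integration.integral_diff[symmetric] integrable_kernel_mult[OF k_int' g_meas g_le])
  also have "norm \<dots> \<le> (LINT t|lborel. C * (p t * D (0 + t)))"
  proof (rule Bochner_Integration.integral_norm_bound_integral)
    show "integrable lborel (\<lambda>t. of_real (k t) * g (y + \<tau> + t) - of_real (k t) * g (y + t))"
      by (intro Bochner_Integration.integrable_diff integrable_kernel_mult[OF k_int' g_meas g_le])
    show "integrable lborel (\<lambda>t. C * (p t * D (0 + t)))" by (intro integrable_mult_right pD)
    fix t
    have "of_real (k t) * g (y + \<tau> + t) - of_real (k t) * g (y + t) = of_real (k t) * (g (y + t + \<tau>) - g (y + t))"
      by (simp add: algebra_simps)
    then have "norm (of_real (k t) * g (y + \<tau> + t) - of_real (k t) * g (y + t)) = \<bar>k t\<bar> * D t" by (simp add: norm_mult D_def)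
    also have "\<dots> \<le> (C * p t) * D t" using k_le[of t] D_nonneg by (intro mult_right_mono) (auto simp: p_def)
    finally show "norm (of_real (k t) * g (y + \<tau> + t) - of_real (k t) * g (y + t)) \<le> C * (p t * D (0 + t))" by (simp add: mult_ac)
  qed
  also have "\<dots> = C * q 0" by (simp add: q_def)
  also have "\<dots> \<le> C * (M * \<epsilon> * (LINT t|lborel. p t))" by (intro mult_left_mono Q C_nonneg)
  finally show ?thesis by (simp add: M_def p_def[abs_def] mult_ac)
qed

text \<open>By \<open>conv_translate_le\<close>, near-periods in the Stepanov mean become
  near-periods in the uniform norm. This is the passage to the class in which the uniqueness theorem
  holds.\<close>

lemma conv_bochner_ap:
  assumes "\<And>\<epsilon>. \<epsilon> > 0 \<Longrightarrow> \<exists>l>0. \<forall>a. \<exists>\<tau>\<in>{a..a + l}. \<forall>u. integral {u..u + pi} (\<lambda>t. norm (g (t + \<tau>) - g t)) \<le> pi * \<epsilon>"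
  shows "bochner_ap conv"
proof (rule bochner_apI_relatively_dense[OF conv_uniformly_continuous])
  fix \<epsilon> :: real assume \<epsilon>: "\<epsilon> > 0"
  define L where "L = C * (2 + 2 * pi\<^sup>2) * (LINT t|lborel. 1 / (1 + t\<^sup>2))"
  have L: "L \<ge> 0" unfolding L_def by (intro mult_nonneg_nonneg C_nonneg Bochner_Integration.integral_nonneg) auto
  obtain l where l: "l > 0" "\<And>a. \<exists>\<tau>\<in>{a..a + l}. \<forall>u. integral {u..u + pi} (\<lambda>t. norm (g (t + \<tau>) - g t)) \<le> pi * (\<epsilon> / (L + 1))"
    using assms[of "\<epsilon> / (L + 1)"] \<epsilon> L by auto
  have "\<exists>\<tau>\<in>{a..a + l}. \<forall>t. norm (conv (t + \<tau>) - conv t) \<le> \<epsilon>" for a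
  proof -
    obtain \<tau> where \<tau>: "\<tau> \<in> {a..a + l}" "\<And>u. integral {u..u + pi} (\<lambda>t. norm (g (t + \<tau>) - g t)) \<le> pi * (\<epsilon> / (L + 1))"
      using l(2) by blast
    have "norm (conv (t + \<tau>) - conv t) \<le> \<epsilon>" for t
    proof -
      have "norm (conv (t + \<tau>) - conv t) \<le> L * (\<epsilon> / (L + 1))" unfolding L_def[symmetric] using conv_translate_le[OF \<tau>(2)] by (simp add: L_def)
      also have "\<dots> \<le> \<epsilon>" using L \<epsilon> by (simp add: divide_le_eq algebra_simps)
      finally show ?thesis .
    qed
    with \<tau>(1) show ?thesis by blast
  qed
  with l(1) show "\<exists>l>0. \<forall>a. \<exists>\<tau>\<in>{a..a + l}. \<forall>t. norm (conv (t + \<tau>) - conv t) \<le> \<epsilon>" by blast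
qed

end

subsection \<open>Partial sums as singular integrals\<close>

lemma null_sets_affine:
  fixes N :: "real set" and c :: real
  assumes "N \<in> null_sets lborel" "c \<noteq> 0"
  shows "{t. s + c * t \<in> N} \<in> null_sets lborel"
proof -
  have [measurable]: "N \<in> sets borel" using assms(1) by auto
  have "AE t in lborel. t \<notin> N" using assms(1) by (rule AE_not_in)
  then have "AE t in lborel. s + c * t \<notin> N" by (intro AE_borel_affine assms(2)) auto
  moreover have "{t. s + c * t \<in> N} \<in> sets lborel"
  proof -
    have "(\<lambda>t. s + c * t) -` N \<inter> space lborel \<in> sets lborel" by (intro measurable_sets[where A=borel]) auto
    then show ?thesis by (simp add: vimage_def)
  qed
  ultimately show ?thesis using AE_iff_null_sets[of "{t. s + c * t \<in> N}" lborel] by simp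
qed

lemma negligible_null_set: "N \<in> null_sets lborel \<Longrightarrow> negligible N"
  by (simp add: negligible_iff_null_sets null_sets_completionI)

text \<open>The convolutions use Borel measurability, while \<open>f\<close> is only known to be
  Lebesgue measurable. The exceptional set is kept explicit because gauge integrals are compared by
  modification on it, and because translates and reflections of it occur in
  \<open>phi\<close>.\<close>

lemma ex_borel_version:
  fixes f :: "real \<Rightarrow> complex"
  assumes ai: "\<And>a b. f absolutely_integrable_on {a..b}" and B: "\<And>t. norm (f t) \<le> B"
  obtains g N where "g \<in> borel_measurable borel" "\<And>t. norm (g t) \<le> B" "N \<in> null_sets lborel" "\<And>t. t \<notin> N \<Longrightarrow> g t = f t"
proof -
  have B0: "B \<ge> 0" using B[of 0] norm_ge_zero order_trans by blast
  have "f \<in> borel_measurable lebesgue"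
  proof (rule borel_measurable_LIMSEQ_metric)
    fix n :: nat
    have "integrable lebesgue (\<lambda>t. indicator {- real n..real n} t *\<^sub>R f t)"
      using ai[of "- real n" "real n"] by (simp add: set_integrable_def)
    then show "(\<lambda>t. indicator {- real n..real n} t *\<^sub>R f t) \<in> borel_measurable lebesgue" by auto
  next
    fix t :: real
    have "eventually (\<lambda>n. indicator {- real n..real n} t *\<^sub>R f t = f t) sequentially"
    proof -
      have "eventually (\<lambda>n. real n \<ge> \<bar>t\<bar>) sequentially" using filterlim_real_sequentially by (simp add: filterlim_at_top)
      then show ?thesis by eventually_elim (auto simp: indicator_def)
    qed
    then show "(\<lambda>n. indicator {- real n..real n} t *\<^sub>R f t) \<longlonglongrightarrow> f t" by (rule tendsto_eventually)
  qed
  then have m: "(\<lambda>t. Re (f t)) \<in> borel_measurable (completion lborel)" "(\<lambda>t. Im (f t)) \<in> borel_measurable (completion lborel)"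
    by simp_all
  obtain u v where uv[measurable]: "u \<in> borel_measurable lborel" "v \<in> borel_measurable lborel"
    and ae: "AE t in lborel. Re (f t) = u t" "AE t in lborel. Im (f t) = v t"
    using completion_ex_borel_measurable_real[OF m(1)] completion_ex_borel_measurable_real[OF m(2)] by auto
  have aeN: "AE t in lborel. Re (f t) = u t \<and> Im (f t) = v t" using ae by eventually_elim auto
  obtain N where "{t \<in> space lborel. \<not> (Re (f t) = u t \<and> Im (f t) = v t)} \<subseteq> N" "emeasure lborel N = 0" "N \<in> sets lborel"
    by (rule AE_E[OF aeN])
  then have N: "N \<in> null_sets lborel" "{t \<in> space lborel. \<not> (Re (f t) = u t \<and> Im (f t) = v t)} \<subseteq> N" by auto
  define g0 where "g0 t = of_real (u t) + \<i> * of_real (v t)" for t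
  \<comment> \<open>Truncation restores the bound at every point; outside \<open>N\<close> it
    changes nothing, since \<open>f\<close> itself obeys the bound.\<close>
  define g where "g t = (if norm (g0 t) \<le> B then g0 t else 0)" for t
  have g0[measurable]: "g0 \<in> borel_measurable borel" unfolding g0_def using uv by simp
  show ?thesis
  proof (rule that[of g N])
    show "g \<in> borel_measurable borel" unfolding g_def by measurable
    show "norm (g t) \<le> B" for t using B0 by (simp add: g_def)
    show "g t = f t" if "t \<notin> N" for t
    proof -
      have "Re (f t) = u t \<and> Im (f t) = v t" using subsetD[OF N(2), of t] that by auto
      then have "g0 t = f t" by (simp add: g0_def complex_eq_iff)
      then show ?thesis using B[of t] by (simp add: g_def)
    qed
  qed fact
qed

lemma uniformly_continuous_on_cis: "uniformly_continuous_on UNIV (\<lambda>t. A * cis (\<mu> * t))"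
unfolding uniformly_continuous_on_def
proof (intro allI impI)
  fix e :: real assume e: "e > 0"
  define d where "d = e / (norm A * \<bar>\<mu>\<bar> + 1)"
  have p: "norm A * \<bar>\<mu>\<bar> + 1 > 0" by (intro add_nonneg_pos) auto
  have d: "d > 0" using e p by (simp add: d_def)
  have "dist (A * cis (\<mu> * s)) (A * cis (\<mu> * t)) < e" if "dist s t < d" for s t
  proof -
    have "A * cis (\<mu> * s) - A * cis (\<mu> * t) = A * cis (\<mu> * t) * (cis (\<mu> * (s - t)) - 1)"
      by (simp add: right_diff_distrib cis_mult mult.assoc)
    then have "dist (A * cis (\<mu> * s)) (A * cis (\<mu> * t)) = norm A * norm (cis (\<mu> * (s - t)) - 1)"
      by (simp add: dist_norm norm_mult)
    also have "\<dots> \<le> norm A * \<bar>\<mu> * (s - t)\<bar>" by (intro mult_left_mono norm_cis_minus_one_le) auto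
    also have "\<dots> = (norm A * \<bar>\<mu>\<bar>) * dist s t" by (simp add: abs_mult dist_real_def)
    also have "\<dots> \<le> (norm A * \<bar>\<mu>\<bar>) * d" using that by (intro mult_left_mono) auto
    also have "\<dots> < (norm A * \<bar>\<mu>\<bar> + 1) * d" using d by simp
    also have "\<dots> = e" using p by (simp add: d_def)
    finally show ?thesis .
  qed
  then show "\<exists>d>0. \<forall>t\<in>UNIV. \<forall>s\<in>UNIV. dist s t < d \<longrightarrow> dist (A * cis (\<mu> * s)) (A * cis (\<mu> * t)) < e"
    using d by blast
qed

lemma mean_cis: "((\<lambda>T. integral {0..T} (\<lambda>t. cis (c * t)) / of_real T) \<longlongrightarrow> (if c = 0 then 1 else 0)) at_top"
proof (cases "c = 0")
  case True
  have "eventually (\<lambda>T. integral {0..T} (\<lambda>t. cis (c * t)) / of_real T = 1) at_top"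
    using eventually_gt_at_top[of 0] by eventually_elim (simp add: True scaleR_conv_of_real)
  then show ?thesis using True by (simp add: tendsto_eventually)
next
  case False
  have "((\<lambda>T. (2 / \<bar>c\<bar>) / T) \<longlongrightarrow> 0) at_top"
    by (rule tendsto_divide_0[OF tendsto_const filterlim_at_top_imp_at_infinity[OF filterlim_ident]])
  then have "((\<lambda>T. integral {0..T} (\<lambda>t. cis (c * t)) / of_real T) \<longlongrightarrow> 0) at_top"
  proof (rule Lim_null_comparison[rotated])
    show "eventually (\<lambda>T. norm (integral {0..T} (\<lambda>t. cis (c * t)) / of_real T) \<le> (2 / \<bar>c\<bar>) / T) at_top"
      using eventually_gt_at_top[of 0]
    proof eventually_elim
      case (elim T)
      have "norm (cis (c * T) - 1) \<le> 1 + 1" by (intro norm_diff_mono) auto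
      then show ?case using elim False integral_unique[OF integral_cis[of T c]]
        by (simp add: norm_divide norm_mult divide_right_mono)
    qed
  qed
  then show ?thesis using False by simp
qed

section \<open>Fourier exponents and the representation of partial sums\<close>

lemma fourier_exponents_strict_mono:
  assumes "fourier_exponents f lam" shows "strict_mono lam"
proof -
  have 0: "lam 0 = 0" and pos: "\<And>\<nu>. \<nu> \<ge> 1 \<Longrightarrow> 0 < lam \<nu> \<and> lam \<nu> < lam (\<nu> + 1)"
    and neg: "\<And>\<nu>. lam (- \<nu>) = - lam \<nu>" using assms by (auto simp: fourier_exponents_def)
  have nn: "lam \<nu> < lam (\<nu> + 1)" if "\<nu> \<ge> 0" for \<nu> using pos[of \<nu>] pos[of 1] 0 that by (cases "\<nu> = 0") auto
  have step: "lam \<nu> < lam (\<nu> + 1)" for \<nu>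
  proof (cases "\<nu> \<ge> 0")
    case False
    then have "lam (- \<nu> - 1) < lam (- \<nu>)" using nn[of "- \<nu> - 1"] by simp
    then show ?thesis using neg[of \<nu>] neg[of "\<nu> + 1"] by simp
  qed (rule nn)
  have "lam \<nu> < lam (\<nu> + 1 + int n)" for \<nu> n
  proof (induction n)
    case 0 show ?case using step by simp
  next
    case (Suc n)
    then show ?case using step[of "\<nu> + 1 + int n"] by (simp add: add_ac)
  qed
  then have "lam \<nu> < lam \<mu>" if "\<nu> < \<mu>" for \<nu> \<mu>
    using that by (metis zle_iff_zadd zless_imp_add1_zle)
  then show ?thesis by (simp add: strict_mono_def)
qed

lemma fourier_exponents_finite:
  assumes "fourier_exponents f lam" shows "finite {\<nu>. \<bar>lam \<nu>\<bar> \<le> \<gamma>}"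
proof -
  have "eventually (\<lambda>\<nu>. lam \<nu> > \<gamma>) at_top" and neg: "\<And>\<nu>. lam (- \<nu>) = - lam \<nu>"
    using assms by (auto simp: fourier_exponents_def filterlim_at_top_dense)
  then obtain n where n: "\<And>\<nu>. \<nu> \<ge> n \<Longrightarrow> lam \<nu> > \<gamma>" by (auto simp: eventually_at_top_linorder)
  have "{\<nu>. \<bar>lam \<nu>\<bar> \<le> \<gamma>} \<subseteq> {- n..n}"
  proof (clarsimp simp: abs_le_iff)
    fix \<nu> assume "lam \<nu> \<le> \<gamma>" "- lam \<nu> \<le> \<gamma>"
    then show "- n \<le> \<nu> \<and> \<nu> \<le> n" using n[of \<nu>] n[of "- \<nu>"] neg[of \<nu>] by (smt (verit))
  qed
  then show ?thesis by (rule finite_subset) simp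
qed

lemma conv_kernel_vp:
  assumes "\<kappa> < \<eta>" "g \<in> borel_measurable borel" "\<And>t. norm (g t) \<le> B"
  shows "conv_kernel (vp_kernel \<kappa> \<eta>) ((\<eta>\<^sup>2 + \<kappa>\<^sup>2 + 4) / (\<eta> - \<kappa>)) g B"
  by unfold_locales (use assms vp_kernel_le vp_kernel_isCont vp_kernel_integrable in auto)

text \<open>Almost periodicity and the Fourier coefficients belong to \<open>f\<close>, the
  convolutions to its Borel version \<open>g\<close>; the first lemmas of the locale transfer
  integrals between the two.\<close>

locale stepanov_borel =
  fixes f g :: "real \<Rightarrow> complex" and B :: real and N :: "real set"
  assumes f_ap: "f \<in> stepanov_ap"
    and g_meas[measurable]: "g \<in> borel_measurable borel" and g_le: "\<And>t. norm (g t) \<le> B"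
    and N: "N \<in> null_sets lborel" and g_eq: "\<And>t. t \<notin> N \<Longrightarrow> g t = f t"
begin

lemma integral_f_eq_g: "integral {a..b} (\<lambda>t. F t (f t)) = integral {a..b} (\<lambda>t. F t (g t))"
  by (rule integral_spike[OF negligible_null_set[OF N]]) (auto simp: g_eq)

lemma integral_f_shift_eq_g:
  "integral {a..b} (\<lambda>t. F (f (t + \<tau>)) (f t)) = integral {a..b} (\<lambda>t. F (g (t + \<tau>)) (g t))"
proof (rule integral_spike)
  have "{t. \<tau> + 1 * t \<in> N} \<in> null_sets lborel" by (rule null_sets_affine[OF N]) simp
  then show "negligible ({t. \<tau> + 1 * t \<in> N} \<union> N)" by (intro negligible_Un negligible_null_set N)
qed (auto simp: g_eq add.commute)

lemma g_relatively_dense: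
  assumes "\<epsilon> > 0"
  shows "\<exists>l>0. \<forall>a. \<exists>\<tau>\<in>{a..a + l}. \<forall>u. integral {u..u + pi} (\<lambda>t. norm (g (t + \<tau>) - g t)) \<le> pi * \<epsilon>"
proof -
  obtain l where l: "l > 0" "\<And>a. \<exists>\<tau>\<in>{a..a + l}. stepanov_translation_number f \<epsilon> \<tau>"
    using f_ap assms unfolding stepanov_ap_def by blast
  have "integral {u..u + pi} (\<lambda>t. norm (g (t + \<tau>) - g t)) \<le> pi * \<epsilon>" if "stepanov_translation_number f \<epsilon> \<tau>" for \<tau> u
  proof -
    have "(1 / pi) * integral {u..u + pi} (\<lambda>t. norm (f (t + \<tau>) - f t)) \<le> \<epsilon>"
      using that unfolding stepanov_translation_number_def by blast
    then show ?thesis using integral_f_shift_eq_g[of u "u + pi" "\<lambda>x y. norm (x - y)" \<tau>]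
      by (simp add: pos_divide_le_eq mult.commute)
  qed
  with l show ?thesis by blast
qed

lemma conv_mean:
  fixes \<kappa> \<eta> :: real
  assumes "\<kappa> < \<eta>"
  defines "h \<equiv> conv_kernel.conv (vp_kernel \<kappa> \<eta>) g"
  shows "bochner_ap h" "uniformly_continuous_on UNIV h"
    and "\<exists>B'. \<forall>t. norm (h t) \<le> B'"
    and "((\<lambda>T. integral {0..T} (\<lambda>y. h y * cis (- (\<mu> * y))) / of_real T
     - (LINT t|lborel. of_real (vp_kernel \<kappa> \<eta> t) * cis (\<mu> * t)) * (integral {0..T} (\<lambda>y. g y * cis (- (\<mu> * y))) / of_real T)) \<longlongrightarrow> 0) at_top"
proof -
  interpret conv_kernel "vp_kernel \<kappa> \<eta>" "(\<eta>\<^sup>2 + \<kappa>\<^sup>2 + 4) / (\<eta> - \<kappa>)" g B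
    by (rule conv_kernel_vp[OF assms(1) g_meas g_le])
  show "bochner_ap h" unfolding h_def by (rule conv_bochner_ap[OF g_relatively_dense])
  show "uniformly_continuous_on UNIV h" unfolding h_def by (rule conv_uniformly_continuous)
  show "\<exists>B'. \<forall>t. norm (h t) \<le> B'" unfolding h_def using conv_le by blast
  show "((\<lambda>T. integral {0..T} (\<lambda>y. h y * cis (- (\<mu> * y))) / of_real T
     - (LINT t|lborel. of_real (vp_kernel \<kappa> \<eta> t) * cis (\<mu> * t)) * (integral {0..T} (\<lambda>y. g y * cis (- (\<mu> * y))) / of_real T)) \<longlongrightarrow> 0) at_top"
    unfolding h_def by (rule conv_fourier)
qed

text \<open>The mean defining the coefficient exists for \<open>f\<close> because it exists for a convolution of \<open>f\<close> whose kernel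
  has transform 1 at \<open>\<mu>\<close>.\<close>

lemma fourier_coeff_tendsto:
  "((\<lambda>T. integral {0..T} (\<lambda>y. g y * cis (- (\<mu> * y))) / of_real T) \<longlongrightarrow> fourier_coeff f \<mu>) at_top"
proof -
  define h where "h = conv_kernel.conv (vp_kernel \<bar>\<mu>\<bar> (\<bar>\<mu>\<bar> + 1)) g"
  have lt: "\<bar>\<mu>\<bar> < \<bar>\<mu>\<bar> + 1" by simp
  note h = conv_mean[OF lt, folded h_def]
  obtain B' where B': "\<And>t. norm (h t) \<le> B'" using h(3) by blast
  have ap: "bochner_ap (\<lambda>t. h t * cis ((- \<mu>) * t))"
    using h(1) B' by (intro bochner_ap_mult[where B="max B' 1"] bochner_ap_cis) (auto simp: le_max_iff_disj)
  have hc: "continuous_on S h" for S using uniformly_continuous_imp_continuous[OF h(2)] continuous_on_subset by blast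
  have "\<exists>l. ((\<lambda>T. integral {0..T} (\<lambda>t. h t * cis ((- \<mu>) * t)) / of_real T) \<longlongrightarrow> l) at_top"
  proof (rule bochner_ap_mean_exists[OF ap])
    show "(\<lambda>t. h t * cis ((- \<mu>) * t)) integrable_on {a..b}" for a b
      by (intro integrable_continuous_interval continuous_intros hc)
    show "norm (h t * cis ((- \<mu>) * t)) \<le> B'" for t using B' by (simp add: norm_mult)
  qed
  then obtain l where l: "((\<lambda>T. integral {0..T} (\<lambda>t. h t * cis (- (\<mu> * t))) / of_real T) \<longlongrightarrow> l) at_top" by auto
  have one: "(LINT t|lborel. of_real (vp_kernel \<bar>\<mu>\<bar> (\<bar>\<mu>\<bar> + 1) t) * cis (\<mu> * t)) = 1"
    by (subst vp_kernel_transform) auto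
  have lim: "((\<lambda>T. integral {0..T} (\<lambda>y. g y * cis (- (\<mu> * y))) / of_real T) \<longlongrightarrow> l) at_top"
    using tendsto_diff[OF l h(4)[of \<mu>, unfolded one]] by simp
  have "fourier_coeff f \<mu> = Lim at_top (\<lambda>T. integral {0..T} (\<lambda>y. g y * cis (- (\<mu> * y))) / of_real T)"
    unfolding fourier_coeff_def
    using integral_f_eq_g[of 0 _ "\<lambda>t z. z * cis (- (\<mu> * t))"] by (simp add: cis_conv_exp)
  also have "\<dots> = l" by (rule tendsto_Lim[OF _ lim]) simp
  finally show ?thesis using lim by simp
qed

text \<open>The difference of the convolution and the partial sum is uniformly almost periodic, and
  its Fourier means vanish: at an exponent the trapezoid is 1 or 0, since no exponent lies over its
  slope, and at any other frequency the coefficient of \<open>f\<close> is 0. The uniqueness theorem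
  then gives equality at every point.\<close>

lemma partial_sum_eq_conv:
  assumes lam: "fourier_exponents f lam" and \<kappa>: "0 \<le> \<kappa>" "\<kappa> < \<eta>"
    and gap: "\<And>\<nu>. \<not> (\<kappa> < \<bar>lam \<nu>\<bar> \<and> \<bar>lam \<nu>\<bar> < \<eta>)"
  shows "partial_sum lam \<kappa> f x = (LINT t|lborel. of_real (vp_kernel \<kappa> \<eta> t) * g (x + t))"
proof -
  interpret conv_kernel "vp_kernel \<kappa> \<eta>" "(\<eta>\<^sup>2 + \<kappa>\<^sup>2 + 4) / (\<eta> - \<kappa>)" g B
    by (rule conv_kernel_vp[OF \<kappa>(2) g_meas g_le])
  note cm = conv_mean[OF \<kappa>(2)]
  define I where "I = {\<nu>. \<bar>lam \<nu>\<bar> \<le> \<kappa>}"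
  have I: "finite I" unfolding I_def by (rule fourier_exponents_finite[OF lam])
  define A where "A \<nu> = fourier_coeff f (lam \<nu>)" for \<nu>
  define h where "h y = conv y - (\<Sum>\<nu>\<in>I. A \<nu> * cis (lam \<nu> * y))" for y
  obtain B' where B': "\<And>t. norm (conv t) \<le> B'" using cm(3) by blast
  have cc: "continuous_on S conv" for S using uniformly_continuous_imp_continuous[OF cm(2)] continuous_on_subset by blast
  have "h x = 0"
  proof (rule bochner_ap_eq_0)
    show "bochner_ap h" unfolding h_def
      by (intro bochner_ap_diff_sum I cm(1) bochner_ap_cmult[where B=1] bochner_ap_cis) auto
    show "uniformly_continuous_on UNIV h" unfolding h_def
      by (intro uniformly_continuous_on_diff uniformly_continuous_on_sum cm(2) uniformly_continuous_on_cis)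
    show "norm (h t) \<le> B' + (\<Sum>\<nu>\<in>I. norm (A \<nu>))" for t
      unfolding h_def by (intro norm_diff_mono B' sum_norm_le) (simp add: norm_mult)
    fix \<mu>
    define J where "J = (LINT t|lborel. of_real (vp_kernel \<kappa> \<eta> t) * cis (\<mu> * t))"
    have 1: "((\<lambda>T. integral {0..T} (\<lambda>y. conv y * cis (- (\<mu> * y))) / of_real T) \<longlongrightarrow> 0 + J * fourier_coeff f \<mu>) at_top"
      using tendsto_add[OF cm(4)[of \<mu>] tendsto_mult[OF tendsto_const[of J] fourier_coeff_tendsto[of \<mu>]]]
      by (simp add: J_def)
    have 2: "((\<lambda>T. \<Sum>\<nu>\<in>I. A \<nu> * (integral {0..T} (\<lambda>t. cis ((lam \<nu> - \<mu>) * t)) / of_real T))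
       \<longlongrightarrow> (\<Sum>\<nu>\<in>I. A \<nu> * (if lam \<nu> - \<mu> = 0 then 1 else 0))) at_top"
      by (intro tendsto_sum tendsto_mult tendsto_const mean_cis)
    have eq: "integral {0..T} (\<lambda>t. h t * cis (- (\<mu> * t))) / of_real T
      = integral {0..T} (\<lambda>y. conv y * cis (- (\<mu> * y))) / of_real T
        - (\<Sum>\<nu>\<in>I. A \<nu> * (integral {0..T} (\<lambda>t. cis ((lam \<nu> - \<mu>) * t)) / of_real T))" for T
    proof -
      have "h t * cis (- (\<mu> * t)) = conv t * cis (- (\<mu> * t)) - (\<Sum>\<nu>\<in>I. A \<nu> * cis ((lam \<nu> - \<mu>) * t))" for t
        by (simp add: h_def left_diff_distrib sum_distrib_right mult.assoc cis_mult)
      then have "integral {0..T} (\<lambda>t. h t * cis (- (\<mu> * t)))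
        = integral {0..T} (\<lambda>t. conv t * cis (- (\<mu> * t)) - (\<Sum>\<nu>\<in>I. A \<nu> * cis ((lam \<nu> - \<mu>) * t)))" by simp
      also have "\<dots> = integral {0..T} (\<lambda>t. conv t * cis (- (\<mu> * t))) - integral {0..T} (\<lambda>t. \<Sum>\<nu>\<in>I. A \<nu> * cis ((lam \<nu> - \<mu>) * t))"
        by (intro Henstock_Kurzweil_Integration.integral_diff integrable_continuous_interval continuous_intros cc)
      also have "integral {0..T} (\<lambda>t. \<Sum>\<nu>\<in>I. A \<nu> * cis ((lam \<nu> - \<mu>) * t)) = (\<Sum>\<nu>\<in>I. integral {0..T} (\<lambda>t. A \<nu> * cis ((lam \<nu> - \<mu>) * t)))"
        by (intro Henstock_Kurzweil_Integration.integral_sum I integrable_continuous_interval continuous_intros)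
      finally show ?thesis by (simp add: diff_divide_distrib sum_divide_distrib)
    qed
    have "0 + J * fourier_coeff f \<mu> - (\<Sum>\<nu>\<in>I. A \<nu> * (if lam \<nu> - \<mu> = 0 then 1 else 0)) = 0"
    proof (cases "\<exists>\<nu>. lam \<nu> = \<mu>")
      case False
      then have "fourier_coeff f \<mu> = 0" using lam by (auto simp: fourier_exponents_def)
      moreover have "(\<Sum>\<nu>\<in>I. A \<nu> * (if lam \<nu> - \<mu> = 0 then 1 else 0)) = 0" using False by (intro sum.neutral) auto
      ultimately show ?thesis by simp
    next
      case True
      then obtain \<nu>0 where \<nu>0: "lam \<nu>0 = \<mu>" by blast
      have inj: "lam \<nu> - \<mu> = 0 \<longleftrightarrow> \<nu> = \<nu>0" for \<nu>
        using strict_mono_eq[OF fourier_exponents_strict_mono[OF lam]] \<nu>0 by auto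
      have "J = (if \<bar>\<mu>\<bar> \<le> \<kappa> then 1 else 0)"
        unfolding J_def using gap[of \<nu>0] \<nu>0 \<kappa> by (intro vp_kernel_transform) auto
      moreover have "(\<Sum>\<nu>\<in>I. A \<nu> * (if lam \<nu> - \<mu> = 0 then 1 else 0)) = (if \<nu>0 \<in> I then A \<nu>0 else 0)"
        unfolding inj using I by (simp add: if_distrib cong: if_cong)
      ultimately show ?thesis using \<nu>0 by (auto simp: I_def A_def)
    qed
    then show "((\<lambda>T. integral {0..T} (\<lambda>t. h t * cis (- (\<mu> * t))) / of_real T) \<longlongrightarrow> 0) at_top"
      unfolding eq using tendsto_diff[OF 1 2] by simp
  qed
  then show ?thesis
    by (simp add: h_def conv_def partial_sum_def I_def A_def cis_conv_exp)
qed

text \<open>The kernel is even with integral 1, so subtracting a constant and folding onto the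
  positive half-line produces a second difference. The constant \<open>z\<close> is free because
  \<open>g x\<close> may differ from \<open>f x\<close>, and it is \<open>f x\<close> that enters
  \<open>phi\<close>.\<close>

lemma partial_sum_deviation:
  assumes lam: "fourier_exponents f lam" and \<kappa>: "0 \<le> \<kappa>" "\<kappa> < \<eta>"
    and gap: "\<And>\<nu>. \<not> (\<kappa> < \<bar>lam \<nu>\<bar> \<and> \<bar>lam \<nu>\<bar> < \<eta>)"
  shows "partial_sum lam \<kappa> f x - z = (LINT t|lborel. indicator {0..} t *\<^sub>R (of_real (vp_kernel \<kappa> \<eta> t) * (g (x + t) + g (x - t) - 2 * z)))"
proof -
  define k where "k t = complex_of_real (vp_kernel \<kappa> \<eta> t)" for t
  have k: "integrable lborel k" unfolding k_def using vp_kernel_integrable by simp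
  have k_minus: "k (- t) = k t" for t by (simp add: k_def vp_kernel_minus)
  have k1: "(LINT t|lborel. k t) = 1"
    using vp_kernel_transform[OF \<kappa>, of 0] \<kappa> by (simp add: k_def)
  have S: "partial_sum lam \<kappa> f x = (LINT t|lborel. k t * g (x + t))"
    unfolding k_def by (rule partial_sum_eq_conv[OF lam \<kappa> gap])
  also have "\<dots> = (LINT t|lborel. k t * g (x - t))"
    using lborel_integral_real_affine[of "-1" "\<lambda>t. k t * g (x + t)" 0] by (simp add: k_minus)
  finally have S': "partial_sum lam \<kappa> f x = (LINT t|lborel. k t * g (x - t))" .
  have i1: "integrable lborel (\<lambda>t. k t * g (x + t))" by (rule integrable_kernel_mult[OF k g_meas g_le])
  have i2: "integrable lborel (\<lambda>t. k t * g (x - t))"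
    using lborel_integrable_real_affine[OF i1, of "-1" 0] by (simp add: k_minus)
  define F where "F t = k t * (g (x + t) + g (x - t) - 2 * z)" for t
  have F_eq: "F t = (k t * g (x + t) + k t * g (x - t)) - 2 * z * k t" for t by (simp add: F_def algebra_simps)
  have Fi: "integrable lborel F" unfolding F_eq using i1 i2 k by auto
  have "(LINT t|lborel. F t) = 2 * (partial_sum lam \<kappa> f x - z)"
    unfolding F_eq using i1 i2 k by (simp add: S[symmetric] S'[symmetric] k1)
  moreover have Fe: "F (- t) = F t" for t by (simp add: F_def k_minus)
  have "integrable lborel (\<lambda>t. indicator {0..} t *\<^sub>R F t)" using Fi by (intro integrable_mult_indicator) auto
  then have "has_bochner_integral lborel (\<lambda>t. indicator {0..} t *\<^sub>R F t) (LINT t|lborel. indicator {0..} t *\<^sub>R F t)"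
    by (rule has_bochner_integral_integrable)
  from has_bochner_integral_even_function[OF this Fe]
  have "(LINT t|lborel. F t) = 2 *\<^sub>R (LINT t|lborel. indicator {0..} t *\<^sub>R F t)" by (simp add: has_bochner_integral_iff)
  ultimately have "2 * (partial_sum lam \<kappa> f x - z) = 2 * (LINT t|lborel. indicator {0..} t *\<^sub>R F t)"
    by (simp only: scaleR_conv_of_real of_real_numeral)
  then have "partial_sum lam \<kappa> f x - z = (LINT t|lborel. indicator {0..} t *\<^sub>R F t)"
    by (subst (asm) mult_cancel_left) auto
  then show ?thesis by (simp add: F_def k_def)
qed

end

subsection \<open>Bessel type inequalities\<close>

text \<open>Expansion of the integral of the squared distance between \<open>u\<close> and its
  projection \<open>S\<close> on the exponentials. Only the modulus of \<open>\<beta>\<close> is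
  prescribed, so that both exponentials of a sine are covered.\<close>

lemma bessel_inequality:
  fixes u :: "real \<Rightarrow> complex" and K :: "nat set"
  assumes K: "finite K" and P: "P > 0" and \<beta>: "\<bar>\<beta>\<bar> = 2 * pi / P"
    and u[measurable]: "u \<in> borel_measurable borel" and B: "\<And>t. norm (u t) \<le> B"
  shows "(\<Sum>k\<in>K. (norm (integral {0..P} (\<lambda>t. u t * cis (real k * \<beta> * t))))\<^sup>2) \<le> P * integral {0..P} (\<lambda>t. (norm (u t))\<^sup>2)"
proof -
  have B0: "B \<ge> 0" using B[of 0] norm_ge_zero order_trans by blast
  have [measurable]: "(\<lambda>t. cis (c * t)) \<in> borel_measurable borel" for c :: real
    by (intro borel_measurable_continuous_onI continuous_intros)
  define e where "e k t = cis (real k * \<beta> * t)" for k t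
  have em[measurable]: "e k \<in> borel_measurable borel" for k unfolding e_def by measurable
  have ecm[measurable]: "(\<lambda>t. cnj (e k t)) \<in> borel_measurable borel" for k
    unfolding e_def by (intro borel_measurable_continuous_onI continuous_intros)
  have ne[simp]: "norm (e k t) = 1" for k t by (simp add: e_def)
  have iu: "(\<lambda>t. u t * e k t) integrable_on {0..P}" for k
    by (rule bounded_borel_integrable_on[where B=B]) (use B in \<open>auto simp: norm_mult\<close>)
  define c where "c k = integral {0..P} (\<lambda>t. u t * e k t) / of_real P" for k
  have ce: "integral {0..P} (\<lambda>t. u t * e k t) = of_real P * c k" for k using P by (simp add: c_def)
  have orth: "integral {0..P} (\<lambda>t. cnj (e k t) * e l t) = (if k = l then of_real P else 0)" for k l
  proof -
    have "cnj (e k t) * e l t = cis ((real l - real k) * \<beta> * t)" for t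
      by (simp add: e_def cis_cnj cis_mult algebra_simps)
    then have eq: "integral {0..P} (\<lambda>t. cnj (e k t) * e l t) = integral {0..P} (\<lambda>t. cis ((real l - real k) * \<beta> * t))" by simp
    show ?thesis
    proof (cases "k = l")
      case True then show ?thesis using P eq by (simp add: scaleR_conv_of_real)
    next
      case False
      have nz: "(real l - real k) * \<beta> \<noteq> 0" using False P \<beta> by auto
      have "\<beta> * P = 2 * pi \<or> \<beta> * P = - (2 * pi)" using \<beta> P by (auto simp: abs_if field_simps split: if_splits)
      then have "cis ((real l - real k) * \<beta> * P) = 1"
      proof
        assume bP: "\<beta> * P = 2 * pi"
        have "(real l - real k) * \<beta> * P = 2 * pi * (real l - real k)" unfolding mult.assoc bP by simp
        then show ?thesis by (simp only:) (rule cis_multiple_2pi, simp)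
      next
        assume bP: "\<beta> * P = - (2 * pi)"
        have "(real l - real k) * \<beta> * P = 2 * pi * (real k - real l)" unfolding mult.assoc bP by (simp add: algebra_simps)
        then show ?thesis by (simp only:) (rule cis_multiple_2pi, simp)
      qed
      then show ?thesis using integral_unique[OF integral_cis[OF _ nz, of P]] P False eq by simp
    qed
  qed
  define S where "S t = (\<Sum>k\<in>K. c k * cnj (e k t))" for t
  have Sm[measurable]: "S \<in> borel_measurable borel" unfolding S_def by measurable
  have S_le: "norm (S t) \<le> (\<Sum>k\<in>K. norm (c k))" for t
    unfolding S_def by (intro sum_norm_le) (simp add: norm_mult)
  define Q where "Q = (\<Sum>k\<in>K. (norm (c k))\<^sup>2)"
  have uS: "integral {0..P} (\<lambda>t. u t * cnj (S t)) = of_real (P * Q)"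
  proof -
    have "integral {0..P} (\<lambda>t. u t * cnj (S t)) = integral {0..P} (\<lambda>t. \<Sum>k\<in>K. cnj (c k) * (u t * e k t))"
      by (simp add: S_def sum_distrib_left mult_ac)
    also have "\<dots> = (\<Sum>k\<in>K. cnj (c k) * (of_real P * c k))"
      by (subst Henstock_Kurzweil_Integration.integral_sum) (auto intro: K integrable_on_mult_right iu simp: ce)
    also have "\<dots> = of_real (P * Q)" unfolding Q_def of_real_mult of_real_sum complex_norm_square by (simp add: sum_distrib_left mult_ac)
    finally show ?thesis .
  qed
  have SS: "integral {0..P} (\<lambda>t. S t * cnj (S t)) = of_real (P * Q)"
  proof -
    have ie: "(\<lambda>t. cnj (e k t) * e l t) integrable_on {0..P}" for k l
      by (rule bounded_borel_integrable_on[where B=1]) (auto simp: norm_mult)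
    have "integral {0..P} (\<lambda>t. S t * cnj (S t)) = integral {0..P} (\<lambda>t. \<Sum>k\<in>K. \<Sum>l\<in>K. (c k * cnj (c l)) * (cnj (e k t) * e l t))"
      by (simp add: S_def sum_product mult_ac)
    also have "\<dots> = (\<Sum>k\<in>K. \<Sum>l\<in>K. (c k * cnj (c l)) * (if k = l then of_real P else 0))"
      by (subst Henstock_Kurzweil_Integration.integral_sum, use K in \<open>auto intro!: integrable_sum integrable_on_mult_right ie\<close>)
         (subst Henstock_Kurzweil_Integration.integral_sum, auto intro!: K integrable_on_mult_right ie simp: orth)
    also have "\<dots> = (\<Sum>k\<in>K. (c k * cnj (c k)) * of_real P)"
      using K by (intro sum.cong refl) (simp add: if_distrib cong: if_cong)
    also have "\<dots> = of_real (P * Q)" unfolding Q_def of_real_mult of_real_sum complex_norm_square by (simp add: sum_distrib_left mult_ac)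
    finally show ?thesis .
  qed
  have cnjm[measurable]: "cnj \<in> borel_measurable borel"
    by (rule borel_measurable_continuous_onI) (rule continuous_on_cnj[OF continuous_on_id])
  have i2: "(\<lambda>t. f t * cnj (g t)) integrable_on {0..P}"
    if "f \<in> borel_measurable borel" "g \<in> borel_measurable borel" "\<And>t. norm (f t) \<le> B1" "\<And>t. norm (g t) \<le> B2" for f g :: "real \<Rightarrow> complex" and B1 B2
  proof (rule bounded_borel_integrable_on[where B="B1 * B2"])
    show "norm (f t * cnj (g t)) \<le> B1 * B2" for t
      unfolding norm_mult complex_mod_cnj using that(3,4) norm_ge_zero order_trans by (intro mult_mono) blast+
    show "(\<lambda>t. f t * cnj (g t)) \<in> borel_measurable borel" using that(1,2) by measurable
  qed
  define M where "M = (\<Sum>k\<in>K. norm (c k))"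
  have S_le': "norm (S t) \<le> M" for t using S_le by (simp add: M_def)
  have iuS: "(\<lambda>t. u t * cnj (S t)) integrable_on {0..P}" by (rule i2[OF u Sm B S_le'])
  have iSS: "(\<lambda>t. S t * cnj (S t)) integrable_on {0..P}" by (rule i2[OF Sm Sm S_le' S_le'])
  have iuu: "(\<lambda>t. (norm (u t))\<^sup>2) integrable_on {0..P}"
    by (rule bounded_borel_integrable_on[where B="B\<^sup>2"]) (use B in \<open>auto intro: power_mono\<close>)
  have Re_int: "((\<lambda>t. Re (h t)) has_integral Re (integral {0..P} h)) {0..P}" if "h integrable_on {0..P}" for h
    using has_integral_linear[OF integrable_integral[OF that] bounded_linear_Re] by (simp add: o_def)
  have "((\<lambda>t. (norm (u t))\<^sup>2 - 2 * Re (u t * cnj (S t)) + Re (S t * cnj (S t))) has_integral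
     (integral {0..P} (\<lambda>t. (norm (u t))\<^sup>2) - 2 * Re (of_real (P * Q)) + Re (of_real (P * Q)))) {0..P}"
    using has_integral_add[OF has_integral_diff[OF integrable_integral[OF iuu] has_integral_mult_right[OF Re_int[OF iuS], of 2]] Re_int[OF iSS]]
    unfolding uS SS .
  moreover have "(norm (u t))\<^sup>2 - 2 * Re (u t * cnj (S t)) + Re (S t * cnj (S t)) = (norm (u t - S t))\<^sup>2" for t
    unfolding cmod_power2 by (simp add: power2_eq_square algebra_simps)
  ultimately have "((\<lambda>t. (norm (u t - S t))\<^sup>2) has_integral (integral {0..P} (\<lambda>t. (norm (u t))\<^sup>2) - P * Q)) {0..P}" by simp
  then have "0 \<le> integral {0..P} (\<lambda>t. (norm (u t))\<^sup>2) - P * Q" by (rule has_integral_nonneg) auto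
  then have "P * (P * Q) \<le> P * integral {0..P} (\<lambda>t. (norm (u t))\<^sup>2)" using P by (intro mult_left_mono) auto
  moreover have "(\<Sum>k\<in>K. (norm (integral {0..P} (\<lambda>t. u t * e k t)))\<^sup>2) = P * (P * Q)"
    unfolding ce using P by (simp add: norm_mult power_mult_distrib Q_def sum_distrib_left power2_eq_square mult_ac)
  ultimately show ?thesis by (simp add: e_def)
qed

lemma norm_lborel_integral_le:
  fixes F :: "real \<Rightarrow> complex" and G :: "real \<Rightarrow> real"
  assumes "integrable lborel F" "integrable lborel G" "\<And>t. norm (F t) \<le> G t"
  shows "norm (LINT t|lborel. F t) \<le> (LINT t|lborel. G t)"
  by (rule Bochner_Integration.integral_norm_bound_integral[OF assms(1,2)]) (simp add: assms(3))

text \<open>The frequencies are at most \<open>pi / \<delta>\<close>, so averaging over windows of length \<open>\<delta>\<close> changes the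
  transform of \<open>F\<close> by at most a factor 2, while it turns \<open>F\<close> into a function that is bounded by the
  local masses of \<open>F\<close>.\<close>

lemma sum_transform_le_local_masses:
  fixes F :: "real \<Rightarrow> complex" and K :: "nat set"
  assumes K: "finite K" and \<delta>: "\<delta> > 0" and P: "(real n + 1) * \<delta> \<le> P" and \<beta>: "\<bar>\<beta>\<bar> = 2 * pi / P"
    and freq: "\<And>k. k \<in> K \<Longrightarrow> real k * \<bar>\<beta>\<bar> * \<delta> \<le> pi"
    and F[measurable]: "F \<in> borel_measurable borel" and B: "\<And>t. norm (F t) \<le> B"
    and supp: "\<And>t. t \<notin> {\<delta><..<real n * \<delta>} \<Longrightarrow> F t = 0"
  shows "(\<Sum>k\<in>K. (norm (LINT t|lborel. F t * cis (real k * \<beta> * t)))\<^sup>2)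
    \<le> 16 * (P / \<delta>) * (\<Sum>j<n. (integral {real j * \<delta>..(real j + 1) * \<delta>} (\<lambda>t. norm (F t)))\<^sup>2)"
proof -
  have "(real n + 1) * \<delta> > 0" using \<delta> by (intro mult_pos_pos) auto
  then have Pp: "P > 0" using P by linarith
  have B0: "B \<ge> 0" using B[of 0] norm_ge_zero order_trans by blast
  have [measurable]: "(\<lambda>t. cis (c * t)) \<in> borel_measurable borel" for c :: real
    by (intro borel_measurable_continuous_onI continuous_intros)
  define U where "U t = integral {t - \<delta>..t} (\<lambda>s. norm (F s))" for t
  \<comment> \<open>The integral of \<open>F\<close> over the window of length
    \<open>\<delta>\<close> ending at \<open>t\<close>, written as a convolution so that Fubini
    applies; \<open>u_eq\<close> gives the plain form.\<close>
  define u where "u t = (LINT y|lborel. indicator {- \<delta>..0} y *\<^sub>R F (y + t))" for t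
  have um[measurable]: "u \<in> borel_measurable borel" unfolding u_def by measurable
  have iF: "F integrable_on {a..b}" "(\<lambda>t. norm (F t)) integrable_on {a..b}" for a b
    by (rule bounded_borel_integrable_on[where B=B]; use B in simp)+
  have u_eq: "u t = integral {t - \<delta>..t} F" for t
    unfolding u_def using integral_window_translate[OF F B, of "- \<delta>" 0 t] by simp
  have uU: "norm (u t) \<le> U t" for t
    unfolding u_eq U_def by (intro Henstock_Kurzweil_Integration.integral_norm_bound_integral iF) auto
  have U_le: "U t \<le> B * \<delta>" for t
  proof -
    have "U t \<le> integral {t - \<delta>..t} (\<lambda>_. B)"
      unfolding U_def by (intro Henstock_Kurzweil_Integration.integral_le iF) (use B in auto)
    then show ?thesis using \<delta> by (simp add: mult.commute)
  qed
  have u_le: "norm (u t) \<le> B * \<delta>" for t using uU U_le order_trans by blast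
  have tr: "\<delta> / 2 * norm (LINT t|lborel. F t * cis (\<theta> * t)) \<le> norm (integral {0..P} (\<lambda>t. u t * cis (\<theta> * t)))"
    if \<theta>: "\<bar>\<theta>\<bar> * \<delta> \<le> pi" for \<theta>
  proof -
    define k where "k t = indicator {0..P} t *\<^sub>R cis (\<theta> * t)" for t
    have k: "integrable lborel k" unfolding k_def by (rule integrable_window[where B=1]) auto
    define FF where "FF = (LINT t|lborel. F t * cis (\<theta> * t))"
    have inner: "(LINT t|lborel. k t * F (y + t)) = cis (- (\<theta> * y)) * FF" if y: "y \<in> {- \<delta>..0}" for y
    proof -
      have "k t * F (y + t) = cis (- (\<theta> * y)) * (F (y + t) * cis (\<theta> * (y + t)))" for t
      proof (cases "y + t \<in> {\<delta><..<real n * \<delta>}")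
        case True
        \<comment> \<open>Averaging prolongs the support of \<open>F\<close> by
          \<open>\<delta>\<close>; the extra cell in the bound for \<open>P\<close> leaves room for
          this, so restricting to one period loses nothing.\<close>
        then have "t \<in> {0..P}" using y \<delta> P by (auto simp: algebra_simps)
        moreover have "cis (\<theta> * t) = cis (- (\<theta> * y)) * cis (\<theta> * (y + t))" by (simp add: cis_mult algebra_simps)
        ultimately show ?thesis by (simp add: k_def mult_ac)
      qed (simp add: supp)
      then have "(LINT t|lborel. k t * F (y + t)) = (LINT t|lborel. cis (- (\<theta> * y)) * (F (y + t) * cis (\<theta> * (y + t))))" by (simp only:)
      also have "\<dots> = cis (- (\<theta> * y)) * (LINT t|lborel. F (y + t) * cis (\<theta> * (y + t)))" by simp
      also have "(LINT t|lborel. F (y + t) * cis (\<theta> * (y + t))) = FF"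
        unfolding FF_def using lborel_integral_real_affine[of 1 "\<lambda>t. F t * cis (\<theta> * t)" y] by simp
      finally show ?thesis .
    qed
    have "integral {0..P} (\<lambda>t. u t * cis (\<theta> * t)) = (LINT t|lborel. indicator {0..P} t *\<^sub>R (u t * cis (\<theta> * t)))"
      by (rule integral_eq_lborel[where B="B * \<delta>"]) (use u_le in \<open>auto simp: norm_mult\<close>)
    also have "\<dots> = (LINT t|lborel. k t * (LINT y|lborel. indicator {- \<delta>..0} y *\<^sub>R F (y + t)))"
      by (intro Bochner_Integration.integral_cong refl) (simp add: k_def u_def)
    also have "\<dots> = (LINT y|lborel. indicator {- \<delta>..0} y *\<^sub>R (LINT t|lborel. k t * F (y + t)))"
      by (rule fubini_window[OF k F B, symmetric])
    also have "\<dots> = (LINT y|lborel. FF * (indicator {- \<delta>..0} y *\<^sub>R cis (- (\<theta> * y))))"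
      by (intro Bochner_Integration.integral_cong refl) (auto simp: indicator_def inner mult.commute)
    also have "\<dots> = FF * (LINT y|lborel. indicator {- \<delta>..0} y *\<^sub>R cis (- (\<theta> * y)))" by (rule integral_mult_right_zero)
    also have "(LINT y|lborel. indicator {- \<delta>..0} y *\<^sub>R cis (- (\<theta> * y))) = (LINT y|lborel. indicator {0..\<delta>} y *\<^sub>R cis (\<theta> * y))"
      using lborel_integral_real_affine[of "-1" "\<lambda>y. indicator {- \<delta>..0} y *\<^sub>R cis (- (\<theta> * y))" 0]
      by (simp add: indicator_def conj_commute)
    also have "\<dots> = integral {0..\<delta>} (\<lambda>y. cis (\<theta> * y))"
      by (rule integral_eq_lborel[symmetric, where B=1]) auto
    finally have "norm (integral {0..P} (\<lambda>t. u t * cis (\<theta> * t))) = norm FF * norm (integral {0..\<delta>} (\<lambda>y. cis (\<theta> * y)))"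
      by (simp add: norm_mult)
    also have "\<dots> \<ge> norm FF * (\<delta> / 2)"
      using \<delta> \<theta> by (intro mult_left_mono norm_integral_cis_ge) (auto simp: abs_mult)
    finally show ?thesis by (simp add: FF_def mult.commute)
  qed
  define A where "A j = integral {real j * \<delta>..(real j + 1) * \<delta>} (\<lambda>t. norm (F t))" for j
  have A_nonneg: "A j \<ge> 0" for j unfolding A_def by (intro Henstock_Kurzweil_Integration.integral_nonneg iF) auto
  have A0: "A 0 = 0"
  proof -
    have "A 0 = integral {real 0 * \<delta>..(real 0 + 1) * \<delta>} (\<lambda>t. 0::real)" unfolding A_def
      by (intro Henstock_Kurzweil_Integration.integral_cong) (auto simp: supp)
    then show ?thesis by simp
  qed
  have An: "A n = 0"
  proof -
    have "A n = integral {real n * \<delta>..(real n + 1) * \<delta>} (\<lambda>t. 0::real)" unfolding A_def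
      by (intro Henstock_Kurzweil_Integration.integral_cong) (auto simp: supp)
    then show ?thesis by simp
  qed
  \<comment> \<open>For \<open>j = 0\<close> the natural number \<open>j - 1\<close> is 0 again,
    which is harmless because \<open>F\<close> vanishes on the first cell.\<close>
  have UA: "U t \<le> A (j - 1) + A j" if t: "t \<in> {real j * \<delta>..(real j + 1) * \<delta>}" for t j
  proof (cases j)
    case 0
    then have "U t = integral {t - \<delta>..t} (\<lambda>t. 0::real)" using t unfolding U_def
      by (intro Henstock_Kurzweil_Integration.integral_cong) (auto simp: supp)
    then show ?thesis using A_nonneg by simp
  next
    case (Suc i)
    have "U t \<le> integral {real i * \<delta>..(real j + 1) * \<delta>} (\<lambda>t. norm (F t))"
      unfolding U_def using t \<delta> Suc by (intro integral_subset_le iF) (auto simp: algebra_simps)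
    also have "\<dots> = integral {real i * \<delta>..real j * \<delta>} (\<lambda>t. norm (F t)) + A j"
      unfolding A_def using \<delta> Suc by (intro Henstock_Kurzweil_Integration.integral_combine[symmetric] iF) (auto simp: algebra_simps)
    also have "integral {real i * \<delta>..real j * \<delta>} (\<lambda>t. norm (F t)) = A (j - 1)" by (simp add: A_def Suc add.commute)
    finally show ?thesis .
  qed
  have iu2: "(\<lambda>t. (norm (u t))\<^sup>2) integrable_on {a..b}" for a b
    by (rule bounded_borel_integrable_on[where B="(B * \<delta>)\<^sup>2"]) (use u_le in \<open>auto intro: power_mono\<close>)
  have blk: "integral {real j * \<delta>..(real j + 1) * \<delta>} (\<lambda>t. (norm (u t))\<^sup>2) \<le> 2 * \<delta> * ((A (j - 1))\<^sup>2 + (A j)\<^sup>2)" for j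
  proof -
    have "integral {real j * \<delta>..(real j + 1) * \<delta>} (\<lambda>t. (norm (u t))\<^sup>2)
      \<le> integral {real j * \<delta>..(real j + 1) * \<delta>} (\<lambda>t. 2 * ((A (j - 1))\<^sup>2 + (A j)\<^sup>2))"
    proof (intro Henstock_Kurzweil_Integration.integral_le iu2)
      fix t assume "t \<in> {real j * \<delta>..(real j + 1) * \<delta>}"
      then have "(norm (u t))\<^sup>2 \<le> (A (j - 1) + A j)\<^sup>2" using uU[of t] UA[of t j] by (intro power_mono) auto
      also have "\<dots> \<le> 2 * ((A (j - 1))\<^sup>2 + (A j)\<^sup>2)"
        using zero_le_power2[of "A (j - 1) - A j"] by (simp add: power2_eq_square algebra_simps)
      finally show "(norm (u t))\<^sup>2 \<le> 2 * ((A (j - 1))\<^sup>2 + (A j)\<^sup>2)" .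
    qed auto
    then show ?thesis using \<delta> by (simp add: algebra_simps)
  qed
  have sumblk: "integral {0..real N * \<delta>} (\<lambda>t. (norm (u t))\<^sup>2) = (\<Sum>j<N. integral {real j * \<delta>..(real j + 1) * \<delta>} (\<lambda>t. (norm (u t))\<^sup>2))" for N
  proof (induction N)
    case (Suc N)
    have "integral {0..real N * \<delta>} (\<lambda>t. (norm (u t))\<^sup>2) + integral {real N * \<delta>..(real N + 1) * \<delta>} (\<lambda>t. (norm (u t))\<^sup>2)
      = integral {0..(real N + 1) * \<delta>} (\<lambda>t. (norm (u t))\<^sup>2)"
      using \<delta> by (intro Henstock_Kurzweil_Integration.integral_combine iu2) (auto simp: algebra_simps)
    then show ?case using Suc by (simp add: add.commute)
  qed simp
  have "integral {0..P} (\<lambda>t. (norm (u t))\<^sup>2) = integral {0..real (Suc n) * \<delta>} (\<lambda>t. (norm (u t))\<^sup>2) + integral {real (Suc n) * \<delta>..P} (\<lambda>t. (norm (u t))\<^sup>2)"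
    using \<delta> P by (intro Henstock_Kurzweil_Integration.integral_combine[symmetric] iu2) (auto simp: add.commute)
  also have "integral {real (Suc n) * \<delta>..P} (\<lambda>t. (norm (u t))\<^sup>2) = integral {real (Suc n) * \<delta>..P} (\<lambda>t. 0)"
  proof (intro Henstock_Kurzweil_Integration.integral_cong)
    fix t assume t: "t \<in> {real (Suc n) * \<delta>..P}"
    have "u t = integral {t - \<delta>..t} (\<lambda>_. 0)" unfolding u_eq using t
      by (intro Henstock_Kurzweil_Integration.integral_cong) (auto simp: supp algebra_simps)
    then show "(norm (u t))\<^sup>2 = 0" by simp
  qed
  also have "integral {0..real (Suc n) * \<delta>} (\<lambda>t. (norm (u t))\<^sup>2) + integral {real (Suc n) * \<delta>..P} (\<lambda>t. 0)
      \<le> (\<Sum>j<Suc n. 2 * \<delta> * ((A (j - 1))\<^sup>2 + (A j)\<^sup>2))" 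
    unfolding sumblk by (simp only: Henstock_Kurzweil_Integration.integral_0 add_0_right) (intro sum_mono blk)
  also have "\<dots> = 2 * \<delta> * ((\<Sum>j<Suc n. (A (j - 1))\<^sup>2) + (\<Sum>j<Suc n. (A j)\<^sup>2))" by (simp only: sum_distrib_left[symmetric] sum.distrib)
  also have "(\<Sum>j<Suc n. (A (j - 1))\<^sup>2) = (\<Sum>j<n. (A j)\<^sup>2)" by (subst sum.lessThan_Suc_shift) (simp add: A0)
  also have "(\<Sum>j<Suc n. (A j)\<^sup>2) = (\<Sum>j<n. (A j)\<^sup>2)" by (simp add: An)
  finally have u2: "integral {0..P} (\<lambda>t. (norm (u t))\<^sup>2) \<le> 4 * \<delta> * (\<Sum>j<n. (A j)\<^sup>2)" by simp
  have "(\<delta> / 2)\<^sup>2 * (\<Sum>k\<in>K. (norm (LINT t|lborel. F t * cis (real k * \<beta> * t)))\<^sup>2)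
     = (\<Sum>k\<in>K. (\<delta> / 2 * norm (LINT t|lborel. F t * cis (real k * \<beta> * t)))\<^sup>2)"
    by (simp only: power_mult_distrib sum_distrib_left)
  also have "\<dots> \<le> (\<Sum>k\<in>K. (norm (integral {0..P} (\<lambda>t. u t * cis (real k * \<beta> * t))))\<^sup>2)"
    using freq \<delta> by (intro sum_mono power_mono tr) (auto simp: abs_mult)
  also have "\<dots> \<le> P * integral {0..P} (\<lambda>t. (norm (u t))\<^sup>2)" by (rule bessel_inequality[OF K Pp \<beta> um u_le])
  also have "\<dots> \<le> P * (4 * \<delta> * (\<Sum>j<n. (A j)\<^sup>2))" using u2 Pp by (intro mult_left_mono) auto
  finally have "\<delta>\<^sup>2 * (\<Sum>k\<in>K. (norm (LINT t|lborel. F t * cis (real k * \<beta> * t)))\<^sup>2) \<le> \<delta>\<^sup>2 * (16 * (P / \<delta>) * (\<Sum>j<n. (A j)\<^sup>2))"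
    using \<delta> by (simp add: power2_eq_square mult_ac)
  from mult_left_le_imp_le[OF this] show ?thesis unfolding A_def using \<delta> by simp
qed

subsection \<open>Moduli of continuity and tail estimates\<close>

text \<open>A dyadic substitute for integration by parts. On
  \<open>{2 ^ n * T0<..2 ^ Suc n * T0}\<close> the factor \<open>1 / t\<^sup>2\<close> is at most
  its value at the left end, so the bound \<open>M\<close> for the means contributes
  \<open>2 * M / T0 / 2 ^ n\<close>, and the geometric series adds up to
  \<open>4 * M / T0\<close>.\<close>

lemma integral_over_square_le:
  fixes U :: "real \<Rightarrow> real"
  assumes [measurable]: "U \<in> borel_measurable borel" and U0: "\<And>t. 0 \<le> U t" and B: "\<And>t. U t \<le> B" and T0: "T0 > 0"
    and M: "\<And>T. T > 0 \<Longrightarrow> integral {0..T} U \<le> M * T"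
  shows "integrable lborel (\<lambda>t. indicator {T0<..} t * (U t / t\<^sup>2))"
    and "(LINT t|lborel. indicator {T0<..} t * (U t / t\<^sup>2)) \<le> 4 * M / T0"
proof -
  have B0: "B \<ge> 0" using U0[of 0] B[of 0] by simp
  let ?f = "\<lambda>t. indicator {T0<..} t * (U t / t\<^sup>2)"
  have f0: "?f t \<ge> 0" for t using U0 by (simp add: indicator_def)
  show fi: "integrable lborel ?f"
  proof (rule Bochner_Integration.integrable_bound[OF integrable_inverse_square[of "B * (1 / T0\<^sup>2 + 1)"]])
    show "AE t in lborel. norm (?f t) \<le> norm (B * (1 / T0\<^sup>2 + 1) / (1 + t\<^sup>2))"
    proof (intro AE_I2)
      fix t
      have "?f t \<le> B * (1 / T0\<^sup>2 + 1) / (1 + t\<^sup>2)"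
      proof (cases "t > T0")
        case True
        have t2: "T0\<^sup>2 \<le> t\<^sup>2" using True T0 by (intro power_mono) auto
        have tp: "t\<^sup>2 > 0" "1 + t\<^sup>2 > 0" using True T0 by (auto simp: add_pos_nonneg)
        have "(1 + t\<^sup>2) * 1 \<le> (1 / T0\<^sup>2 + 1) * t\<^sup>2" using t2 T0 by (simp add: field_simps)
        then have "U t * (1 + t\<^sup>2) \<le> B * ((1 / T0\<^sup>2 + 1) * t\<^sup>2)" using B U0 B0 by (intro mult_mono) auto
        then show ?thesis using True tp by (simp add: divide_le_eq le_divide_eq mult_ac)
      qed (use B0 in \<open>auto intro!: divide_nonneg_pos mult_nonneg_nonneg add_pos_nonneg\<close>)
      then show "norm (?f t) \<le> norm (B * (1 / T0\<^sup>2 + 1) / (1 + t\<^sup>2))"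
        unfolding real_norm_def abs_of_nonneg[OF f0] by (rule order_trans[OF _ abs_ge_self])
    qed
  qed measurable
  have M0: "M \<ge> 0"
  proof -
    have "0 \<le> integral {0..1} U" by (intro Henstock_Kurzweil_Integration.integral_nonneg bounded_borel_integrable_on[where B=B]) (use U0 B in auto)
    then show ?thesis using M[of 1] by simp
  qed
  have fin: "integrable lborel (\<lambda>t. indicator S t * ?f t)" if "S \<in> sets borel" for S
    using integrable_mult_indicator[OF _ fi, of S] that by simp
  have part: "(LINT t|lborel. indicator {T0<..2 ^ n * T0} t * ?f t) \<le> (4 * M / T0) * (1 - 1 / 2 ^ n)" for n
  proof (induction n)
    case 0 show ?case by simp
  next
    case (Suc n)
    let ?I = "{2 ^ n * T0<..2 ^ Suc n * T0}"
    have p: "2 ^ n * T0 > 0" "T0 \<le> 2 ^ n * T0" using T0 by auto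
    have split: "(LINT t|lborel. indicator {T0<..2 ^ Suc n * T0} t * ?f t) = (LINT t|lborel. indicator {T0<..2 ^ n * T0} t * ?f t + indicator ?I t * ?f t)"
      using p by (intro Bochner_Integration.integral_cong refl) (auto simp: indicator_def)
    have add: "(LINT t|lborel. indicator {T0<..2 ^ n * T0} t * ?f t + indicator ?I t * ?f t)
      = (LINT t|lborel. indicator {T0<..2 ^ n * T0} t * ?f t) + (LINT t|lborel. indicator ?I t * ?f t)"
      by (intro Bochner_Integration.integral_add fin) auto
    have "(LINT t|lborel. indicator ?I t * ?f t) \<le> (LINT t|lborel. (1 / (2 ^ n * T0)\<^sup>2) * (indicator {0..2 ^ Suc n * T0} t *\<^sub>R U t))"
    proof (rule integral_mono[OF fin])
      show "integrable lborel (\<lambda>t. (1 / (2 ^ n * T0)\<^sup>2) * (indicator {0..2 ^ Suc n * T0} t *\<^sub>R U t))"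
        by (intro integrable_mult_right integrable_window[where B=B]) (use U0 B in auto)
      fix t
      show "indicator ?I t * ?f t \<le> (1 / (2 ^ n * T0)\<^sup>2) * (indicator {0..2 ^ Suc n * T0} t *\<^sub>R U t)"
      proof (cases "t \<in> ?I")
        case True
        then have "(2 ^ n * T0)\<^sup>2 \<le> t\<^sup>2" using p by (intro power_mono) auto
        then have "U t / t\<^sup>2 \<le> U t / (2 ^ n * T0)\<^sup>2" using U0 p True by (intro divide_left_mono mult_pos_pos) auto
        then show ?thesis using True p by (auto simp: indicator_def)
      qed (use U0 in \<open>auto simp: indicator_def\<close>)
    qed auto
    also have "\<dots> = (1 / (2 ^ n * T0)\<^sup>2) * integral {0..2 ^ Suc n * T0} U"
      by (subst integral_eq_lborel[where B=B]) (use U0 B in auto)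
    also have "\<dots> \<le> (1 / (2 ^ n * T0)\<^sup>2) * (M * (2 ^ Suc n * T0))" using T0 by (intro mult_left_mono M) auto
    also have "\<dots> = 2 * M / T0 / 2 ^ n" using T0 by (simp add: power2_eq_square field_simps)
    finally have "(LINT t|lborel. indicator {T0<..2 ^ Suc n * T0} t * ?f t) \<le> (4 * M / T0) * (1 - 1 / 2 ^ n) + 2 * M / T0 / 2 ^ n"
      unfolding split add by (intro add_mono Suc)
    also have "\<dots> = (4 * M / T0) * (1 - 1 / 2 ^ Suc n)" using T0 by (simp add: field_simps)
    finally show ?case .
  qed
  have "(\<lambda>n. LINT t|lborel. indicator {T0<..2 ^ n * T0} t * ?f t) \<longlonglongrightarrow> (LINT t|lborel. ?f t)"
  proof (rule integral_dominated_convergence[where w="?f"])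
    show "AE t in lborel. (\<lambda>n. indicator {T0<..2 ^ n * T0} t * ?f t) \<longlonglongrightarrow> ?f t"
    proof (intro AE_I2)
      fix t
      obtain n where n: "t / T0 < 2 ^ n" using real_arch_pow[of 2 "t / T0"] by auto
      have "eventually (\<lambda>k. indicator {T0<..2 ^ k * T0} t * ?f t = ?f t) sequentially"
        using eventually_ge_at_top[of n]
      proof eventually_elim
        case (elim k)
        have "(2::real) ^ n \<le> 2 ^ k" using elim by simp
        then have "t / T0 \<le> 2 ^ k" using n by linarith
        then have "t \<le> 2 ^ k * T0" using T0 by (simp add: divide_le_eq)
        then show ?case by (auto simp: indicator_def)
      qed
      then show "(\<lambda>n. indicator {T0<..2 ^ n * T0} t * ?f t) \<longlonglongrightarrow> ?f t" by (rule tendsto_eventually)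
    qed
    show "AE t in lborel. norm (indicator {T0<..2 ^ n * T0} t * ?f t) \<le> ?f t" for n
      using U0 by (intro AE_I2) (auto simp: indicator_def)
  qed (use fi in measurable)
  moreover have "(LINT t|lborel. indicator {T0<..2 ^ n * T0} t * ?f t) \<le> 4 * M / T0" for n
  proof -
    have "(4 * M / T0) * (1 - 1 / 2 ^ n) \<le> (4 * M / T0) * 1" using M0 T0 by (intro mult_left_mono) auto
    then show ?thesis using part[of n] by simp
  qed
  ultimately show "(LINT t|lborel. ?f t) \<le> 4 * M / T0" by (intro LIMSEQ_le_const2) auto
qed

lemma modulus_mult_le:
  assumes "modulus_type w" "x \<ge> 0" shows "w (real n * x) \<le> real n * w x"
proof (induction n)
  case 0 then show ?case using assms by (simp add: modulus_type_def)
next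
  case (Suc n)
  have "w (real n * x + x) \<le> w (real n * x) + w x" using assms by (simp add: modulus_type_def)
  then show ?case using Suc by (simp add: algebra_simps)
qed

lemma modulus_scale_le:
  assumes "modulus_type w" "x \<ge> 0" "c \<ge> 0" "0 \<le> y" "y \<le> c * x" shows "w y \<le> (c + 1) * w x"
proof -
  have w: "mono_on {0..} w" "w x \<ge> 0" using assms by (auto simp: modulus_type_def)
  define n where "n = nat \<lceil>c\<rceil>"
  have n: "c \<le> real n" "real n \<le> c + 1" using assms(3) unfolding n_def by linarith+
  have "y \<le> real n * x" using assms(5) mult_right_mono[OF n(1) assms(2)] by simp
  then have "w y \<le> w (real n * x)" using assms by (intro mono_onD[OF w(1)]) auto
  also have "\<dots> \<le> real n * w x" by (rule modulus_mult_le[OF assms(1,2)])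
  also have "\<dots> \<le> (c + 1) * w x" using n w by (intro mult_right_mono) auto
  finally show ?thesis .
qed

text \<open>Shifting the sine costs \<open>b * \<gamma>\<close>, shifting the square costs
  \<open>2 * \<gamma> / T0\<close>, both relative to \<open>1 / t\<^sup>2\<close>. The error thus
  remains integrable over the tail and is linear in \<open>\<gamma>\<close>.\<close>

lemma sin_over_square_diff_le:
  fixes b t \<gamma> :: real
  assumes "b \<ge> 0" "T0 > 0" "t \<ge> T0" "\<gamma> \<ge> 0"
  shows "\<bar>sin (b * t) / t\<^sup>2 - sin (b * (t + \<gamma>)) / (t + \<gamma>)\<^sup>2\<bar> \<le> \<gamma> * (b + 2 / T0) / t\<^sup>2"
proof -
  have t: "t > 0" "t + \<gamma> > 0" using assms by auto
  have sd: "\<bar>sin x - sin y\<bar> \<le> \<bar>x - y\<bar>" for x y :: real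
  proof -
    have "sin x - sin y = 2 * sin ((x - y) / 2) * cos ((x + y) / 2)" by (rule sin_diff_sin)
    then have "\<bar>sin x - sin y\<bar> = 2 * (\<bar>sin ((x - y) / 2)\<bar> * \<bar>cos ((x + y) / 2)\<bar>)" by (simp add: abs_mult)
    also have "\<dots> \<le> 2 * (\<bar>(x - y) / 2\<bar> * 1)" by (intro mult_left_mono mult_mono abs_sin_x_le_abs_x) auto
    finally show ?thesis by simp
  qed
  have e: "sin (b * t) / t\<^sup>2 - sin (b * (t + \<gamma>)) / (t + \<gamma>)\<^sup>2
     = (sin (b * t) - sin (b * (t + \<gamma>))) / t\<^sup>2 + sin (b * (t + \<gamma>)) * (1 / t\<^sup>2 - 1 / (t + \<gamma>)\<^sup>2)"
    by (simp add: algebra_simps diff_divide_distrib)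
  have A: "\<bar>(sin (b * t) - sin (b * (t + \<gamma>))) / t\<^sup>2\<bar> \<le> (b * \<gamma>) / t\<^sup>2"
  proof -
    have "\<bar>sin (b * t) - sin (b * (t + \<gamma>))\<bar> \<le> b * \<gamma>" using sd[of "b * t" "b * (t + \<gamma>)"] assms by (simp add: algebra_simps abs_mult)
    then show ?thesis by (simp add: abs_divide divide_right_mono)
  qed
  have D0: "1 / t\<^sup>2 - 1 / (t + \<gamma>)\<^sup>2 \<ge> 0" using t assms by (simp add: frac_le power_mono)
  have "1 / t\<^sup>2 - 1 / (t + \<gamma>)\<^sup>2 = (\<gamma> * (2 * t + \<gamma>) / (t + \<gamma>)\<^sup>2) / t\<^sup>2"
  proof -
    have "(t + \<gamma>)\<^sup>2 - t\<^sup>2 = \<gamma> * (2 * t + \<gamma>)" by (simp add: power2_eq_square algebra_simps)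
    moreover have "1 / t\<^sup>2 - 1 / (t + \<gamma>)\<^sup>2 = (((t + \<gamma>)\<^sup>2 - t\<^sup>2) / (t + \<gamma>)\<^sup>2) / t\<^sup>2"
      using t by (simp add: diff_divide_distrib)
    ultimately show ?thesis by simp
  qed
  also have "\<dots> \<le> (\<gamma> * (2 / T0)) / t\<^sup>2"
  proof (intro divide_right_mono)
    have "(2 * t + \<gamma>) * T0 \<le> (2 * (t + \<gamma>)) * (t + \<gamma>)" using assms t by (intro mult_mono) auto
    then have "(2 * t + \<gamma>) / (t + \<gamma>)\<^sup>2 \<le> 2 / T0" using t assms by (simp add: divide_le_eq le_divide_eq power2_eq_square mult_ac)
    from mult_left_mono[OF this assms(4)] show "\<gamma> * (2 * t + \<gamma>) / (t + \<gamma>)\<^sup>2 \<le> \<gamma> * (2 / T0)" by simp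
  qed simp
  finally have D: "1 / t\<^sup>2 - 1 / (t + \<gamma>)\<^sup>2 \<le> (\<gamma> * (2 / T0)) / t\<^sup>2" .
  have "\<bar>sin (b * (t + \<gamma>)) * (1 / t\<^sup>2 - 1 / (t + \<gamma>)\<^sup>2)\<bar> \<le> 1 * \<bar>1 / t\<^sup>2 - 1 / (t + \<gamma>)\<^sup>2\<bar>"
    unfolding abs_mult by (intro mult_right_mono) auto
  also have "\<dots> = 1 / t\<^sup>2 - 1 / (t + \<gamma>)\<^sup>2" unfolding abs_of_nonneg[OF D0] by simp
  also note D
  finally have E: "\<bar>sin (b * (t + \<gamma>)) * (1 / t\<^sup>2 - 1 / (t + \<gamma>)\<^sup>2)\<bar> \<le> (\<gamma> * (2 / T0)) / t\<^sup>2" .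
  have "\<bar>sin (b * t) / t\<^sup>2 - sin (b * (t + \<gamma>)) / (t + \<gamma>)\<^sup>2\<bar> \<le> (b * \<gamma>) / t\<^sup>2 + (\<gamma> * (2 / T0)) / t\<^sup>2"
    unfolding e by (rule order_trans[OF abs_triangle_ineq], rule add_mono[OF A E])
  also have "\<dots> = \<gamma> * (b + 2 / T0) / t\<^sup>2" by (simp add: distrib_left add_divide_distrib mult_ac)
  finally show ?thesis .
qed

text \<open>The difference of cosines factors, and all windows have the same length
  \<open>\<alpha> / 2\<close>, so \<open>k\<close> occurs in the last sine only. This makes the
  integrals for different \<open>k\<close> sine coefficients of one function, and it exhibits the
  oscillation whose half-period is used in \<open>V_tail\<close>.\<close>

lemma vp_kernel_eq:
  assumes "\<alpha> > 0"
  shows "vp_kernel (\<alpha> * real k / 2) (\<alpha> * (real k + 1) / 2) t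
    = 4 / (pi * \<alpha>) * (sin (\<alpha> / 4 * t) / t\<^sup>2) * sin ((2 * real k + 1) * \<alpha> / 4 * t)"
proof -
  have "cos (\<alpha> * real k / 2 * t) - cos (\<alpha> * (real k + 1) / 2 * t)
    = 2 * sin ((\<alpha> * real k / 2 * t + \<alpha> * (real k + 1) / 2 * t) / 2) * sin ((\<alpha> * (real k + 1) / 2 * t - \<alpha> * real k / 2 * t) / 2)"
    by (rule cos_diff_cos)
  also have "(\<alpha> * real k / 2 * t + \<alpha> * (real k + 1) / 2 * t) / 2 = (2 * real k + 1) * \<alpha> / 4 * t" by (simp add: field_simps)
  also have "(\<alpha> * (real k + 1) / 2 * t - \<alpha> * real k / 2 * t) / 2 = \<alpha> / 4 * t" by (simp add: field_simps)
  finally have c: "cos (\<alpha> * real k / 2 * t) - cos (\<alpha> * (real k + 1) / 2 * t)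
    = 2 * sin ((2 * real k + 1) * \<alpha> / 4 * t) * sin (\<alpha> / 4 * t)" .
  have "vp_kernel (\<alpha> * real k / 2) (\<alpha> * (real k + 1) / 2) t
    = (cos (\<alpha> * real k / 2 * t) - cos (\<alpha> * (real k + 1) / 2 * t)) / (pi * t\<^sup>2) / (\<alpha> * (real k + 1) / 2 - \<alpha> * real k / 2)"
    unfolding vp_kernel_def fejer_def by (simp add: diff_divide_distrib[symmetric])
  also have "\<alpha> * (real k + 1) / 2 - \<alpha> * real k / 2 = \<alpha> / 2" by (simp add: field_simps)
  finally show ?thesis unfolding c by (simp add: mult_ac)
qed

subsection \<open>Quadratic means of the deviations over dyadic blocks\<close>

text \<open>\<open>p\<close> stands for a Borel version of \<open>phi f x\<close>. With
  \<open>w pi > 0\<close>, subadditivity gives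
  \<open>w (pi / real m) \<ge> w pi / real m > 0\<close>, so errors of order \<open>1 / m\<close>
  are admissible.\<close>

locale local_modulus =
  fixes p :: "real \<Rightarrow> complex" and \<alpha> C B :: real and w :: "real \<Rightarrow> real"
  assumes \<alpha>: "\<alpha> > 0" and w: "modulus_type w" and w_pi: "w pi > 0"
    and p_meas[measurable]: "p \<in> borel_measurable borel" and p_le: "\<And>t. norm (p t) \<le> B"
    and smooth: "\<And>\<gamma> \<delta>. \<gamma> > 0 \<Longrightarrow> \<delta> > 0 \<Longrightarrow> (1 / \<delta>) * integral {0..\<delta>} (\<lambda>t. norm (p t - p (t + \<gamma>))) \<le> C * w \<gamma>"
    and G_le: "\<And>\<delta>. \<delta> > 0 \<Longrightarrow> sqrt (\<Sum>k = 0..nat \<lfloor>pi / (\<alpha> * \<delta>)\<rfloor>.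
       ((1 / ((real k + 1) * \<delta>)) * integral {real k * \<delta>..(real k + 1) * \<delta>} (\<lambda>t. norm (p t)))\<^sup>2) \<le> C * w \<delta>"
begin

definition "vp_window k = vp_kernel (\<alpha> * real k / 2) (\<alpha> * (real k + 1) / 2)"

definition "V k = (LINT t|lborel. indicator {0..} t *\<^sub>R (of_real (vp_window k t) * p t))"

lemma B_nonneg: "B \<ge> 0" using p_le[of 0] norm_ge_zero order_trans by blast

lemma vp_window_integrable: "integrable lborel (\<lambda>t. of_real (vp_window k t) * p t)"
  using integrable_kernel_mult[OF _ p_meas p_le, of "\<lambda>t. of_real (vp_window k t)" 0] vp_kernel_integrable
  by (simp add: vp_window_def)

lemma vp_window_integrable': "S \<in> sets borel \<Longrightarrow> integrable lborel (\<lambda>t. indicator S t *\<^sub>R (of_real (vp_window k t) * p t))"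
  by (rule integrable_mult_indicator[OF _ vp_window_integrable]) simp

lemma vp_window_eq: "vp_window k t = 4 / (pi * \<alpha>) * (sin (\<alpha> / 4 * t) / t\<^sup>2) * sin ((2 * real k + 1) * \<alpha> / 4 * t)"
  unfolding vp_window_def by (rule vp_kernel_eq[OF \<alpha>])

lemma norm_p_integrable: "(\<lambda>t. norm (p t)) integrable_on {a..b}"
  by (rule bounded_borel_integrable_on[where B=B]) (use p_le in auto)

text \<open>Read off from the proof of \<open>V_tail\<close>. In the bracket the first summand comes
  from the smoothness of \<open>p\<close>, the second from the varying amplitude and the boundary
  strip; \<open>\<alpha> / pi\<close> is the reciprocal of \<open>T0\<close>, and
  \<open>4 * pi / \<alpha> / w pi\<close> converts \<open>\<gamma>\<close> into
  \<open>w (pi / real m)\<close>. The prefactor is half of that in \<open>vp_window_eq\<close>, as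
  the shift argument estimates twice the integral.\<close>

definition "tail_const = 2 / (pi * \<alpha>) * (4 * C * (4 / \<alpha> + 1) * (\<alpha> / pi)
  + (B * (\<alpha> / 4 + 2 * (\<alpha> / pi)) * (4 * (\<alpha> / pi)) + B * (\<alpha> / pi)\<^sup>2) * (4 * pi / \<alpha> / w pi))"

context
  fixes m :: nat and \<delta> :: real
  assumes m: "m \<ge> 1" and \<delta>_def: "\<delta> = pi / (real m * \<alpha>)"
begin

lemma \<delta>: "\<delta> > 0" using m \<alpha> by (simp add: \<delta>_def)

lemma w_m: "w pi \<le> real m * w (pi / real m)"
  using modulus_mult_le[OF w, of "pi / real m" m] m by simp

lemma w_\<delta>: "w \<delta> \<le> (1 / \<alpha> + 1) * w (pi / real m)"
  using \<delta> \<alpha> m by (intro modulus_scale_le[OF w]) (auto simp: \<delta>_def field_simps)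

definition "gterm j = (1 / ((real j + 1) * \<delta>)) * integral {real j * \<delta>..(real j + 1) * \<delta>} (\<lambda>t. norm (p t))"

lemma gterm_nonneg: "gterm j \<ge> 0"
  unfolding gterm_def using \<delta> by (intro mult_nonneg_nonneg Henstock_Kurzweil_Integration.integral_nonneg norm_p_integrable) auto

lemma gterm_sum: "(\<Sum>j<m + 1. (gterm j)\<^sup>2) \<le> (C * w \<delta>)\<^sup>2" and C_w_\<delta>: "C * w \<delta> \<ge> 0"
proof -
  \<comment> \<open>Hence the sum in \<open>G21\<close> has exactly the terms with index 0 to
    \<open>m\<close>, and its cells cover \<open>{0..real (m + 1) * \<delta>}\<close>.\<close>
  have "pi / (\<alpha> * \<delta>) = real m" using \<alpha> m by (simp add: \<delta>_def)
  then have e: "{0..nat \<lfloor>pi / (\<alpha> * \<delta>)\<rfloor>} = {..<m + 1}" by auto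
  have s: "sqrt (\<Sum>j<m + 1. (gterm j)\<^sup>2) \<le> C * w \<delta>" using G_le[OF \<delta>] unfolding e gterm_def .
  then show "C * w \<delta> \<ge> 0" by (meson order_trans real_sqrt_ge_zero sum_nonneg zero_le_power2)
  show "(\<Sum>j<m + 1. (gterm j)\<^sup>2) \<le> (C * w \<delta>)\<^sup>2"
    using sqrt_le_D[OF s] .
qed

lemma gterm_0_le: "gterm 0 \<le> C * w \<delta>"
proof -
  have "(gterm 0)\<^sup>2 \<le> (\<Sum>j<m + 1. (gterm j)\<^sup>2)" by (rule member_le_sum) auto
  then have "(gterm 0)\<^sup>2 \<le> (C * w \<delta>)\<^sup>2" using gterm_sum by linarith
  then show ?thesis using C_w_\<delta> by (rule power2_le_imp_le)
qed

lemma sin_quotient_le: "\<bar>sin (\<alpha> / 4 * t)\<bar> \<le> \<alpha> / 4 * \<bar>t\<bar>"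
  using abs_sin_x_le_abs_x[of "\<alpha> / 4 * t"] \<alpha> by (simp add: abs_mult)

text \<open>For these \<open>k\<close> the number \<open>2 * real k + 1\<close> is at most
  \<open>4 * real m\<close>, so bounding both sines by their arguments keeps the kernel below
  \<open>1 / \<delta>\<close> in modulus. The head is then at most the first term of
  \<open>G21\<close>.\<close>

lemma V_head:
  assumes k: "k \<le> 2 * m - 1"
  shows "norm (LINT t|lborel. indicator {0..\<delta>} t *\<^sub>R (of_real (vp_window k t) * p t)) \<le> C * w \<delta>"
proof -
  have le: "\<bar>vp_window k t\<bar> \<le> 1 / \<delta>" for t
  proof (cases "t = 0")
    case False
    have t2: "t\<^sup>2 > 0" using False by simp
    have "\<bar>sin ((2 * real k + 1) * \<alpha> / 4 * t)\<bar> \<le> \<bar>(2 * real k + 1) * \<alpha> / 4 * t\<bar>" by (rule abs_sin_x_le_abs_x)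
    also have "\<dots> = (2 * real k + 1) * \<alpha> / 4 * \<bar>t\<bar>" using \<alpha> by (simp add: abs_mult)
    also have "\<dots> \<le> (4 * real m) * \<alpha> / 4 * \<bar>t\<bar>" using k m \<alpha> by (intro mult_right_mono divide_right_mono) auto
    finally have "\<bar>sin ((2 * real k + 1) * \<alpha> / 4 * t)\<bar> \<le> real m * \<alpha> * \<bar>t\<bar>" by simp
    then have "\<bar>sin (\<alpha> / 4 * t)\<bar> * \<bar>sin ((2 * real k + 1) * \<alpha> / 4 * t)\<bar> \<le> (\<alpha> / 4 * \<bar>t\<bar>) * (real m * \<alpha> * \<bar>t\<bar>)"
      using \<alpha> by (intro mult_mono sin_quotient_le) auto
    also have "\<dots> = (\<alpha> / 4 * (real m * \<alpha>)) * t\<^sup>2" by (simp add: power2_eq_square mult_ac)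
    finally have "\<bar>sin (\<alpha> / 4 * t)\<bar> * \<bar>sin ((2 * real k + 1) * \<alpha> / 4 * t)\<bar> / t\<^sup>2 \<le> \<alpha> / 4 * (real m * \<alpha>)"
      using t2 by (simp add: pos_divide_le_eq)
    then have "4 / (pi * \<alpha>) * (\<bar>sin (\<alpha> / 4 * t)\<bar> * \<bar>sin ((2 * real k + 1) * \<alpha> / 4 * t)\<bar> / t\<^sup>2) \<le> 4 / (pi * \<alpha>) * (\<alpha> / 4 * (real m * \<alpha>))"
      using \<alpha> by (intro mult_left_mono) auto
    also have "\<dots> = 1 / \<delta>" using \<alpha> m by (simp add: \<delta>_def field_simps)
    finally show ?thesis using \<alpha> by (simp add: vp_window_eq abs_mult abs_divide)
  qed (use \<delta> in \<open>simp add: vp_window_eq\<close>)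
  have "norm (LINT t|lborel. indicator {0..\<delta>} t *\<^sub>R (of_real (vp_window k t) * p t))
    \<le> (LINT t|lborel. (1 / \<delta>) * (indicator {0..\<delta>} t *\<^sub>R norm (p t)))"
  proof (rule norm_lborel_integral_le)
    show "integrable lborel (\<lambda>t. indicator {0..\<delta>} t *\<^sub>R (of_real (vp_window k t) * p t))" by (rule vp_window_integrable') simp
    show "integrable lborel (\<lambda>t. (1 / \<delta>) * (indicator {0..\<delta>} t *\<^sub>R norm (p t)))"
      by (intro integrable_mult_right integrable_window[where B=B]) (use p_le in auto)
    show "norm (indicator {0..\<delta>} t *\<^sub>R (of_real (vp_window k t) * p t)) \<le> (1 / \<delta>) * (indicator {0..\<delta>} t *\<^sub>R norm (p t))" for t
      using mult_right_mono[OF le[of t], of "norm (p t)"] by (simp add: indicator_def norm_mult)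
  qed
  also have "\<dots> = (1 / \<delta>) * integral {0..\<delta>} (\<lambda>t. norm (p t))"
    by (subst integral_eq_lborel[where B=B]) (use p_le in auto)
  also have "\<dots> = gterm 0" by (simp add: gterm_def)
  finally show ?thesis using gterm_0_le by linarith
qed

definition "T1 = real (m + 1) * \<delta>"

lemma T1_eq: "T1 = pi / \<alpha> + \<delta>"
proof -
  have "real m * \<delta> = pi / \<alpha>" using m \<alpha> by (simp add: \<delta>_def)
  then show ?thesis by (simp add: T1_def distrib_right)
qed

text \<open>The sine containing \<open>k\<close> is split into two exponentials. Amplitude and
  offset \<open>\<alpha> / 4\<close> go into \<open>F \<sigma>\<close>, which does not depend on
  \<open>k\<close>; the remaining frequencies are multiples of \<open>\<alpha> / 2\<close>. The
  amplitude is of order \<open>1 / t\<close>, which matches the weights in \<open>G21\<close>: the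
  mass of \<open>F \<sigma>\<close> on each cell is at most the corresponding
  \<open>gterm\<close>.\<close>

lemma V_middle:
  "(\<Sum>k\<in>{m - 1..2 * m - 1}. (norm (LINT t|lborel. indicator {\<delta><..<T1} t *\<^sub>R (of_real (vp_window k t) * p t)))\<^sup>2)
    \<le> 256 * real m * (C * w \<delta>)\<^sup>2"
proof -
  define K where "K = {m - 1..2 * m - 1}"
  \<comment> \<open>The common period of the exponentials whose frequencies are multiples of
    \<open>\<alpha> / 2\<close>.\<close>
  define P where "P = 4 * pi / \<alpha>"
  have [measurable]: "(\<lambda>t. cis (c * t)) \<in> borel_measurable borel" for c :: real
    by (intro borel_measurable_continuous_onI continuous_intros)
  define F where "F \<sigma> t = indicator {\<delta><..<T1} t *\<^sub>R (of_real (4 / (pi * \<alpha>) * (sin (\<alpha> / 4 * t) / t\<^sup>2)) * p t * cis (\<sigma> * (\<alpha> / 4) * t) / (2 * \<i>))"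
    for \<sigma> t
  have Fm[measurable]: "F \<sigma> \<in> borel_measurable borel" for \<sigma> unfolding F_def by measurable
  have F_norm: "norm (F \<sigma> t) \<le> norm (p t) / (2 * pi * t)" if "t > 0" for \<sigma> t
  proof -
    have "4 / (pi * \<alpha>) * (\<bar>sin (\<alpha> / 4 * t)\<bar> / t\<^sup>2) \<le> 4 / (pi * \<alpha>) * ((\<alpha> / 4 * \<bar>t\<bar>) / t\<^sup>2)"
      using \<alpha> by (intro mult_left_mono divide_right_mono sin_quotient_le) auto
    also have "\<dots> = 1 / (pi * t)" using that \<alpha> by (simp add: field_simps power2_eq_square)
    finally have s: "4 / (pi * \<alpha>) * (\<bar>sin (\<alpha> / 4 * t)\<bar> / t\<^sup>2) \<le> 1 / (pi * t)" .
    have "norm (F \<sigma> t) \<le> (4 / (pi * \<alpha>) * (\<bar>sin (\<alpha> / 4 * t)\<bar> / t\<^sup>2)) * norm (p t) / 2"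
      using \<alpha> by (simp add: F_def indicator_def norm_mult norm_divide norm_power abs_mult)
    also have "\<dots> \<le> (1 / (pi * t)) * norm (p t) / 2" by (intro divide_right_mono mult_right_mono s) auto
    finally show ?thesis by (simp add: mult_ac)
  qed
  have F_supp: "F \<sigma> t = 0" if "t \<notin> {\<delta><..<real (m + 1) * \<delta>}" for \<sigma> t
    using that by (simp add: F_def T1_def)
  have F_le: "norm (F \<sigma> t) \<le> B / (2 * pi * \<delta>)" for \<sigma> t
  proof (cases "t > \<delta>")
    case True
    then have "norm (F \<sigma> t) \<le> norm (p t) / (2 * pi * t)" using \<delta> by (intro F_norm) auto
    also have "\<dots> \<le> B / (2 * pi * \<delta>)" using True \<delta> p_le B_nonneg by (intro frac_le) auto
    finally show ?thesis .
  qed (use B_nonneg \<delta> in \<open>simp add: F_def\<close>)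
  have iF: "(\<lambda>t. norm (F \<sigma> t)) integrable_on {a..b}" for \<sigma> a b
    by (rule bounded_borel_integrable_on[where B="B / (2 * pi * \<delta>)"]) (use F_le in auto)
  have mass: "integral {real j * \<delta>..(real j + 1) * \<delta>} (\<lambda>t. norm (F \<sigma> t)) \<le> gterm j" for \<sigma> j
  \<comment> \<open>The first cell is separate because \<open>real j + 1 \<le> 2 * real j\<close>
    fails there; \<open>F \<sigma>\<close> vanishes on it.\<close>
  proof (cases "j = 0")
    case True
    have "integral {real j * \<delta>..(real j + 1) * \<delta>} (\<lambda>t. norm (F \<sigma> t)) = integral {real j * \<delta>..(real j + 1) * \<delta>} (\<lambda>t. 0::real)"
      by (intro Henstock_Kurzweil_Integration.integral_cong) (use True in \<open>auto simp: F_def\<close>)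
    then show ?thesis using gterm_nonneg[of j] by simp
  next
    case False
    have "integral {real j * \<delta>..(real j + 1) * \<delta>} (\<lambda>t. norm (F \<sigma> t))
      \<le> integral {real j * \<delta>..(real j + 1) * \<delta>} (\<lambda>t. (1 / ((real j + 1) * \<delta>)) * norm (p t))"
    proof (intro Henstock_Kurzweil_Integration.integral_le iF integrable_on_mult_right norm_p_integrable)
      fix t assume t: "t \<in> {real j * \<delta>..(real j + 1) * \<delta>}"
      have jd: "real j * \<delta> > 0" using False \<delta> by simp
      have "(real j + 1) * \<delta> \<le> (2 * real j) * \<delta>" using False \<delta> by (intro mult_right_mono) auto
      also have "\<dots> \<le> 2 * t" using t by simp
      also have "\<dots> \<le> (2 * pi) * t" using t jd pi_ge_two by (intro mult_right_mono) auto
      finally have "(real j + 1) * \<delta> \<le> 2 * pi * t" .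
      have "norm (F \<sigma> t) \<le> norm (p t) / (2 * pi * t)" using t jd by (intro F_norm) auto
      also have "\<dots> \<le> norm (p t) / ((real j + 1) * \<delta>)" using \<open>(real j + 1) * \<delta> \<le> 2 * pi * t\<close> \<delta> by (intro divide_left_mono mult_pos_pos) (use t jd in auto)
      finally show "norm (F \<sigma> t) \<le> (1 / ((real j + 1) * \<delta>)) * norm (p t)" by simp
    qed
    also have "\<dots> = gterm j" by (simp add: gterm_def)
    finally show ?thesis .
  qed
  have sumF: "(\<Sum>k\<in>K. (norm (LINT t|lborel. F \<sigma> t * cis (real k * (\<sigma> * (\<alpha> / 2)) * t)))\<^sup>2) \<le> 64 * real m * (C * w \<delta>)\<^sup>2"
    if \<sigma>: "\<bar>\<sigma>\<bar> = 1" for \<sigma>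
  proof -
    have "(\<Sum>k\<in>K. (norm (LINT t|lborel. F \<sigma> t * cis (real k * (\<sigma> * (\<alpha> / 2)) * t)))\<^sup>2)
      \<le> 16 * (P / \<delta>) * (\<Sum>j<m + 1. (integral {real j * \<delta>..(real j + 1) * \<delta>} (\<lambda>t. norm (F \<sigma> t)))\<^sup>2)"
    proof (rule sum_transform_le_local_masses[OF _ \<delta> _ _ _ Fm F_le F_supp])
      have "(real (m + 1) + 1) * \<delta> = pi / \<alpha> + 2 * \<delta>" using m \<alpha> by (simp add: \<delta>_def field_simps)
      moreover have "\<delta> \<le> pi / \<alpha>" unfolding \<delta>_def using m \<alpha> by (intro divide_left_mono) auto
      moreover have "pi / \<alpha> \<ge> 0" "P = 4 * (pi / \<alpha>)" using \<alpha> by (auto simp: P_def)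
      ultimately show "(real (m + 1) + 1) * \<delta> \<le> P" by linarith
      show "\<bar>\<sigma> * (\<alpha> / 2)\<bar> = 2 * pi / P" using \<sigma> \<alpha> by (simp add: P_def abs_mult)
      fix k assume "k \<in> K"
      then have "real k \<le> 2 * real m" by (auto simp: K_def)
      then have "real k * (\<alpha> / 2 * \<delta>) \<le> 2 * real m * (\<alpha> / 2 * \<delta>)" using \<alpha> \<delta> by (intro mult_right_mono) auto
      also have "\<dots> = pi" using \<alpha> m by (simp add: \<delta>_def)
      finally show "real k * \<bar>\<sigma> * (\<alpha> / 2)\<bar> * \<delta> \<le> pi" using \<sigma> \<alpha> by (simp add: abs_mult mult.assoc)
    qed (auto simp: K_def)
    also have "\<dots> \<le> 16 * (P / \<delta>) * (\<Sum>j<m + 1. (gterm j)\<^sup>2)"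
      using \<alpha> \<delta> by (intro mult_left_mono sum_mono power_mono mass Henstock_Kurzweil_Integration.integral_nonneg iF) (auto simp: P_def)
    also have "\<dots> \<le> 16 * (P / \<delta>) * (C * w \<delta>)\<^sup>2" using \<alpha> \<delta> by (intro mult_left_mono gterm_sum) (auto simp: P_def)
    also have "P / \<delta> = 4 * real m" using \<alpha> m by (simp add: P_def \<delta>_def field_simps)
    finally show ?thesis by simp
  qed
  have Fi: "integrable lborel (\<lambda>t. F \<sigma> t * cis (c * t))" for \<sigma> c
  proof -
    have "integrable lborel (\<lambda>t. indicator {0..T1} t *\<^sub>R (F \<sigma> t * cis (c * t)))"
      by (rule integrable_window[where B="B / (2 * pi * \<delta>)"]) (use F_le in \<open>auto simp: norm_mult\<close>)
    moreover have "indicator {0..T1} t *\<^sub>R (F \<sigma> t * cis (c * t)) = F \<sigma> t * cis (c * t)" for t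
      using \<delta> by (auto simp: indicator_def F_def)
    ultimately show ?thesis by simp
  qed
  have split: "(LINT t|lborel. indicator {\<delta><..<T1} t *\<^sub>R (of_real (vp_window k t) * p t))
    = (LINT t|lborel. F 1 t * cis (real k * (1 * (\<alpha> / 2)) * t)) - (LINT t|lborel. F (- 1) t * cis (real k * (- 1 * (\<alpha> / 2)) * t))" for k
  proof -
    have "indicator {\<delta><..<T1} t *\<^sub>R (of_real (vp_window k t) * p t) = F 1 t * cis (real k * (1 * (\<alpha> / 2)) * t) - F (- 1) t * cis (real k * (- 1 * (\<alpha> / 2)) * t)" for t
    proof -
      define \<theta> where "\<theta> = (2 * real k + 1) * \<alpha> / 4 * t"
      have c: "cis (1 * (\<alpha> / 4) * t) * cis (real k * (1 * (\<alpha> / 2)) * t) = cis \<theta>"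
        "cis (- 1 * (\<alpha> / 4) * t) * cis (real k * (- 1 * (\<alpha> / 2)) * t) = cis (- \<theta>)"
        unfolding cis_mult \<theta>_def by (intro arg_cong[where f=cis]; simp add: field_simps)+
      have s: "complex_of_real (sin \<theta>) = (cis \<theta> - cis (- \<theta>)) / (2 * \<i>)" by (simp add: complex_eq_iff)
      have "of_real (vp_window k t) = of_real (4 / (pi * \<alpha>) * (sin (\<alpha> / 4 * t) / t\<^sup>2)) * ((cis \<theta> - cis (- \<theta>)) / (2 * \<i>))"
        unfolding vp_window_eq \<theta>_def[symmetric] of_real_mult s ..
      then have "of_real (vp_window k t) * p t = of_real (4 / (pi * \<alpha>) * (sin (\<alpha> / 4 * t) / t\<^sup>2)) * p t * cis \<theta> / (2 * \<i>)
         - of_real (4 / (pi * \<alpha>) * (sin (\<alpha> / 4 * t) / t\<^sup>2)) * p t * cis (- \<theta>) / (2 * \<i>)"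
        by (simp only: diff_divide_distrib right_diff_distrib left_diff_distrib times_divide_eq_right times_divide_eq_left mult_ac)
      then show ?thesis unfolding F_def c[symmetric]
        by (cases "t \<in> {\<delta><..<T1}") (simp_all add: mult.assoc)
    qed
    then show ?thesis by (simp only: Bochner_Integration.integral_diff[OF Fi Fi])
  qed
  have "(\<Sum>k\<in>K. (norm (LINT t|lborel. indicator {\<delta><..<T1} t *\<^sub>R (of_real (vp_window k t) * p t)))\<^sup>2)
    \<le> (\<Sum>k\<in>K. 2 * (norm (LINT t|lborel. F 1 t * cis (real k * (1 * (\<alpha> / 2)) * t)))\<^sup>2
        + 2 * (norm (LINT t|lborel. F (- 1) t * cis (real k * (- 1 * (\<alpha> / 2)) * t)))\<^sup>2)"
  proof (intro sum_mono)
    fix k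
    have *: "(norm (a - b))\<^sup>2 \<le> 2 * (norm a)\<^sup>2 + 2 * (norm b)\<^sup>2" for a b :: complex
    proof -
      have "(norm (a - b))\<^sup>2 \<le> (norm a + norm b)\<^sup>2" by (intro power_mono norm_triangle_ineq4) auto
      also have "\<dots> \<le> 2 * (norm a)\<^sup>2 + 2 * (norm b)\<^sup>2" using zero_le_power2[of "norm a - norm b"] by (simp add: power2_eq_square algebra_simps)
      finally show ?thesis .
    qed
    show "(norm (LINT t|lborel. indicator {\<delta><..<T1} t *\<^sub>R (of_real (vp_window k t) * p t)))\<^sup>2
      \<le> 2 * (norm (LINT t|lborel. F 1 t * cis (real k * (1 * (\<alpha> / 2)) * t)))\<^sup>2
        + 2 * (norm (LINT t|lborel. F (- 1) t * cis (real k * (- 1 * (\<alpha> / 2)) * t)))\<^sup>2"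
      unfolding split by (rule *)
  qed
  also have "\<dots> = 2 * (\<Sum>k\<in>K. (norm (LINT t|lborel. F 1 t * cis (real k * (1 * (\<alpha> / 2)) * t)))\<^sup>2)
        + 2 * (\<Sum>k\<in>K. (norm (LINT t|lborel. F (- 1) t * cis (real k * (- 1 * (\<alpha> / 2)) * t)))\<^sup>2)"
    by (simp only: sum.distrib sum_distrib_left)
  also have "\<dots> \<le> 2 * (64 * real m * (C * w \<delta>)\<^sup>2) + 2 * (64 * real m * (C * w \<delta>)\<^sup>2)"
    by (intro add_mono mult_left_mono sumF) auto
  finally show ?thesis by (simp add: K_def)
qed

lemma V_tail:
  assumes k: "m - 1 \<le> k" and C0: "C \<ge> 0"
  shows "norm (LINT t|lborel. indicator {T1..} t *\<^sub>R (of_real (vp_window k t) * p t)) \<le> tail_const * w (pi / real m)"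
proof -
  define \<omega> where "\<omega> = (2 * real k + 1) * \<alpha> / 4"
  define \<gamma> where "\<gamma> = pi / \<omega>"
  define T0 where "T0 = pi / \<alpha>"
  define b where "b = \<alpha> / 4"
  have \<omega>: "\<omega> > 0" using \<alpha> by (simp add: \<omega>_def add_nonneg_pos)
  have \<gamma>: "\<gamma> > 0" using \<omega> by (simp add: \<gamma>_def)
  have T0: "T0 > 0" using \<alpha> by (simp add: T0_def)
  have T01: "T0 < T1" using \<delta> by (simp add: T1_eq T0_def)
  have b: "b \<ge> 0" using \<alpha> by (simp add: b_def)
  define s where "s t = sin (b * t) / t\<^sup>2" for t
  define H where "H t = indicator {T1..} t *\<^sub>R (of_real (s t * sin (\<omega> * t)) * p t)" for t
  have win: "of_real (vp_window k t) * p t = of_real (4 / (pi * \<alpha>)) * (of_real (s t * sin (\<omega> * t)) * p t)" for t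
    by (simp add: vp_window_eq s_def b_def \<omega>_def)
  have winH: "indicator {T1..} t *\<^sub>R (of_real (vp_window k t) * p t) = of_real (4 / (pi * \<alpha>)) * H t" for t
    unfolding H_def win by (simp only: mult_scaleR_right)
  have Hi: "integrable lborel H"
  proof -
    have "integrable lborel (\<lambda>t. of_real (4 / (pi * \<alpha>)) * H t)" using vp_window_integrable'[of "{T1..}" k] unfolding winH by simp
    from integrable_mult_right[OF this, of "of_real (pi * \<alpha> / 4)"] show ?thesis using \<alpha> by (simp add: mult.assoc[symmetric])
  qed
  define J where "J = (LINT t|lborel. H t)"
  have Hi': "integrable lborel (\<lambda>t. H (\<gamma> + t))" using lborel_integrable_real_affine[OF Hi, of 1 \<gamma>] by simp
  have "J = (LINT t|lborel. H (\<gamma> + t))" unfolding J_def using lborel_integral_real_affine[of 1 H \<gamma>] by simp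
  then have J2: "2 * J = (LINT t|lborel. H t + H (\<gamma> + t))" using Hi Hi' by (simp add: J_def)
  define U where "U t = norm (p t - p (t + \<gamma>))" for t
  \<comment> \<open>Majorants for the three effects of the shift: the difference of
    \<open>p\<close>, the change of the amplitude \<open>s\<close>, and the strip of length
    \<open>\<gamma>\<close> before \<open>T1\<close>, where only the shifted term is
    present.\<close>
  define W1 where "W1 t = indicator {T0<..} t * (U t / t\<^sup>2)" for t
  define W2 where "W2 t = indicator {T0<..} t * (1 / t\<^sup>2)" for t :: real
  define W3 where "W3 t = (indicator {T1 - \<gamma>..T1} t :: real)" for t
  have Um: "U \<in> borel_measurable borel" unfolding U_def by measurable
  have U0: "U t \<ge> 0" for t by (simp add: U_def)
  have UB: "U t \<le> B + B" for t unfolding U_def by (rule norm_diff_mono[OF p_le p_le])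
  have UM: "integral {0..T} U \<le> (C * w \<gamma>) * T" if "T > 0" for T
    using smooth[OF \<gamma> that] that by (simp add: U_def[abs_def] pos_divide_le_eq)
  note W1 = integral_over_square_le[OF Um U0 UB T0 UM, folded W1_def[abs_def]]
  have W2: "integrable lborel W2" "(LINT t|lborel. W2 t) \<le> 4 * 1 / T0"
    unfolding W2_def using integral_over_square_le[of "\<lambda>_. 1" 1 T0 1] T0 by auto
  have W3: "integrable lborel W3" "(LINT t|lborel. W3 t) = \<gamma>"
    using \<gamma> unfolding W3_def by (auto intro!: integrable_real_indicator simp: emeasure_lborel_Icc_eq)
  have s_le: "\<bar>s t\<bar> \<le> 1 / t\<^sup>2" for t by (auto simp: s_def abs_divide intro!: divide_right_mono)
  have pt: "norm (H t + H (\<gamma> + t)) \<le> W1 t + (B * (\<gamma> * (b + 2 / T0))) * W2 t + (B / T0\<^sup>2) * W3 t" for t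
  proof -
    have nn: "W1 t \<ge> 0" "(B * (\<gamma> * (b + 2 / T0))) * W2 t \<ge> 0" "(B / T0\<^sup>2) * W3 t \<ge> 0"
      using B_nonneg \<gamma> b T0 U0 by (auto simp: W1_def W2_def W3_def)
    consider "t \<ge> T1" | "t < T1" "t \<ge> T1 - \<gamma>" | "t < T1 - \<gamma>" by linarith
    then show ?thesis
    proof cases
      case 1
      have "sin (\<omega> * (\<gamma> + t)) = - sin (\<omega> * t)" using \<omega> by (simp add: \<gamma>_def distrib_left sin_add)
      then have "H t + H (\<gamma> + t) = of_real (s t * sin (\<omega> * t)) * p t - of_real (s (t + \<gamma>) * sin (\<omega> * t)) * p (t + \<gamma>)"
        using 1 \<gamma> by (simp add: H_def add.commute)
      also have "\<dots> = of_real (sin (\<omega> * t)) * (of_real (s t) * (p t - p (t + \<gamma>)) + of_real (s t - s (t + \<gamma>)) * p (t + \<gamma>))"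
        by (simp add: algebra_simps)
      also have "norm \<dots> \<le> 1 * (1 / t\<^sup>2 * U t + (\<gamma> * (b + 2 / T0) / t\<^sup>2) * B)"
        unfolding norm_mult norm_of_real
      proof (intro mult_mono norm_add_mono)
        show "norm (of_real (s t) * (p t - p (t + \<gamma>))) \<le> 1 / t\<^sup>2 * U t"
          unfolding norm_mult norm_of_real U_def by (intro mult_right_mono s_le) auto
        show "norm (of_real (s t - s (t + \<gamma>)) * p (t + \<gamma>)) \<le> (\<gamma> * (b + 2 / T0) / t\<^sup>2) * B"
          unfolding norm_mult norm_of_real s_def
          using 1 T01 T0 \<gamma> b by (intro mult_mono sin_over_square_diff_le p_le) auto
      qed auto
      also have "\<dots> = W1 t + (B * (\<gamma> * (b + 2 / T0))) * W2 t" using 1 T01 by (simp add: W1_def W2_def mult_ac)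
      finally show ?thesis using nn by linarith
    next
      case 2
      have "norm (H t + H (\<gamma> + t)) = \<bar>s (t + \<gamma>)\<bar> * \<bar>sin (\<omega> * (t + \<gamma>))\<bar> * norm (p (t + \<gamma>))"
        using 2 by (simp add: H_def norm_mult abs_mult add.commute)
      also have "\<dots> \<le> (1 / T0\<^sup>2) * 1 * B"
      proof (intro mult_mono p_le)
        have "1 / (t + \<gamma>)\<^sup>2 \<le> 1 / T0\<^sup>2" using 2 T01 T0 by (intro divide_left_mono power_mono mult_pos_pos) auto
        then show "\<bar>s (t + \<gamma>)\<bar> \<le> 1 / T0\<^sup>2" using s_le[of "t + \<gamma>"] by linarith
      qed auto
      also have "\<dots> = (B / T0\<^sup>2) * W3 t" using 2 by (simp add: W3_def)
      finally show ?thesis using nn by linarith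
    next
      case 3
      then have "H t + H (\<gamma> + t) = 0" using \<gamma> by (simp add: H_def)
      then show ?thesis using nn by simp
    qed
  qed
  have "norm (2 * J) \<le> (LINT t|lborel. W1 t + (B * (\<gamma> * (b + 2 / T0))) * W2 t + (B / T0\<^sup>2) * W3 t)"
    unfolding J2 by (rule norm_lborel_integral_le[OF _ _ pt])
      (intro Bochner_Integration.integrable_add integrable_mult_right Hi Hi' W1(1) W2(1) W3(1))+
  also have "\<dots> = (LINT t|lborel. W1 t) + (B * (\<gamma> * (b + 2 / T0))) * (LINT t|lborel. W2 t) + (B / T0\<^sup>2) * (LINT t|lborel. W3 t)"
    using W1(1) W2(1) W3(1) by simp
  also have "\<dots> \<le> 4 * (C * w \<gamma>) / T0 + (B * (\<gamma> * (b + 2 / T0))) * (4 * 1 / T0) + (B / T0\<^sup>2) * \<gamma>"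
    using B_nonneg \<gamma> b T0 unfolding W3(2) by (intro add_mono mult_left_mono W1(2) W2(2) order_refl) auto
  also have "\<dots> = 4 * (C * w \<gamma>) * (\<alpha> / pi) + (B * (\<alpha> / 4 + 2 * (\<alpha> / pi)) * (4 * (\<alpha> / pi)) + B * (\<alpha> / pi)\<^sup>2) * \<gamma>"
    by (simp add: T0_def b_def power_divide algebra_simps)
  finally have J: "2 * norm J \<le> 4 * (C * w \<gamma>) * (\<alpha> / pi) + (B * (\<alpha> / 4 + 2 * (\<alpha> / pi)) * (4 * (\<alpha> / pi)) + B * (\<alpha> / pi)\<^sup>2) * \<gamma>"
    by (simp add: norm_mult)
  have \<gamma>_le: "\<gamma> \<le> (4 / \<alpha>) * (pi / real m)"
  proof -
    have "real m \<le> 2 * real k + 1" using k m by linarith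
    then have "real m * \<alpha> / 4 \<le> \<omega>" unfolding \<omega>_def using \<alpha> by (intro divide_right_mono mult_right_mono) auto
    then have "\<gamma> \<le> pi / (real m * \<alpha> / 4)" unfolding \<gamma>_def using m \<alpha> \<omega> by (intro divide_left_mono mult_pos_pos) auto
    then show ?thesis by (simp add: mult_ac)
  qed
  have w\<gamma>: "w \<gamma> \<le> (4 / \<alpha> + 1) * w (pi / real m)" using \<gamma> \<gamma>_le \<alpha> by (intro modulus_scale_le[OF w]) auto
  \<comment> \<open>Here an error of order \<open>1 / m\<close> is turned into a multiple of
    \<open>w (pi / real m)\<close>, by means of \<open>w pi > 0\<close>.\<close>
  have \<gamma>w: "\<gamma> \<le> (4 * pi / \<alpha> / w pi) * w (pi / real m)"
  proof -
    have "1 / real m \<le> w (pi / real m) / w pi" using w_m w_pi m by (simp add: field_simps)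
    then have "(4 * pi / \<alpha>) * (1 / real m) \<le> (4 * pi / \<alpha>) * (w (pi / real m) / w pi)" using \<alpha> by (intro mult_left_mono) auto
    then show ?thesis using \<gamma>_le by simp
  qed
  have "2 * norm J \<le> 4 * (C * ((4 / \<alpha> + 1) * w (pi / real m))) * (\<alpha> / pi)
     + (B * (\<alpha> / 4 + 2 * (\<alpha> / pi)) * (4 * (\<alpha> / pi)) + B * (\<alpha> / pi)\<^sup>2) * ((4 * pi / \<alpha> / w pi) * w (pi / real m))"
    using B_nonneg \<alpha> C0
    by (intro order_trans[OF J] add_mono mult_right_mono mult_left_mono w\<gamma> \<gamma>w add_nonneg_nonneg mult_nonneg_nonneg) auto
  then have "2 / (pi * \<alpha>) * (2 * norm J) \<le> 2 / (pi * \<alpha>) * (4 * (C * ((4 / \<alpha> + 1) * w (pi / real m))) * (\<alpha> / pi)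
     + (B * (\<alpha> / 4 + 2 * (\<alpha> / pi)) * (4 * (\<alpha> / pi)) + B * (\<alpha> / pi)\<^sup>2) * ((4 * pi / \<alpha> / w pi) * w (pi / real m)))"
    using \<alpha> by (intro mult_left_mono) auto
  also have "\<dots> = tail_const * w (pi / real m)" by (simp only: tail_const_def distrib_left distrib_right mult_ac)
  finally have "4 / (pi * \<alpha>) * norm J \<le> tail_const * w (pi / real m)" by simp
  moreover have "norm (LINT t|lborel. indicator {T1..} t *\<^sub>R (of_real (vp_window k t) * p t)) = 4 / (pi * \<alpha>) * norm J"
    unfolding winH J_def integral_mult_right_zero norm_mult norm_of_real using \<alpha> by simp
  ultimately show ?thesis by simp
qed

lemma V_split:
  "V k = (LINT t|lborel. indicator {0..\<delta>} t *\<^sub>R (of_real (vp_window k t) * p t))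
    + (LINT t|lborel. indicator {\<delta><..<T1} t *\<^sub>R (of_real (vp_window k t) * p t))
    + (LINT t|lborel. indicator {T1..} t *\<^sub>R (of_real (vp_window k t) * p t))"
proof -
  have "\<delta> < T1" using \<alpha> by (simp add: T1_eq)
  then have "indicator {0..} t *\<^sub>R z = indicator {0..\<delta>} t *\<^sub>R z + indicator {\<delta><..<T1} t *\<^sub>R z + indicator {T1..} t *\<^sub>R z"
    for t and z :: complex using \<delta> by (auto simp: indicator_def)
  then show ?thesis unfolding V_def by (simp add: vp_window_integrable')
qed

text \<open>The range begins at \<open>m - 1\<close> because the deviation with index
  \<open>k\<close> may be represented by \<open>V (k - 1)\<close>. The factor 3 comes from squaring
  three summands; 258 is 256 from the middle part plus 2 from the head, where the range has at most
  \<open>2 * m\<close> indices.\<close>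

lemma V_block:
  assumes C0: "C \<ge> 0"
  shows "(\<Sum>k\<in>{m - 1..2 * m - 1}. (norm (V k))\<^sup>2)
    \<le> 3 * (258 * (C * (1 / \<alpha> + 1))\<^sup>2 + 2 * tail_const\<^sup>2) * real m * (w (pi / real m))\<^sup>2"
proof -
  define K where "K = {m - 1..2 * m - 1}"
  define W where "W = w (pi / real m)"
  define a where "a k = norm (LINT t|lborel. indicator {0..\<delta>} t *\<^sub>R (of_real (vp_window k t) * p t))" for k
  define b where "b k = norm (LINT t|lborel. indicator {\<delta><..<T1} t *\<^sub>R (of_real (vp_window k t) * p t))" for k
  define c where "c k = norm (LINT t|lborel. indicator {T1..} t *\<^sub>R (of_real (vp_window k t) * p t))" for k
  have card: "real (card K) \<le> 2 * real m" using m by (simp add: K_def)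
  have "(norm (V k))\<^sup>2 \<le> 3 * (a k)\<^sup>2 + 3 * (b k)\<^sup>2 + 3 * (c k)\<^sup>2" for k
  proof -
    have "norm (V k) \<le> a k + b k + c k" unfolding V_split a_def b_def c_def by (intro norm_add_mono order_refl)
    then have "(norm (V k))\<^sup>2 \<le> (a k + b k + c k)\<^sup>2" by (intro power_mono) auto
    also have "\<dots> \<le> 3 * (a k)\<^sup>2 + 3 * (b k)\<^sup>2 + 3 * (c k)\<^sup>2"
      using zero_le_power2[of "a k - b k"] zero_le_power2[of "b k - c k"] zero_le_power2[of "a k - c k"]
      by (simp add: power2_eq_square algebra_simps)
    finally show ?thesis .
  qed
  then have "(\<Sum>k\<in>K. (norm (V k))\<^sup>2) \<le> (\<Sum>k\<in>K. 3 * (a k)\<^sup>2 + 3 * (b k)\<^sup>2 + 3 * (c k)\<^sup>2)" by (intro sum_mono)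
  also have "\<dots> = 3 * (\<Sum>k\<in>K. (a k)\<^sup>2) + 3 * (\<Sum>k\<in>K. (b k)\<^sup>2) + 3 * (\<Sum>k\<in>K. (c k)\<^sup>2)"
    by (simp only: sum.distrib sum_distrib_left)
  also have "\<dots> \<le> 3 * (2 * real m * (C * w \<delta>)\<^sup>2) + 3 * (256 * real m * (C * w \<delta>)\<^sup>2) + 3 * (2 * real m * (tail_const * W)\<^sup>2)"
  proof (intro add_mono mult_left_mono)
    have "(\<Sum>k\<in>K. (a k)\<^sup>2) \<le> (\<Sum>k\<in>K. (C * w \<delta>)\<^sup>2)"
      by (intro sum_mono power_mono) (auto simp: K_def a_def intro!: V_head)
    also have "\<dots> \<le> 2 * real m * (C * w \<delta>)\<^sup>2" using card by (simp add: mult_right_mono)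
    finally show "(\<Sum>k\<in>K. (a k)\<^sup>2) \<le> 2 * real m * (C * w \<delta>)\<^sup>2" .
    show "(\<Sum>k\<in>K. (b k)\<^sup>2) \<le> 256 * real m * (C * w \<delta>)\<^sup>2" unfolding K_def b_def by (rule V_middle)
    have "(\<Sum>k\<in>K. (c k)\<^sup>2) \<le> (\<Sum>k\<in>K. (tail_const * W)\<^sup>2)"
      unfolding W_def c_def by (intro sum_mono power_mono V_tail C0) (auto simp: K_def)
    also have "\<dots> \<le> 2 * real m * (tail_const * W)\<^sup>2" using card by (simp add: mult_right_mono)
    finally show "(\<Sum>k\<in>K. (c k)\<^sup>2) \<le> 2 * real m * (tail_const * W)\<^sup>2" .
  qed auto
  also have "\<dots> = 774 * real m * (C * w \<delta>)\<^sup>2 + 6 * real m * (tail_const * W)\<^sup>2" by simp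
  also have "\<dots> \<le> 774 * real m * (C * ((1 / \<alpha> + 1) * W))\<^sup>2 + 6 * real m * (tail_const * W)\<^sup>2"
    using C0 w_\<delta> C_w_\<delta> unfolding W_def by (intro add_mono mult_left_mono power_mono order_refl) auto
  also have "\<dots> = 3 * (258 * (C * (1 / \<alpha> + 1))\<^sup>2 + 2 * tail_const\<^sup>2) * real m * W\<^sup>2"
  proof -
    define X where "X = (C * (1 / \<alpha> + 1))\<^sup>2"
    have "(C * ((1 / \<alpha> + 1) * W))\<^sup>2 = X * W\<^sup>2" unfolding X_def by (simp only: mult.assoc[symmetric] power_mult_distrib)
    then show ?thesis unfolding X_def[symmetric] by (simp add: power_mult_distrib distrib_left distrib_right mult_ac)
  qed
  finally show ?thesis by (simp add: K_def W_def)
qed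

end

end

subsection \<open>Summation with general monotone weights\<close>

lemma diff_le_sum_variation:
  fixes a :: "nat \<Rightarrow> real"
  assumes "k \<in> {m..2 * m - 1}" "l \<in> {m..2 * m - 1}"
  shows "a k \<le> a l + (\<Sum>i = m..2 * m - 1. \<bar>a i - a (i + 1)\<bar>)"
proof -
  have *: "\<bar>a j - a i\<bar> \<le> (\<Sum>i = m..2 * m - 1. \<bar>a i - a (i + 1)\<bar>)" if "m \<le> i" "i \<le> j" "j \<le> 2 * m - 1" for i j
  proof -
    have "a j - a i = (\<Sum>r = i..<j. a (Suc r) - a r)" using that by (simp add: sum_Suc_diff')
    then have "\<bar>a j - a i\<bar> \<le> (\<Sum>r = i..<j. \<bar>a (Suc r) - a r\<bar>)" by (simp add: sum_abs)
    also have "\<dots> \<le> (\<Sum>r = m..2 * m - 1. \<bar>a (Suc r) - a r\<bar>)" using that by (intro sum_mono2) auto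
    finally show ?thesis by (simp add: abs_minus_commute)
  qed
  show ?thesis using *[of k l] *[of l k] assms by (cases "k \<le> l") auto
qed

text \<open>Bounds the number of dyadic scales comparable with \<open>y\<close>, independently of
  \<open>y\<close>; it later limits the overlap of the ranges attached to dyadic blocks. With
  \<open>i\<close> the least such scale, \<open>2 ^ (j - i) \<le> r * s\<close>, and the crude
  inequality \<open>j - i \<le> 2 ^ (j - i)\<close> takes the place of a logarithm.\<close>

lemma card_dyadic_le:
  fixes r s y :: real
  assumes "r > 0" "\<And>j. j \<in> J \<Longrightarrow> 2 ^ j \<le> r * y" "\<And>j. j \<in> J \<Longrightarrow> y \<le> s * 2 ^ j" "finite (J :: nat set)"
  shows "real (card J) \<le> r * s + 1 \<or> J = {}"
proof (cases "J = {}")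
  case False
  define i where "i = Min J"
  have i: "i \<in> J" "\<And>j. j \<in> J \<Longrightarrow> i \<le> j" using False assms(4) by (auto simp: i_def)
  have d: "real (j - i) \<le> r * s" if "j \<in> J" for j
  proof -
    have "(2::real) ^ j = 2 ^ (j - i) * 2 ^ i" using i(2)[OF that] by (simp flip: power_add)
    moreover have "(2::real) ^ j \<le> r * (s * 2 ^ i)" using assms(2)[OF that] assms(3)[OF i(1)] assms(1) by (meson mult_left_mono less_imp_le order_trans)
    ultimately have "(2::real) ^ (j - i) * 2 ^ i \<le> (r * s) * 2 ^ i" by simp
    then have "(2::real) ^ (j - i) \<le> r * s" by (rule mult_right_le_imp_le) simp
    moreover have "real (j - i) \<le> 2 ^ (j - i)" using less_exp[of "j - i"] by (metis of_nat_le_iff of_nat_numeral of_nat_power order_less_imp_le)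
    ultimately show ?thesis by linarith
  qed
  have rs: "r * s \<ge> 0" using d[OF i(1)] by simp
  have "J \<subseteq> {i..i + nat \<lfloor>r * s\<rfloor>}"
  proof
    fix j assume j: "j \<in> J"
    then have "j - i \<le> nat \<lfloor>r * s\<rfloor>" using d[OF j] by (simp add: le_nat_floor)
    then show "j \<in> {i..i + nat \<lfloor>r * s\<rfloor>}" using i(2)[OF j] by auto
  qed
  then have "card J \<le> card {i..i + nat \<lfloor>r * s\<rfloor>}" by (intro card_mono) auto
  then have "real (card J) \<le> real (nat \<lfloor>r * s\<rfloor>) + 1" by simp
  then show ?thesis using rs by linarith
qed simp

text \<open>The inequality between \<open>a k\<close>, \<open>a l\<close> and the variation over the
  block is summed over all \<open>l\<close> of the block. The variation is bounded by weights
  divided by their index, where \<open>real m / real l\<close> is at most \<open>2 * c\<close>. The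
  range on the right contains the block as well as the range of the \<open>GM\<close>
  condition.\<close>

lemma GM_2beta_block:
  assumes a: "\<And>k. a k \<ge> 0" and c: "c > 1" and K0: "K0 > 0" and GM: "a \<in> GM_2beta c K0" and m: "m \<ge> 1"
    and k: "k \<in> {m..2 * m - 1}"
  shows "real m * a k \<le> (1 + 2 * c * K0) * (\<Sum>l | 1 \<le> l \<and> real m \<le> 2 * c * real l \<and> real l \<le> (c + 2) * real m. a l)"
proof -
  define R where "R = {l. 1 \<le> l \<and> real m \<le> 2 * c * real l \<and> real l \<le> (c + 2) * real m}"
  have fin: "finite R"
  proof (rule finite_subset)
    show "R \<subseteq> {..nat \<lfloor>(c + 2) * real m\<rfloor>}" by (auto simp: R_def le_nat_floor)
  qed simp
  define T where "T = (\<Sum>i = m..2 * m - 1. \<bar>a i - a (i + 1)\<bar>)"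
  define L where "L = {max 1 (nat \<lfloor>real m / c\<rfloor>)..nat \<lfloor>c * real m\<rfloor>}"
  have T: "T \<le> K0 * (\<Sum>l\<in>L. a l / real l)" using GM m by (simp add: GM_2beta_def T_def L_def)
  have card: "card {m..2 * m - 1} = m" using m by simp
  have "real m * a k = (\<Sum>l = m..2 * m - 1. a k)" by (simp only: sum_constant card)
  also have "\<dots> \<le> (\<Sum>l = m..2 * m - 1. a l + T)" unfolding T_def by (intro sum_mono diff_le_sum_variation k)
  also have "\<dots> = (\<Sum>l = m..2 * m - 1. a l) + real m * T" by (simp only: sum.distrib sum_constant card)
  also have "\<dots> \<le> (\<Sum>l\<in>R. a l) + 2 * c * K0 * (\<Sum>l\<in>R. a l)"
  proof (rule add_mono)
    show "(\<Sum>l = m..2 * m - 1. a l) \<le> (\<Sum>l\<in>R. a l)"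
    proof (intro sum_mono2 fin a subsetI)
      fix l assume l: "l \<in> {m..2 * m - 1}"
      have "real m * 1 \<le> real l * (2 * c)" using l c by (intro mult_mono) auto
      moreover have "2 * real m \<le> (c + 2) * real m" using c by (intro mult_right_mono) auto
      moreover have "l \<le> 2 * m" using l by (auto intro: le_trans[OF _ diff_le_self])
      then have "real l \<le> 2 * real m" by linarith
      ultimately have "real m * 1 \<le> real l * (2 * c)" "real l \<le> (c + 2) * real m" by linarith+
      then show "l \<in> R" using l m by (auto simp: R_def mult_ac)
    qed
    have "real m * (\<Sum>l\<in>L. a l / real l) = (\<Sum>l\<in>L. a l * (real m / real l))" by (simp add: sum_distrib_left mult_ac)
    also have "\<dots> \<le> (\<Sum>l\<in>L. a l * (2 * c))"
    proof (intro sum_mono mult_left_mono a)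
      fix l assume l: "l \<in> L"
      then have l1: "1 \<le> l" by (simp add: L_def)
      \<comment> \<open>The floor is at most \<open>l\<close>, and the 1 lost by rounding down is at
        most \<open>l\<close> too; this doubling is why \<open>2 * c\<close> appears in place of
        \<open>c\<close>.\<close>
      have "real m / c < real (nat \<lfloor>real m / c\<rfloor>) + 1" using c by linarith
      also have "\<dots> \<le> real l + real l" using l by (intro add_mono) (auto simp: L_def)
      finally have "real m < 2 * c * real l" using c by (simp add: pos_divide_less_eq mult_ac)
      then show "real m / real l \<le> 2 * c" using l1 by (simp add: pos_divide_le_eq)
    qed
    also have "\<dots> \<le> (\<Sum>l\<in>R. a l * (2 * c))"
    proof (intro sum_mono2 fin subsetI)
      fix l assume l: "l \<in> L"
      then have l1: "1 \<le> l" by (simp add: L_def)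
      have "real m / c < real (nat \<lfloor>real m / c\<rfloor>) + 1" using c by linarith
      also have "\<dots> \<le> real l + real l" using l by (intro add_mono) (auto simp: L_def)
      finally have m2: "real m < 2 * c * real l" using c by (simp add: pos_divide_less_eq mult_ac)
      have "real l \<le> real (nat \<lfloor>c * real m\<rfloor>)" using l by (simp add: L_def)
      also have "\<dots> \<le> c * real m" using c by (intro of_nat_floor) simp
      also have "\<dots> \<le> (c + 2) * real m" by (intro mult_right_mono) auto
      finally show "l \<in> R" using l1 m2 by (simp add: R_def)
    qed (use a c in auto)
    also have "\<dots> = 2 * c * (\<Sum>l\<in>R. a l)" unfolding sum_distrib_right[symmetric] by (rule mult.commute)
    finally have "K0 * (real m * (\<Sum>l\<in>L. a l / real l)) \<le> K0 * (2 * c * (\<Sum>l\<in>R. a l))" using K0 by (intro mult_left_mono) auto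
    moreover have "real m * T \<le> real m * (K0 * (\<Sum>l\<in>L. a l / real l))" using T by (intro mult_left_mono) auto
    ultimately show "real m * T \<le> 2 * c * K0 * (\<Sum>l\<in>R. a l)" by (simp add: mult_ac)
  qed
  also have "\<dots> = (1 + 2 * c * K0) * (\<Sum>l\<in>R. a l)" by (simp add: distrib_right)
  finally show ?thesis by (simp add: R_def)
qed

text \<open>\<open>U m\<close> measures \<open>b\<close> on the block starting at \<open>m\<close>,
  and \<open>v\<close> is its pointwise counterpart on the comparable range. After
  \<open>GM_2beta_block\<close> the ranges \<open>R (2 ^ j)\<close> of the dyadic blocks overlap at
  most \<open>2 * c * (c + 2) + 1\<close> times. The index 0 lies in no dyadic block and is covered
  by \<open>D''\<close>.\<close>

lemma GM_2beta_sum_le: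
  fixes a b v U :: "nat \<Rightarrow> real"
  assumes a: "\<And>k. a k \<ge> 0" and c: "c > 1" and K0: "K0 > 0" and GM: "a \<in> GM_2beta c K0"
    and b: "\<And>k. b k \<ge> 0" and v: "\<And>k. v k \<ge> 0" and U: "\<And>m. U m \<ge> 0"
    and D: "D \<ge> 0" "D' \<ge> 0" "D'' \<ge> 0"
    and block: "\<And>m. m \<ge> 1 \<Longrightarrow> (\<Sum>k = m..2 * m - 1. b k) \<le> D * real m * U m"
    and comp: "\<And>m l. m \<ge> 1 \<Longrightarrow> real l \<le> (c + 2) * real m \<Longrightarrow> U m \<le> D' * v l"
    and zero: "b 0 \<le> D'' * v 0"
    and sm: "summable (\<lambda>k. a k * v k)"
  shows "summable (\<lambda>k. a k * b k)"
    and "(\<Sum>k. a k * b k) \<le> (D'' + D * (1 + 2 * c * K0) * D' * (2 * c * (c + 2) + 1)) * (\<Sum>k. a k * v k)"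
proof -
  define R where "R m = {l. 1 \<le> l \<and> real m \<le> 2 * c * real l \<and> real l \<le> (c + 2) * real m}" for m :: nat
  have sub: "R m \<subseteq> {..nat \<lfloor>(c + 2) * real m\<rfloor>}" for m by (auto simp: R_def le_nat_floor)
  have fin: "finite (R m)" for m by (rule finite_subset[OF sub]) simp
  define S where "S = (\<Sum>k. a k * v k)"
  define Q where "Q = D * (1 + 2 * c * K0) * D'"
  have Q: "Q \<ge> 0" using D c K0 by (simp add: Q_def)
  have blk: "(\<Sum>k = m..2 * m - 1. a k * b k) \<le> Q * (\<Sum>l\<in>R m. a l * v l)" if m: "m \<ge> 1" for m
  proof -
    define E where "E = (1 + 2 * c * K0) * (\<Sum>l\<in>R m. a l)"
    have E: "E \<ge> 0" unfolding E_def using c K0 a by (intro mult_nonneg_nonneg sum_nonneg) auto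
    have "(\<Sum>k = m..2 * m - 1. a k * b k) \<le> (\<Sum>k = m..2 * m - 1. (E / real m) * b k)"
    proof (intro sum_mono mult_right_mono b)
      fix k assume "k \<in> {m..2 * m - 1}"
      from GM_2beta_block[OF a c K0 GM m this] have "real m * a k \<le> E" by (simp add: E_def R_def)
      then show "a k \<le> E / real m" using m by (simp add: pos_le_divide_eq mult.commute)
    qed
    also have "\<dots> = (E / real m) * (\<Sum>k = m..2 * m - 1. b k)" by (simp add: sum_distrib_left)
    also have "\<dots> \<le> (E / real m) * (D * real m * U m)" using E by (intro mult_left_mono block m) auto
    also have "\<dots> = D * U m * E" using m by simp
    also have "\<dots> = D * (1 + 2 * c * K0) * (\<Sum>l\<in>R m. a l * U m)" 
      unfolding E_def sum_distrib_right[symmetric] by (simp only: mult_ac)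
    also have "\<dots> \<le> D * (1 + 2 * c * K0) * (\<Sum>l\<in>R m. a l * (D' * v l))"
    proof (intro mult_left_mono sum_mono a)
      fix l assume "l \<in> R m"
      then show "U m \<le> D' * v l" by (intro comp m) (simp add: R_def)
    qed (use D c K0 in auto)
    also have "\<dots> = Q * (\<Sum>l\<in>R m. a l * v l)" by (simp add: Q_def sum_distrib_left mult_ac)
    finally show ?thesis .
  qed
  have dy: "(\<Sum>k = 1..<2 ^ J. a k * b k) = (\<Sum>j<J. \<Sum>k = 2 ^ j..2 * 2 ^ j - 1. a k * b k)" for J
  proof (induction J)
    case (Suc J)
    have "{1..<2 ^ Suc J} = {1..<2 ^ J} \<union> {2 ^ J..2 * 2 ^ J - 1 :: nat}"
    proof -
      define X where "X = (2::nat) ^ J"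
      have "X \<ge> 1" by (simp add: X_def)
      then show ?thesis unfolding power_Suc X_def[symmetric] by auto
    qed
    moreover have "{1..<2 ^ J} \<inter> {2 ^ J..2 * 2 ^ J - 1 :: nat} = {}" by auto
    ultimately show ?case using Suc by (simp add: sum.union_disjoint)
  qed simp
  have bound: "(\<Sum>k = 1..<2 ^ J. a k * b k) \<le> Q * (2 * c * (c + 2) + 1) * S" for J
  proof -
    define M where "M = nat \<lfloor>(c + 2) * 2 ^ J\<rfloor>"
    have RM: "R (2 ^ j) \<subseteq> {..M}" if "j < J" for j
    proof -
      have "(2::real) ^ j \<le> 2 ^ J" using that by (intro power_increasing) auto
      then have "(c + 2) * 2 ^ j \<le> (c + 2) * 2 ^ J" using c by (intro mult_left_mono) auto
      then have "nat \<lfloor>(c + 2) * 2 ^ j\<rfloor> \<le> M" unfolding M_def by (intro nat_mono floor_mono)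
      then show ?thesis using sub[of "2 ^ j"] by (auto dest!: subsetD)
    qed
    have "(\<Sum>k = 1..<2 ^ J. a k * b k) \<le> (\<Sum>j<J. Q * (\<Sum>l\<in>R (2 ^ j). a l * v l))"
      unfolding dy by (intro sum_mono blk) simp
    also have "\<dots> = Q * (\<Sum>j<J. \<Sum>l\<in>R (2 ^ j). a l * v l)" by (simp add: sum_distrib_left)
    also have "(\<Sum>j<J. \<Sum>l\<in>R (2 ^ j). a l * v l) = (\<Sum>j<J. \<Sum>l\<le>M. if l \<in> R (2 ^ j) then a l * v l else 0)"
    proof (rule sum.cong[OF refl])
      fix j assume "j \<in> {..<J}"
      then have "{..M} \<inter> R (2 ^ j) = R (2 ^ j)" using RM[of j] by auto
      then show "(\<Sum>l\<in>R (2 ^ j). a l * v l) = (\<Sum>l\<le>M. if l \<in> R (2 ^ j) then a l * v l else 0)"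
        using sum.inter_restrict[of "{..M}" "\<lambda>l. a l * v l" "R (2 ^ j)"] by simp
    qed
    \<comment> \<open>Interchanging the sums counts, for each \<open>l\<close>, the scales
      \<open>j\<close> whose range contains \<open>l\<close>.\<close>
    also have "\<dots> = (\<Sum>l\<le>M. \<Sum>j<J. if l \<in> R (2 ^ j) then a l * v l else 0)" by (rule sum.swap)
    also have "\<dots> = (\<Sum>l\<le>M. real (card {j. j < J \<and> l \<in> R (2 ^ j)}) * (a l * v l))"
    proof (intro sum.cong refl)
      fix l
      have "(\<Sum>j<J. if l \<in> R (2 ^ j) then a l * v l else 0) = (\<Sum>j\<in>{..<J} \<inter> {j. l \<in> R (2 ^ j)}. a l * v l)"
        by (subst sum.inter_restrict) auto
      also have "{..<J} \<inter> {j. l \<in> R (2 ^ j)} = {j. j < J \<and> l \<in> R (2 ^ j)}" by auto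
      finally show "(\<Sum>j<J. if l \<in> R (2 ^ j) then a l * v l else 0) = real (card {j. j < J \<and> l \<in> R (2 ^ j)}) * (a l * v l)" by simp
    qed
    also have "\<dots> \<le> (\<Sum>l\<le>M. (2 * c * (c + 2) + 1) * (a l * v l))"
    proof (intro sum_mono mult_right_mono mult_nonneg_nonneg a v)
      fix l
      have "real (card {j. j < J \<and> l \<in> R (2 ^ j)}) \<le> (2 * c) * (c + 2) + 1 \<or> {j. j < J \<and> l \<in> R (2 ^ j)} = {}"
        by (rule card_dyadic_le[where y="real l"]) (use c in \<open>auto simp: R_def\<close>)
      moreover have "0 \<le> (2 * c) * (c + 2) + 1" using c by simp
      ultimately show "real (card {j. j < J \<and> l \<in> R (2 ^ j)}) \<le> 2 * c * (c + 2) + 1"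
        by (elim disjE) (assumption, simp only: card.empty of_nat_0)
    qed
    also have "\<dots> = (2 * c * (c + 2) + 1) * (\<Sum>l\<le>M. a l * v l)" by (simp add: sum_distrib_left)
    also have "\<dots> \<le> (2 * c * (c + 2) + 1) * S"
      unfolding S_def using c a v sm by (intro mult_left_mono sum_le_suminf) auto
    finally show ?thesis using Q by (simp add: mult_left_mono mult.assoc)
  qed
  have part: "(\<Sum>k<n. a k * b k) \<le> (D'' + Q * (2 * c * (c + 2) + 1)) * S" for n
  proof -
    have "(\<Sum>k<n. a k * b k) \<le> (\<Sum>k\<in>insert 0 {1..<2 ^ n}. a k * b k)"
    proof (intro sum_mono2 mult_nonneg_nonneg a b subsetI)
      fix k assume "k \<in> {..<n}"
      then have "k < 2 ^ n" using less_exp[of n] by (simp add: less_trans)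
      then show "k \<in> insert 0 {1..<2 ^ n}" by auto
    qed auto
    also have "\<dots> = a 0 * b 0 + (\<Sum>k = 1..<2 ^ n. a k * b k)" by (subst sum.insert) auto
    also have "\<dots> \<le> D'' * S + Q * (2 * c * (c + 2) + 1) * S"
    proof (intro add_mono bound)
      have "a 0 * b 0 \<le> a 0 * (D'' * v 0)" by (intro mult_left_mono zero a)
      also have "\<dots> = D'' * (\<Sum>k<1. a k * v k)" by simp
      also have "\<dots> \<le> D'' * S" unfolding S_def using a v sm D by (intro mult_left_mono sum_le_suminf) auto
      finally show "a 0 * b 0 \<le> D'' * S" .
    qed
    finally show ?thesis by (simp add: distrib_right)
  qed
  show sab: "summable (\<lambda>k. a k * b k)"
    by (rule summableI_nonneg_bounded[OF _ part]) (use a b in auto)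
  show "(\<Sum>k. a k * b k) \<le> (D'' + D * (1 + 2 * c * K0) * D' * (2 * c * (c + 2) + 1)) * (\<Sum>k. a k * v k)"
    using suminf_le_const[OF sab part] by (simp add: Q_def S_def)
qed

section \<open>Bounds for the best approximation\<close>

lemma zero_in_exp_type_bounded: "(\<lambda>_. 0) \<in> exp_type_bounded \<sigma>"
  unfolding exp_type_bounded_def by (auto intro!: exI[of _ 0])

text \<open>Boundedness is what makes the supremum meaningful. A window over which the norm of
  \<open>h\<close> is not integrable contributes the default value 0, which respects both
  bounds.\<close>

lemma stepanov_norm_bounded:
  assumes "\<And>t. norm (h t) \<le> B"
  shows "0 \<le> stepanov_norm h"
proof -
  have B0: "B \<ge> 0" using assms[of 0] norm_ge_zero order_trans by blast
  have nn: "0 \<le> (1 / pi) * integral {u..u + pi} (\<lambda>t. norm (h t))" for u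
  proof (cases "(\<lambda>t. norm (h t)) integrable_on {u..u + pi}")
    case True
    then have "0 \<le> integral {u..u + pi} (\<lambda>t. norm (h t))" by (rule Henstock_Kurzweil_Integration.integral_nonneg) simp
    then show ?thesis by simp
  qed (simp add: not_integrable_integral)
  have le: "(1 / pi) * integral {u..u + pi} (\<lambda>t. norm (h t)) \<le> B" for u
  proof (cases "(\<lambda>t. norm (h t)) integrable_on {u..u + pi}")
    case True
    then have "integral {u..u + pi} (\<lambda>t. norm (h t)) \<le> integral {u..u + pi} (\<lambda>_. B)"
      using assms by (intro Henstock_Kurzweil_Integration.integral_le) auto
    then show ?thesis by (simp add: pos_divide_le_eq mult.commute)
  qed (use B0 in \<open>simp add: not_integrable_integral\<close>)
  have "bdd_above (range (\<lambda>u. (1 / pi) * integral {u..u + pi} (\<lambda>t. norm (h t))))"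
    by (rule bdd_aboveI[of _ B]) (use le in auto)
  then show ?thesis unfolding stepanov_norm_def using nn[of 0] by (intro cSUP_upper2[of _ _ 0]) auto
qed

text \<open>The competitor 0 gives the upper bound. The two bounds together let the best
  approximation be added to \<open>w\<close> at no cost and keep the series on the right-hand side
  convergent.\<close>

lemma
  assumes f: "\<And>t. norm (f t) \<le> B"
  shows best_approx_nonneg: "0 \<le> best_approx \<sigma> f" and best_approx_le: "best_approx \<sigma> f \<le> stepanov_norm f"
proof -
  have nn: "0 \<le> stepanov_norm (\<lambda>t. f t - g (of_real t))" if "g \<in> exp_type_bounded \<sigma>" for g
  proof -
    have "bounded (range (\<lambda>t::real. g (of_real t)))" using that by (simp add: exp_type_bounded_def)
    then obtain B' where "\<And>t::real. norm (g (of_real t)) \<le> B'" by (auto simp: bounded_iff)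
    then have "norm (f t - g (of_real t)) \<le> B + B'" for t using norm_diff_mono[OF f] by blast
    then show ?thesis by (rule stepanov_norm_bounded)
  qed
  show "0 \<le> best_approx \<sigma> f" unfolding best_approx_def
    by (rule cINF_greatest) (use zero_in_exp_type_bounded nn in auto)
  have "best_approx \<sigma> f \<le> stepanov_norm (\<lambda>t. f t - (\<lambda>_. 0) (of_real t))" unfolding best_approx_def
    by (rule cINF_lower[OF _ zero_in_exp_type_bounded]) (use nn in \<open>auto intro!: bdd_belowI[of _ 0]\<close>)
  then show "best_approx \<sigma> f \<le> stepanov_norm f" by simp
qed

text \<open>The passage from quadratic means to exponents \<open>q \<le> 2\<close>: when
  \<open>b\<close> exceeds \<open>W\<close>, the ratio is larger than 1 and its power with exponent
  \<open>q\<close> is at most its square. With a fixed \<open>W\<close> on a block, a bound for the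
  sum of squares is then enough.\<close>

lemma powr_le_one_plus_square:
  fixes b W q :: real
  assumes "b \<ge> 0" "W > 0" "0 < q" "q \<le> 2"
  shows "b powr q \<le> W powr q * (1 + (b / W)\<^sup>2)"
proof (cases "b \<le> W")
  case True
  then have "b powr q \<le> W powr q" using assms by (intro powr_mono2) auto
  also have "\<dots> \<le> W powr q * (1 + (b / W)\<^sup>2)" using assms by (simp add: mult_ge1_I distrib_left)
  finally show ?thesis .
next
  case False
  then have r: "b / W \<ge> 1" using assms by (simp add: pos_le_divide_eq)
  have "b powr q = W powr q * (b / W) powr q" using assms by (simp add: powr_divide)
  also have "(b / W) powr q \<le> (b / W) powr 2" using r assms by (intro powr_mono) auto
  also have "(b / W) powr 2 = (b / W)\<^sup>2" using r by (simp add: powr_numeral)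
  also have "W powr q * (b / W)\<^sup>2 \<le> W powr q * (1 + (b / W)\<^sup>2)" by (intro mult_left_mono) auto
  finally show ?thesis using assms by (simp add: mult_left_mono)
qed

subsection \<open>Strong approximation\<close>

text \<open>The gap is known for some enumeration \<open>lam'\<close>. It carries over because every
  positive exponent in \<open>lam\<close> has a nonzero coefficient at itself or at its negative,
  and therefore occurs in \<open>lam'\<close>.\<close>

lemma fourier_exponents_gap:
  assumes lam: "fourier_exponents f lam" and lam': "fourier_exponents f lam'"
    and gap: "\<And>\<nu>. \<nu> \<ge> 1 \<Longrightarrow> lam' (\<nu> + 1) - lam' \<nu> \<ge> \<alpha>"
    and \<nu>: "1 \<le> \<nu>" "1 \<le> \<mu>" "lam \<nu> < lam \<mu>"
  shows "lam \<nu> + \<alpha> \<le> lam \<mu>"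
proof -
  have ran: "\<exists>\<nu>'\<ge>1. lam' \<nu>' = lam \<nu>" if "\<nu> \<ge> 1" for \<nu>
  proof -
    have pos: "lam \<nu> > 0" and "norm (fourier_coeff f (lam \<nu>)) + norm (fourier_coeff f (lam (- \<nu>))) > 0"
      using lam that by (auto simp: fourier_exponents_def)
    then have "fourier_coeff f (lam \<nu>) \<noteq> 0 \<or> fourier_coeff f (- lam \<nu>) \<noteq> 0"
      using lam by (auto simp: fourier_exponents_def)
    then have "lam \<nu> \<in> range lam' \<or> - lam \<nu> \<in> range lam'" using lam' unfolding fourier_exponents_def by blast
    moreover have neg: "lam' (- \<nu>') = - lam' \<nu>'" for \<nu>' using lam' by (simp add: fourier_exponents_def)
    ultimately obtain \<nu>' where \<nu>': "lam' \<nu>' = lam \<nu>" by (metis (no_types, opaque_lifting) imageE minus_minus)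
    have "lam' 0 < lam' \<nu>'" using pos \<nu>' lam' by (simp add: fourier_exponents_def)
    then have "0 < \<nu>'" using strict_mono_less[OF fourier_exponents_strict_mono[OF lam']] by blast
    with \<nu>' show ?thesis by (intro exI[of _ \<nu>']) auto
  qed
  obtain i where i: "i \<ge> 1" "lam' i = lam \<nu>" using ran[OF \<nu>(1)] by blast
  obtain j where j: "j \<ge> 1" "lam' j = lam \<mu>" using ran[OF \<nu>(2)] by blast
  note mono = fourier_exponents_strict_mono[OF lam']
  have "lam' i < lam' j" using i j \<nu> by simp
  then have "i + 1 \<le> j" using strict_mono_less[OF mono] by simp
  then have "lam' (i + 1) \<le> lam' j" using strict_mono_less_eq[OF mono] by blast
  then show ?thesis using gap[OF i(1)] i j by simp
qed

lemma fourier_exponents_abs_ge: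
  assumes "fourier_exponents f lam" "\<bar>lam \<nu>\<bar> > 0"
  shows "\<exists>\<mu>\<ge>1. \<bar>lam \<nu>\<bar> = lam \<mu>"
proof -
  have 0: "lam 0 = 0" and pos: "\<And>\<nu>. \<nu> \<ge> 1 \<Longrightarrow> 0 < lam \<nu>" and neg: "\<And>\<nu>. lam (- \<nu>) = - lam \<nu>"
    using assms(1) by (auto simp: fourier_exponents_def)
  consider "\<nu> \<ge> 1" | "\<nu> = 0" | "- \<nu> \<ge> 1" by linarith
  then show ?thesis
  proof cases
    case 1 then show ?thesis using pos[of \<nu>] by (intro exI[of _ \<nu>]) auto
  next
    case 2 then show ?thesis using assms(2) 0 by simp
  next
    case 3 then show ?thesis using pos[of "- \<nu>"] neg[of \<nu>] by (intro exI[of _ "- \<nu>"]) auto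
  qed
qed

text \<open>An interval of length \<open>\<alpha>\<close> contains at most one positive exponent, so one of the two halves of
  \<open>{\<alpha> * k / 2 - \<alpha> / 2<..<\<alpha> * k / 2 + \<alpha> / 2}\<close> is free of exponents.\<close>

lemma exponent_free_window:
  assumes lam: "fourier_exponents f lam" and lam': "fourier_exponents f lam'"
    and gap: "\<And>\<nu>. \<nu> \<ge> 1 \<Longrightarrow> lam' (\<nu> + 1) - lam' \<nu> \<ge> \<alpha>" and \<alpha>: "\<alpha> > 0" and k: "k \<ge> 1"
  shows "(\<forall>\<nu>. \<not> (\<alpha> * real k / 2 < \<bar>lam \<nu>\<bar> \<and> \<bar>lam \<nu>\<bar> < \<alpha> * (real k + 1) / 2)) \<or>
    (\<forall>\<nu>. \<not> (\<alpha> * (real k - 1) / 2 < \<bar>lam \<nu>\<bar> \<and> \<bar>lam \<nu>\<bar> \<le> \<alpha> * real k / 2))"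
proof (rule ccontr)
  assume "\<not> ?thesis"
  then obtain \<nu> \<mu> where \<nu>: "\<alpha> * real k / 2 < \<bar>lam \<nu>\<bar>" "\<bar>lam \<nu>\<bar> < \<alpha> * (real k + 1) / 2"
    and \<mu>: "\<alpha> * (real k - 1) / 2 < \<bar>lam \<mu>\<bar>" "\<bar>lam \<mu>\<bar> \<le> \<alpha> * real k / 2" by blast
  have nn: "\<alpha> * real k / 2 \<ge> 0" "\<alpha> * (real k - 1) / 2 \<ge> 0" using \<alpha> k by auto
  obtain \<nu>' where \<nu>': "\<nu>' \<ge> 1" "\<bar>lam \<nu>\<bar> = lam \<nu>'" using fourier_exponents_abs_ge[OF lam, of \<nu>] \<nu> nn by fastforce
  obtain \<mu>' where \<mu>': "\<mu>' \<ge> 1" "\<bar>lam \<mu>\<bar> = lam \<mu>'" using fourier_exponents_abs_ge[OF lam, of \<mu>] \<mu> nn by fastforce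
  have "lam \<mu>' < lam \<nu>'" using \<nu> \<mu> \<nu>' \<mu>' by simp
  from fourier_exponents_gap[OF lam lam' gap \<mu>'(1) \<nu>'(1) this]
  have "\<bar>lam \<mu>\<bar> + \<alpha> \<le> \<bar>lam \<nu>\<bar>" using \<nu>' \<mu>' by simp
  moreover have "\<alpha> * (real k + 1) / 2 = \<alpha> * (real k - 1) / 2 + \<alpha>" by (simp add: field_simps)
  ultimately show False using \<nu> \<mu> by linarith
qed

text \<open>Only finitely many exponents have modulus up to \<open>\<kappa> + 1\<close>, so some
  window to the right of \<open>\<kappa>\<close> is free, with no control of its length. That
  suffices when \<open>w pi = 0\<close>, where the kernel is integrated against a function vanishing
  almost everywhere.\<close>

lemma exponent_free_right_window:
  assumes "fourier_exponents f lam"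
  shows "\<exists>\<eta>>\<kappa>. \<forall>\<nu>. \<not> (\<kappa> < \<bar>lam \<nu>\<bar> \<and> \<bar>lam \<nu>\<bar> < \<eta>)"
proof -
  define A where "A = insert (\<kappa> + 1) ((\<lambda>\<nu>. \<bar>lam \<nu>\<bar>) ` {\<nu>. \<bar>lam \<nu>\<bar> \<le> \<kappa> + 1} \<inter> {\<kappa><..})"
  have A: "finite A" "A \<noteq> {}" using fourier_exponents_finite[OF assms] by (auto simp: A_def)
  have "Min A \<in> A" using A by (rule Min_in)
  then have "Min A > \<kappa>" by (auto simp: A_def)
  moreover have "\<not> (\<kappa> < \<bar>lam \<nu>\<bar> \<and> \<bar>lam \<nu>\<bar> < Min A)" for \<nu>
  proof
    assume \<nu>: "\<kappa> < \<bar>lam \<nu>\<bar> \<and> \<bar>lam \<nu>\<bar> < Min A"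
    have "Min A \<le> \<kappa> + 1" using A by (intro Min_le) (auto simp: A_def)
    then have "\<bar>lam \<nu>\<bar> \<in> A" using \<nu> by (auto simp: A_def)
    then have "Min A \<le> \<bar>lam \<nu>\<bar>" using A by (intro Min_le) auto
    then show False using \<nu> by simp
  qed
  ultimately show ?thesis by blast
qed

text \<open>The constant may depend on \<open>f\<close>, \<open>x\<close> and \<open>w\<close>.  Hence the second condition of \<open>Omega12\<close> with arbitrarily
  long means already controls the contribution of large \<open>t\<close>, and no best approximation enters here.\<close>

lemma deviation_block:
  assumes \<alpha>: "\<alpha> > 0" and w: "modulus_type w" and f: "f \<in> Omega12 \<alpha> x w" and lam: "fourier_exponents f lam"
  shows "w pi = 0 \<Longrightarrow> partial_sum lam (\<alpha> * real k / 2) f x = f x"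
    and "w pi > 0 \<Longrightarrow> \<exists>D\<ge>0. \<forall>m\<ge>1. (\<Sum>k = m..2 * m - 1. (norm (partial_sum lam (\<alpha> * real k / 2) f x - f x))\<^sup>2)
      \<le> D * real m * (w (pi / real m))\<^sup>2"
proof -
  obtain C where C: "C > 0" and C_all: "\<And>\<gamma> \<delta>. \<gamma> > 0 \<Longrightarrow> \<delta> > 0 \<Longrightarrow>
      (1 / \<delta>) * integral {0..\<delta>} (\<lambda>t. norm (phi f x t - phi f x (t + \<gamma>))) \<le> C * w \<gamma> \<and> G21 \<alpha> f x \<delta> \<le> C * w \<delta>"
    using f unfolding Omega12_def by blast
  have smooth: "(1 / \<delta>) * integral {0..\<delta>} (\<lambda>t. norm (phi f x t - phi f x (t + \<gamma>))) \<le> C * w \<gamma>" if "\<gamma> > 0" "\<delta> > 0" for \<gamma> \<delta>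
    using C_all[OF that] by blast
  have G: "G21 \<alpha> f x \<delta> \<le> C * w \<delta>" if "\<delta> > 0" for \<delta> using C_all[of 1 \<delta>] that by simp
  have f1: "f \<in> Omega1 \<alpha>" using f by (simp add: Omega12_def)
  then obtain lam' where f_ap: "f \<in> stepanov_ap" and "bounded (range f)" and lam': "fourier_exponents f lam'"
    and gap: "\<And>\<nu>. \<nu> \<ge> 1 \<Longrightarrow> lam' (\<nu> + 1) - lam' \<nu> \<ge> \<alpha>" by (auto simp: Omega1_def)
  obtain B where B: "\<And>t. norm (f t) \<le> B" using \<open>bounded (range f)\<close> by (auto simp: bounded_iff)
  have ai: "\<And>a b. f absolutely_integrable_on {a..b}" using f_ap by (simp add: stepanov_ap_def)
  obtain g N where g: "g \<in> borel_measurable borel" "\<And>t. norm (g t) \<le> B" "N \<in> null_sets lborel" "\<And>t. t \<notin> N \<Longrightarrow> g t = f t"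
    using ex_borel_version[OF ai B] by blast
  interpret stepanov_borel f g B N by unfold_locales (use f_ap g in auto)
  \<comment> \<open>The value at the centre is that of \<open>f\<close> and not of \<open>g\<close>,
    so \<open>p\<close> agrees with \<open>phi f x\<close> almost everywhere even if
    \<open>x\<close> lies in \<open>N\<close>.\<close>
  define p where "p t = g (x + t) + g (x - t) - 2 * f x" for t
  have p_meas[measurable]: "p \<in> borel_measurable borel" unfolding p_def by measurable
  have p_le: "norm (p t) \<le> 4 * B" for t
  proof -
    have "norm (p t) \<le> (B + B) + 2 * B" unfolding p_def
      by (intro norm_diff_mono norm_add_mono g_le) (simp add: norm_mult B)
    then show ?thesis by simp
  qed
  define N' where "N' = {t. x + 1 * t \<in> N} \<union> {t. x + (- 1) * t \<in> N}"
  have N': "N' \<in> null_sets lborel" unfolding N'_def by (intro null_sets.Un null_sets_affine N) auto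
  have p_eq: "phi f x t = p t" if "t \<notin> N'" for t using that g_eq by (auto simp: N'_def phi_def p_def)
  have smooth': "(1 / \<delta>) * integral {0..\<delta>} (\<lambda>t. norm (p t - p (t + \<gamma>))) \<le> C * w \<gamma>" if "\<gamma> > 0" "\<delta> > 0" for \<gamma> \<delta>
  proof -
    have "{t. \<gamma> + 1 * t \<in> N'} \<in> null_sets lborel" by (rule null_sets_affine[OF N']) simp
    then have "negligible (N' \<union> {t. \<gamma> + 1 * t \<in> N'})" by (intro negligible_Un negligible_null_set N')
    then have "integral {0..\<delta>} (\<lambda>t. norm (phi f x t - phi f x (t + \<gamma>))) = integral {0..\<delta>} (\<lambda>t. norm (p t - p (t + \<gamma>)))"
      by (rule integral_spike) (auto simp: p_eq add.commute)
    then show ?thesis using smooth[OF that] by simp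
  qed
  have int_phi: "integral {a..b} (\<lambda>t. norm (phi f x t)) = integral {a..b} (\<lambda>t. norm (p t))" for a b
    by (rule integral_spike[OF negligible_null_set[OF N']]) (auto simp: p_eq)
  have G': "sqrt (\<Sum>k = 0..nat \<lfloor>pi / (\<alpha> * \<delta>)\<rfloor>.
       ((1 / ((real k + 1) * \<delta>)) * integral {real k * \<delta>..(real k + 1) * \<delta>} (\<lambda>t. norm (p t)))\<^sup>2) \<le> C * w \<delta>" if "\<delta> > 0" for \<delta>
    using G[OF that] unfolding G21_def int_phi .
  have dev: "partial_sum lam \<kappa> f x - f x = (LINT t|lborel. indicator {0..} t *\<^sub>R (of_real (vp_kernel \<kappa> \<eta> t) * p t))"
    if "0 \<le> \<kappa>" "\<kappa> < \<eta>" "\<And>\<nu>. \<not> (\<kappa> < \<bar>lam \<nu>\<bar> \<and> \<bar>lam \<nu>\<bar> < \<eta>)" for \<kappa> \<eta>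
    unfolding p_def by (rule partial_sum_deviation[OF lam that])
  show "partial_sum lam (\<alpha> * real k / 2) f x = f x" if w0: "w pi = 0"
  proof -
    \<comment> \<open>By subadditivity \<open>w\<close> vanishes on the whole half-line, and with it
      the first term of \<open>G21\<close> for every \<open>\<delta>\<close>.\<close>
    have p0: "integral {0..\<delta>} (\<lambda>t. norm (p t)) = 0" if \<delta>: "\<delta> > 0" for \<delta>
    proof -
      have "w \<delta> \<le> (\<delta> / pi + 1) * w pi" using \<delta> by (intro modulus_scale_le[OF w]) auto
      then have "w \<delta> \<le> 0" using w0 by simp
      then have "C * w \<delta> \<le> 0" using C by (simp add: mult_nonneg_nonpos)
      let ?h = "\<lambda>k. ((1 / ((real k + 1) * \<delta>)) * integral {real k * \<delta>..(real k + 1) * \<delta>} (\<lambda>t. norm (p t)))\<^sup>2"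
      have "?h 0 \<le> (\<Sum>k = 0..nat \<lfloor>pi / (\<alpha> * \<delta>)\<rfloor>. ?h k)" by (rule member_le_sum) auto
      moreover have "(\<Sum>k = 0..nat \<lfloor>pi / (\<alpha> * \<delta>)\<rfloor>. ?h k) \<le> 0" using G'[OF \<delta>] \<open>C * w \<delta> \<le> 0\<close> by (meson order_trans real_sqrt_le_0_iff)
      ultimately have "?h 0 \<le> 0" by linarith
      then show ?thesis using \<delta> by simp
    qed
    have "AE t in lborel. \<forall>n. indicator {0..real (Suc n)} t *\<^sub>R norm (p t) = 0"
    proof (subst AE_all_countable, intro allI)
      fix n
      have i: "integrable lborel (\<lambda>t. indicator {0..real (Suc n)} t *\<^sub>R norm (p t))"
        by (rule integrable_window[where B="4 * B"]) (use p_le in auto)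
      have "(LINT t|lborel. indicator {0..real (Suc n)} t *\<^sub>R norm (p t)) = 0"
      proof -
        have "(LINT t|lborel. indicator {0..real (Suc n)} t *\<^sub>R norm (p t)) = integral {0..real (Suc n)} (\<lambda>t. norm (p t))"
          by (rule integral_eq_lborel[symmetric, where B="4 * B"]) (use p_le in auto)
        also have "\<dots> = 0" by (rule p0) simp
        finally show ?thesis .
      qed
      then show "AE t in lborel. indicator {0..real (Suc n)} t *\<^sub>R norm (p t) = 0"
        using integral_nonneg_eq_0_iff_AE[OF i] by simp
    qed
    then have ae: "AE t in lborel. indicator {0..} t *\<^sub>R (of_real (vp_kernel \<kappa> \<eta> t) * p t) = 0" for \<kappa> \<eta>
    proof eventually_elim
      case (elim t)
      show ?case
      proof (cases "t \<ge> 0")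
        case True
        obtain n where "t \<le> real n" using real_arch_simple by blast
        then have "t \<in> {0..real (Suc n)}" using True by auto
        then show ?thesis using elim[rule_format, of n] by simp
      qed simp
    qed
    have nn: "\<alpha> * real k / 2 \<ge> 0" using \<alpha> by simp
    obtain \<eta> where \<eta>: "\<eta> > \<alpha> * real k / 2" "\<And>\<nu>. \<not> (\<alpha> * real k / 2 < \<bar>lam \<nu>\<bar> \<and> \<bar>lam \<nu>\<bar> < \<eta>)"
      using exponent_free_right_window[OF lam, of "\<alpha> * real k / 2"] by blast
    have "partial_sum lam (\<alpha> * real k / 2) f x - f x = 0"
      unfolding dev[OF nn \<eta>] by (rule integral_eq_zero_AE[OF ae])
    then show ?thesis by simp
  qed
  show "\<exists>D\<ge>0. \<forall>m\<ge>1. (\<Sum>k = m..2 * m - 1. (norm (partial_sum lam (\<alpha> * real k / 2) f x - f x))\<^sup>2)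
      \<le> D * real m * (w (pi / real m))\<^sup>2" if wp: "w pi > 0"
  proof -
    interpret L: local_modulus p \<alpha> C "4 * B" w
      by unfold_locales (use \<alpha> w wp p_meas p_le smooth' G' in auto)
    \<comment> \<open>If the window to the right of \<open>\<alpha> * real k / 2\<close> is free,
      its kernel represents the deviation. Otherwise the window to the left is free, including its
      right end point, so the partial sums for \<open>k\<close> and \<open>k - 1\<close> coincide
      and the kernel of the left window is used.\<close>
    have V: "norm (partial_sum lam (\<alpha> * real k / 2) f x - f x) = norm (L.V k) \<or>
      norm (partial_sum lam (\<alpha> * real k / 2) f x - f x) = norm (L.V (k - 1))" if k: "k \<ge> 1" for k
      using exponent_free_window[OF lam lam' gap \<alpha> k]
    proof
      assume free: "\<forall>\<nu>. \<not> (\<alpha> * real k / 2 < \<bar>lam \<nu>\<bar> \<and> \<bar>lam \<nu>\<bar> < \<alpha> * (real k + 1) / 2)"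
      have "partial_sum lam (\<alpha> * real k / 2) f x - f x = L.V k"
        unfolding L.V_def L.vp_window_def by (rule dev) (use \<alpha> free in \<open>auto simp: divide_strict_right_mono\<close>)
      then show ?thesis by simp
    next
      assume free: "\<forall>\<nu>. \<not> (\<alpha> * (real k - 1) / 2 < \<bar>lam \<nu>\<bar> \<and> \<bar>lam \<nu>\<bar> \<le> \<alpha> * real k / 2)"
      have k1: "real (k - 1) = real k - 1" using k by simp
      have "{\<nu>. \<bar>lam \<nu>\<bar> \<le> \<alpha> * real k / 2} = {\<nu>. \<bar>lam \<nu>\<bar> \<le> \<alpha> * real (k - 1) / 2}"
      proof -
        have "\<alpha> * (real k - 1) / 2 \<le> \<alpha> * real k / 2" using \<alpha> by (intro divide_right_mono mult_left_mono) auto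
        then show ?thesis unfolding k1 using free by (auto intro: order_trans simp: not_less)
      qed
      then have "partial_sum lam (\<alpha> * real k / 2) f x - f x = partial_sum lam (\<alpha> * real (k - 1) / 2) f x - f x"
        by (simp add: partial_sum_def)
      also have "\<dots> = L.V (k - 1)"
        unfolding L.V_def L.vp_window_def
      proof (rule dev)
        show "\<not> (\<alpha> * real (k - 1) / 2 < \<bar>lam \<nu>\<bar> \<and> \<bar>lam \<nu>\<bar> < \<alpha> * (real (k - 1) + 1) / 2)" for \<nu>
          using free unfolding k1 by (auto simp: less_imp_le)
      qed (use \<alpha> in \<open>auto simp: divide_strict_right_mono\<close>)
      finally show ?thesis by simp
    qed
    define H where "H = 3 * (258 * (C * (1 / \<alpha> + 1))\<^sup>2 + 2 * L.tail_const\<^sup>2)"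
    define D where "D = 2 * H"
    have "(\<Sum>k = m..2 * m - 1. (norm (partial_sum lam (\<alpha> * real k / 2) f x - f x))\<^sup>2) \<le> D * real m * (w (pi / real m))\<^sup>2"
      if m: "m \<ge> 1" for m
    proof -
      define S where "S = (\<Sum>k\<in>{m - 1..2 * m - 1}. (norm (L.V k))\<^sup>2)"
      have "(\<Sum>k = m..2 * m - 1. (norm (partial_sum lam (\<alpha> * real k / 2) f x - f x))\<^sup>2)
        \<le> (\<Sum>k = m..2 * m - 1. (norm (L.V k))\<^sup>2 + (norm (L.V (k - 1)))\<^sup>2)"
      proof (intro sum_mono)
        fix k assume "k \<in> {m..2 * m - 1}"
        then have "k \<ge> 1" using m by simp
        from V[OF this] show "(norm (partial_sum lam (\<alpha> * real k / 2) f x - f x))\<^sup>2 \<le> (norm (L.V k))\<^sup>2 + (norm (L.V (k - 1)))\<^sup>2" by auto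
      qed
      also have "\<dots> = (\<Sum>k = m..2 * m - 1. (norm (L.V k))\<^sup>2) + (\<Sum>k = m..2 * m - 1. (norm (L.V (k - 1)))\<^sup>2)" by (rule sum.distrib)
      also have "\<dots> \<le> S + S"
      proof (intro add_mono)
        show "(\<Sum>k = m..2 * m - 1. (norm (L.V k))\<^sup>2) \<le> S" unfolding S_def by (intro sum_mono2) auto
        have "(\<Sum>k = m..2 * m - 1. (norm (L.V (k - 1)))\<^sup>2) = (\<Sum>k\<in>(\<lambda>k. k - 1) ` {m..2 * m - 1}. (norm (L.V k))\<^sup>2)"
          using m by (subst sum.reindex) (auto simp: inj_on_def)
        also have "\<dots> \<le> S" unfolding S_def by (intro sum_mono2) auto
        finally show "(\<Sum>k = m..2 * m - 1. (norm (L.V (k - 1)))\<^sup>2) \<le> S" .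
      qed
      also have "\<dots> \<le> D * real m * (w (pi / real m))\<^sup>2"
      proof -
        have "S \<le> H * real m * (w (pi / real m))\<^sup>2" unfolding S_def H_def using L.V_block[OF m refl] C by simp
        then have "S + S \<le> 2 * (H * real m * (w (pi / real m))\<^sup>2)" by linarith
        then show ?thesis by (simp only: D_def mult.assoc)
      qed
      finally show ?thesis .
    qed
    moreover have "D \<ge> 0" by (simp add: D_def H_def)
    ultimately show ?thesis by blast
  qed
qed

theorem theorem5:
  fixes \<alpha> q x c K0 :: real
    and w :: "real \<Rightarrow> real"
    and f :: "real \<Rightarrow> complex"
    and lam :: "int \<Rightarrow> real"
    and a :: "nat \<Rightarrow> nat \<Rightarrow> real"
  assumes "\<alpha> > 0" and "0 < q" and "q \<le> 2"
    and "modulus_type w"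
    and "f \<in> Omega12 \<alpha> x w"
    and "fourier_exponents f lam"
    and "\<And>n k. a n k \<ge> 0"
    and "\<And>n. a n sums 1"
    and "(\<lambda>n. a n 0) \<longlonglongrightarrow> 0"
    and "c > 1" and "K0 > 0"
    and "\<And>n. a n \<in> GM_2beta c K0"
  shows "\<exists>K>0. \<forall>n.
    summable (\<lambda>k. a n k * norm (partial_sum lam (\<alpha> * real k / 2) f x - f x) powr q) \<and>
    summable (\<lambda>k. a n k * (w (pi / (real k + 1))
      + best_approx (\<alpha> * real k / 2 ^ (1 + nat \<lfloor>c\<rfloor>)) f) powr q) \<and>
    (\<Sum>k. a n k * norm (partial_sum lam (\<alpha> * real k / 2) f x - f x) powr q) powr (1 / q)
      \<le> K * (\<Sum>k. a n k * (w (pi / (real k + 1))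
        + best_approx (\<alpha> * real k / 2 ^ (1 + nat \<lfloor>c\<rfloor>)) f) powr q) powr (1 / q)"
proof -
  define b where "b k = norm (partial_sum lam (\<alpha> * real k / 2) f x - f x)" for k
  define E where "E k = best_approx (\<alpha> * real k / 2 ^ (1 + nat \<lfloor>c\<rfloor>)) f" for k
  define v where "v k = (w (pi / (real k + 1)) + E k) powr q" for k
  note \<alpha> = \<open>\<alpha> > 0\<close> and q = \<open>0 < q\<close> \<open>q \<le> 2\<close> and w = \<open>modulus_type w\<close>
  have w0: "w y \<ge> 0" if "y \<ge> 0" for y using w that by (simp add: modulus_type_def)
  obtain B where B: "\<And>t. norm (f t) \<le> B"
    using assms(5) by (auto simp: Omega12_def Omega1_def bounded_iff)
  have E0: "E k \<ge> 0" and E_le: "E k \<le> stepanov_norm f" for k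
    unfolding E_def by (rule best_approx_nonneg[OF B], rule best_approx_le[OF B])
  have w_le: "w (pi / (real k + 1)) \<le> w pi" for k
  proof -
    have "mono_on {0..} w" using w by (simp add: modulus_type_def)
    moreover have "pi / (real k + 1) \<le> pi" by (simp add: divide_le_eq)
    ultimately show ?thesis by (intro mono_onD[of "{0..}" w]) auto
  qed
  have v_nonneg: "v k \<ge> 0" for k by (simp add: v_def)
  have v_le: "v k \<le> (w pi + stepanov_norm f) powr q" for k
    unfolding v_def using q E0[of k] w0[of "pi / (real k + 1)"] by (intro powr_mono2 add_mono w_le E_le) auto
  have sm: "summable (\<lambda>k. a n k * v k)" for n
  proof (rule summable_comparison_test')
    show "summable (\<lambda>k. a n k * (w pi + stepanov_norm f) powr q)"
      using assms(8)[of n] by (intro summable_mult2) (auto simp: sums_iff)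
    show "norm (a n k * v k) \<le> a n k * (w pi + stepanov_norm f) powr q" if "k \<ge> 0" for k
      using assms(7)[of n k] v_nonneg[of k] v_le[of k] by (simp add: abs_mult mult_left_mono)
  qed
  \<comment> \<open>Of the matrix only \<open>c\<close> and \<open>K0\<close> enter
    \<open>M\<close>, which makes the estimate uniform in \<open>n\<close>.\<close>
  have "\<exists>M\<ge>0. \<forall>n. summable (\<lambda>k. a n k * b k powr q) \<and> (\<Sum>k. a n k * b k powr q) \<le> M * (\<Sum>k. a n k * v k)"
  proof (cases "w pi = 0")
    case True
    then have "b k = 0" for k using deviation_block(1)[OF \<alpha> w assms(5,6)] by (simp add: b_def)
    then show ?thesis by (intro exI[of _ 0]) simp
  next
    case False
    then have wp: "w pi > 0" using w0[of pi] by simp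
    obtain D where D: "D \<ge> 0" "\<And>m. m \<ge> 1 \<Longrightarrow> (\<Sum>k = m..2 * m - 1. (b k)\<^sup>2) \<le> D * real m * (w (pi / real m))\<^sup>2"
      using deviation_block(2)[OF \<alpha> w assms(5,6) wp] unfolding b_def by blast
    \<comment> \<open>At index 0 the right-hand side contains \<open>w pi\<close> itself, so a
      constant ratio suffices.\<close>
    define D'' where "D'' = (b 0 / w pi) powr q"
    \<comment> \<open>For \<open>l\<close> up to \<open>(c + 2) * m\<close> the argument
      \<open>pi / m\<close> is at most \<open>c + 3\<close> times \<open>pi / (l + 1)\<close>, and
      \<open>modulus_scale_le\<close> adds 1.\<close>
    define D' where "D' = (c + 4) powr q"
    define M where "M = D'' + (1 + D) * (1 + 2 * c * K0) * D' * (2 * c * (c + 2) + 1)"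
    have block: "(\<Sum>k = m..2 * m - 1. b k powr q) \<le> (1 + D) * real m * w (pi / real m) powr q" if m: "m \<ge> 1" for m
    proof -
      define W where "W = w (pi / real m)"
      have "w pi \<le> real m * W" unfolding W_def using modulus_mult_le[OF w, of "pi / real m" m] m by simp
      then have W: "W > 0" using wp m w0[of "pi / real m"] by (cases "W = 0") (auto simp: W_def)
      have "(\<Sum>k = m..2 * m - 1. b k powr q) \<le> (\<Sum>k = m..2 * m - 1. W powr q * (1 + (b k / W)\<^sup>2))"
        using W q by (intro sum_mono powr_le_one_plus_square) (auto simp: b_def)
      also have "\<dots> = W powr q * (real m + (\<Sum>k = m..2 * m - 1. (b k)\<^sup>2) / W\<^sup>2)"
        using m by (simp add: sum_distrib_left[symmetric] sum.distrib power_divide sum_divide_distrib[symmetric] of_nat_diff)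
      also have "\<dots> \<le> W powr q * (real m + D * real m)"
      proof (intro mult_left_mono add_mono order_refl)
        show "(\<Sum>k = m..2 * m - 1. (b k)\<^sup>2) / W\<^sup>2 \<le> D * real m" using D(2)[OF m] W by (simp add: W_def pos_divide_le_eq)
      qed simp
      finally show ?thesis by (simp add: W_def algebra_simps)
    qed
    have comp: "w (pi / real m) powr q \<le> D' * v l" if m: "m \<ge> 1" and l: "real l \<le> (c + 2) * real m" for m l
    proof -
      have "real l + 1 \<le> (c + 3) * real m" using l m by (simp add: algebra_simps)
      then have "(real l + 1) / real m \<le> c + 3" using m by (simp add: pos_divide_le_eq)
      then have "(real l + 1) / real m * (pi / (real l + 1)) \<le> (c + 3) * (pi / (real l + 1))" by (intro mult_right_mono) auto
      then have "pi / real m \<le> (c + 3) * (pi / (real l + 1))" by (simp add: add_nonneg_eq_0_iff)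
      then have "w (pi / real m) \<le> ((c + 3) + 1) * w (pi / (real l + 1))"
        using assms(10) m by (intro modulus_scale_le[OF w]) auto
      also have "\<dots> = (c + 4) * w (pi / (real l + 1))" by simp
      also have "\<dots> \<le> (c + 4) * (w (pi / (real l + 1)) + E l)" using E0[of l] assms(10) by (intro mult_left_mono) auto
      finally have "w (pi / real m) powr q \<le> ((c + 4) * (w (pi / (real l + 1)) + E l)) powr q"
        using q w0[of "pi / real m"] by (intro powr_mono2) auto
      also have "\<dots> = D' * v l" unfolding D'_def v_def by (rule powr_mult)
      finally show ?thesis .
    qed
    have zero: "b 0 powr q \<le> D'' * v 0"
    proof -
      have "b 0 powr q = (b 0 / w pi * w pi) powr q" using wp by simp
      also have "\<dots> = D'' * w pi powr q" unfolding D''_def by (rule powr_mult)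
      also have "w pi powr q \<le> v 0" unfolding v_def using wp q E0[of 0] by (intro powr_mono2) auto
      finally show ?thesis by (simp add: D''_def mult_left_mono)
    qed
    have "M \<ge> 0" unfolding M_def D'_def D''_def using D(1) assms(10,11) by (intro add_nonneg_nonneg mult_nonneg_nonneg) auto
    moreover have "summable (\<lambda>k. a n k * b k powr q)" "(\<Sum>k. a n k * b k powr q) \<le> M * (\<Sum>k. a n k * v k)" for n
      using GM_2beta_sum_le[of "a n" c K0 "\<lambda>k. b k powr q" v "\<lambda>m. w (pi / real m) powr q" "1 + D" D' D'',
        OF assms(7,10,11,12) _ v_nonneg _ _ _ _ block comp zero sm] D(1)
      unfolding M_def by (auto simp: D'_def D''_def)
    ultimately show ?thesis by blast
  qed
  then obtain M where M: "M \<ge> 0" "\<And>n. summable (\<lambda>k. a n k * b k powr q)"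
    "\<And>n. (\<Sum>k. a n k * b k powr q) \<le> M * (\<Sum>k. a n k * v k)" by blast
  \<comment> \<open>Adding 1 keeps the final constant positive also when
    \<open>M = 0\<close>.\<close>
  have "(\<Sum>k. a n k * b k powr q) powr (1 / q) \<le> (M + 1) powr (1 / q) * (\<Sum>k. a n k * v k) powr (1 / q)" for n
  proof -
    have S: "(\<Sum>k. a n k * v k) \<ge> 0" using assms(7) v_nonneg by (intro suminf_nonneg sm) auto
    have "(\<Sum>k. a n k * b k powr q) \<ge> 0" using assms(7) by (intro suminf_nonneg M(2)) auto
    moreover have "(\<Sum>k. a n k * b k powr q) \<le> (M + 1) * (\<Sum>k. a n k * v k)" using M(3)[of n] S by (simp add: distrib_right)
    ultimately have "(\<Sum>k. a n k * b k powr q) powr (1 / q) \<le> ((M + 1) * (\<Sum>k. a n k * v k)) powr (1 / q)"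
      using q by (intro powr_mono2) auto
    also have "\<dots> = (M + 1) powr (1 / q) * (\<Sum>k. a n k * v k) powr (1 / q)" by (rule powr_mult)
    finally show ?thesis .
  qed
  moreover have "(M + 1) powr (1 / q) > 0" using M(1) by simp
  ultimately show ?thesis using M(2) sm unfolding b_def v_def E_def by blast
qed

end
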